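(* Let $\mathfrak M$ be the variety of associative algebras defined by the identity $[x,y,z]=0$. Let $n\geq 1$ and $0\leq k\leq n-1$. All consequences of higher degree of $S_{k+1}(x_1,\ldots,x_{k+1})x_1^{n-k-1}$ in $F(\mathfrak M)$ are equivalent to the identities $$\varepsilon S_k(x_1,\ldots,x_k)x_1^{n-k+1},\quad S_{k+1}(x_1,\ldots,x_{k+1})x_1^{n-k},$$ $$S_{k+2}(x_1,\ldots,x_{k+2})x_1^{n-k-1},\quad S_{k+3}(x_1,\ldots,x_{k+3})x_1^{n-k-2},$$ where $\varepsilon=1$ if $k$ is even and $\varepsilon=0$ if $k$ is odd. Here the first polynomial is omitted from the list if $k=0$, and the last one is omitted if $k=n-1$.
   Context: $K$ is a field of characteristic $0$; algebras are associative $K$-algebras, not necessarily unital. $A=K\langle x_1,x_2,\ldots\rangle$ is the free non-unitary associative algebra (the letters $x,y,z,\ldots$ also denote distinct free generators). For a variety $\mathfrak M$, $T(\mathfrak M)\subset A$ is the T-ideal of its polynomial identities and $F(\mathfrak M)=A/T(\mathfrak M)$ is the relatively free algebra. $[x,y]=xy-yx$, $[x,y,z]=[[x,y],z]$, and $S_n(x_1,\ldots,x_n)=\sum_{\sigma\in S_n}(-1)^\sigma x_{\sigma(1)}\cdots x_{\sigma(n)}$ (so $S_1(x_1)=x_1$). A factor $x_1^0$ is simply omitted. For $f$ homogeneous of degree $n$, its consequences of higher degree in $F(\mathfrak M)$ are the elements of the T-ideal of $F(\mathfrak M)$ generated by $f$ all of whose homogeneous components have degree $>n$. They are "equivalent to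 the identities $g_1,\ldots,g_s$" if the set of all of them coincides with the T-ideal of $F(\mathfrak M)$ generated by $g_1,\ldots,g_s$. *)

theory Defs
  imports Main "HOL-Library.Poly_Mapping" "HOL-Library.FuncSet" "HOL-Combinatorics.Permutations"
begin

section \<open>Algebras without unit, homomorphisms, T-ideals, quotients\<close>

text \<open>The algebras of the library are unital rings, so associative algebras that need not have
  a unit are introduced here, with an explicit carrier and scalars from a field \<open>'k\<close>.\<close>

record ('k, 'a) alg =
  carrier :: "'a set"
  add :: "'a \<Rightarrow> 'a \<Rightarrow> 'a"
  zero :: 'a
  mult :: "'a \<Rightarrow> 'a \<Rightarrow> 'a"
  smult :: "'k \<Rightarrow> 'a \<Rightarrow> 'a"

locale assoc_algebra =
  fixes B :: "('k::field, 'a) alg"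
  assumes zero_closed: "zero B \<in> carrier B"
    and add_closed: "\<lbrakk>a \<in> carrier B; b \<in> carrier B\<rbrakk> \<Longrightarrow> add B a b \<in> carrier B"
    and mult_closed: "\<lbrakk>a \<in> carrier B; b \<in> carrier B\<rbrakk> \<Longrightarrow> mult B a b \<in> carrier B"
    and smult_closed: "a \<in> carrier B \<Longrightarrow> smult B c a \<in> carrier B"
    and add_assoc: "\<lbrakk>a \<in> carrier B; b \<in> carrier B; d \<in> carrier B\<rbrakk>
      \<Longrightarrow> add B (add B a b) d = add B a (add B b d)"
    and add_comm: "\<lbrakk>a \<in> carrier B; b \<in> carrier B\<rbrakk> \<Longrightarrow> add B a b = add B b a"
    and add_zero: "a \<in> carrier B \<Longrightarrow> add B (zero B) a = a"
    and add_inv: "a \<in> carrier B \<Longrightarrow> \<exists>b\<in>carrier B. add B a b = zero B"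
    and mult_assoc: "\<lbrakk>a \<in> carrier B; b \<in> carrier B; d \<in> carrier B\<rbrakk>
      \<Longrightarrow> mult B (mult B a b) d = mult B a (mult B b d)"
    and mult_add_left: "\<lbrakk>a \<in> carrier B; b \<in> carrier B; d \<in> carrier B\<rbrakk>
      \<Longrightarrow> mult B (add B a b) d = add B (mult B a d) (mult B b d)"
    and mult_add_right: "\<lbrakk>a \<in> carrier B; b \<in> carrier B; d \<in> carrier B\<rbrakk>
      \<Longrightarrow> mult B d (add B a b) = add B (mult B d a) (mult B d b)"
    and smult_add: "\<lbrakk>a \<in> carrier B; b \<in> carrier B\<rbrakk>
      \<Longrightarrow> smult B c (add B a b) = add B (smult B c a) (smult B c b)"
    and add_smult: "a \<in> carrier B \<Longrightarrow> smult B (c + e) a = add B (smult B c a) (smult B e a)"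
    and smult_smult: "a \<in> carrier B \<Longrightarrow> smult B (c * e) a = smult B c (smult B e a)"
    and smult_one: "a \<in> carrier B \<Longrightarrow> smult B 1 a = a"
    and smult_mult_left: "\<lbrakk>a \<in> carrier B; b \<in> carrier B\<rbrakk>
      \<Longrightarrow> mult B (smult B c a) b = smult B c (mult B a b)"
    and smult_mult_right: "\<lbrakk>a \<in> carrier B; b \<in> carrier B\<rbrakk>
      \<Longrightarrow> mult B a (smult B c b) = smult B c (mult B a b)"

definition alg_hom :: "('k, 'a) alg \<Rightarrow> ('k, 'b) alg \<Rightarrow> ('a \<Rightarrow> 'b) set" where
  "alg_hom B C = {\<phi> \<in> carrier B \<rightarrow> carrier C.
     (\<forall>a\<in>carrier B. \<forall>b\<in>carrier B. \<phi> (add B a b) = add C (\<phi> a) (\<phi> b)) \<and>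
     (\<forall>a\<in>carrier B. \<forall>b\<in>carrier B. \<phi> (mult B a b) = mult C (\<phi> a) (\<phi> b)) \<and>
     (\<forall>c. \<forall>a\<in>carrier B. \<phi> (smult B c a) = smult C c (\<phi> a))}"

definition alg_ideal :: "('k, 'a) alg \<Rightarrow> 'a set \<Rightarrow> bool" where
  "alg_ideal B I \<longleftrightarrow> I \<subseteq> carrier B \<and> zero B \<in> I \<and>
     (\<forall>a\<in>I. \<forall>b\<in>I. add B a b \<in> I) \<and> (\<forall>c. \<forall>a\<in>I. smult B c a \<in> I) \<and>
     (\<forall>a\<in>I. \<forall>b\<in>carrier B. mult B a b \<in> I \<and> mult B b a \<in> I)"

definition T_ideal :: "('k, 'a) alg \<Rightarrow> 'a set \<Rightarrow> bool" where
  "T_ideal B I \<longleftrightarrow> alg_ideal B I \<and> (\<forall>\<phi>\<in>alg_hom B B. \<phi> ` I \<subseteq> I)"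

definition T_ideal_gen :: "('k, 'a) alg \<Rightarrow> 'a set \<Rightarrow> 'a set" where
  "T_ideal_gen B G = \<Inter>{I. T_ideal B I \<and> G \<subseteq> I}"

definition coset :: "('k, 'a) alg \<Rightarrow> 'a set \<Rightarrow> 'a \<Rightarrow> 'a set" where
  "coset B I a = add B a ` I"

definition quot :: "('k, 'a) alg \<Rightarrow> 'a set \<Rightarrow> ('k, 'a set) alg" where
  "quot B I = \<lparr>carrier = coset B I ` carrier B,
     add = (\<lambda>U V. \<Union>a\<in>U. \<Union>b\<in>V. coset B I (add B a b)),
     zero = coset B I (zero B),
     mult = (\<lambda>U V. \<Union>a\<in>U. \<Union>b\<in>V. coset B I (mult B a b)),
     smult = (\<lambda>c U. \<Union>a\<in>U. coset B I (smult B c a))\<rparr>"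

section \<open>The free algebra\<close>

text \<open>Words form a monoid under concatenation, written additively so that the convolution
  product of \<^typ>\<open>'a \<Rightarrow>\<^sub>0 'b\<close> yields the free unital associative algebra.\<close>

datatype word = Word (letters: "nat list")

instantiation word :: monoid_add
begin
definition "0 = Word []"
definition "u + v = Word (letters u @ letters v)"
instance by standard (auto simp: zero_word_def plus_word_def)
end

type_synonym 'k ncpoly = "word \<Rightarrow>\<^sub>0 'k"

text \<open>\<open>X i\<close> is the generator usually written \<open>x\<^sub>i\<^sub>+\<^sub>1\<close>.\<close>

definition X :: "nat \<Rightarrow> 'k::field ncpoly" where
  "X i = Poly_Mapping.single (Word [i]) 1"

text \<open>The free algebra without unit consists of the polynomials without constant term.\<close>

definition free_alg :: "('k::field, 'k ncpoly) alg" where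
  "free_alg = \<lparr>carrier = {f. Poly_Mapping.lookup f 0 = 0}, add = (+), zero = 0, mult = (*),
     smult = (\<lambda>c f. Poly_Mapping.single 0 c * f)\<rparr>"

definition commutator :: "'a::ring \<Rightarrow> 'a \<Rightarrow> 'a" where
  "commutator a b = a * b - b * a"

definition std_poly :: "nat \<Rightarrow> 'k::field ncpoly" where
  "std_poly n = (\<Sum>p | p permutes {..<n}. of_int (sign p) * prod_list (map (\<lambda>i. X (p i)) [0..<n]))"

definition homog_part :: "nat \<Rightarrow> 'k::field ncpoly \<Rightarrow> 'k ncpoly" where
  "homog_part d f = (\<Sum>w | w \<in> Poly_Mapping.keys f \<and> length (letters w) = d.
     Poly_Mapping.single w (Poly_Mapping.lookup f w))"

section \<open>Varieties and relatively free algebras\<close>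

text \<open>Evaluating \<open>f\<close> at elements of an algebra is applying a homomorphism from the free algebra.\<close>

definition identity_of :: "('k::field, 'b) alg \<Rightarrow> 'k ncpoly \<Rightarrow> bool" where
  "identity_of B f \<longleftrightarrow> f \<in> carrier free_alg \<and> (\<forall>\<phi>\<in>alg_hom free_alg B. \<phi> f = zero B)"

text \<open>A class of algebras needs a type of possible elements. The type of sets of polynomials
  contains every quotient of the free algebra, hence a copy of every countably generated
  algebra; as a polynomial involves only finitely many generators, these algebras
  determine the identities of a variety.\<close>

type_synonym 'k variety = "('k, 'k ncpoly set) alg set"

definition variety :: "'k::field ncpoly set \<Rightarrow> 'k variety" where
  "variety G = {B. assoc_algebra B \<and> (\<forall>g\<in>G. identity_of B g)}"

definition identities :: "'k::field variety \<Rightarrow> 'k ncpoly set" where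
  "identities M = {f \<in> carrier free_alg. \<forall>B\<in>M. identity_of B f}"

definition rel_free :: "'k::field variety \<Rightarrow> ('k, 'k ncpoly set) alg" where
  "rel_free M = quot free_alg (identities M)"

definition proj :: "'k::field variety \<Rightarrow> 'k ncpoly \<Rightarrow> 'k ncpoly set" where
  "proj M f = coset free_alg (identities M) f"

text \<open>For homogeneous \<^term>\<open>identities M\<close> (always the case over an infinite field) all
  members of the union below are equal.\<close>

definition rel_homog_part :: "'k::field variety \<Rightarrow> nat \<Rightarrow> 'k ncpoly set \<Rightarrow> 'k ncpoly set" where
  "rel_homog_part M d U = (\<Union>f\<in>U. proj M (homog_part d f))"

text \<open>Here \<open>f\<close> is meant to be homogeneous of degree \<open>n\<close>.\<close>

definition higher_consequences ::
    "'k::field variety \<Rightarrow> nat \<Rightarrow> 'k ncpoly \<Rightarrow> 'k ncpoly set set" where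
  "higher_consequences M n f = {U \<in> T_ideal_gen (rel_free M) {proj M f}.
     \<forall>d\<le>n. rel_homog_part M d U = zero (rel_free M)}"

definition equivalent_to_identities ::
    "'k::field variety \<Rightarrow> 'k ncpoly set set \<Rightarrow> 'k ncpoly set \<Rightarrow> bool" where
  "equivalent_to_identities M C G \<longleftrightarrow> C = T_ideal_gen (rel_free M) (proj M ` G)"

end

theory Submission
  imports Defs
begin

text \<open>Modulo \<open>[x, y, z] = 0\<close> commutators are central, and a product of \<open>r\<close> commutators is
  alternating and a derivation in each of its \<open>2r\<close> arguments. So the algebra behaves like the even
  differential forms, with \<open>[x, y]\<close> in the role of \<open>dx \<and> dy\<close>: up to a scalar
  \<open>S\<^sub>2\<^sub>r(y)\<close> is \<open>dy\<^sub>1 \<and> \<dots> \<and> dy\<^sub>2\<^sub>r\<close> and \<open>S\<^sub>2\<^sub>r\<^sub>+\<^sub>1(y)\<close> is the contraction of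
  \<open>dy\<^sub>1 \<and> \<dots> \<and> dy\<^sub>2\<^sub>r\<^sub>+\<^sub>1\<close> with the Euler field. A form is the sum of a closed one and a
  contraction of a closed one (Euler's formula), so the listed identities generate spaces of closed
  or of all forms of given degree.

  The listed identities follow from \<open>f = S\<^sub>k\<^sub>+\<^sub>1 x\<^sub>1\<^sup>m\<close>, where \<open>m = n - k - 1\<close>, by multiplying, by
  commuting with a new variable, and by replacing an argument by \<open>x\<^sup>2\<close> or \<open>x\<close> by \<open>x + [a, b]\<close>.
  Conversely, let \<open>J\<close> be the T-ideal that they generate. Modulo \<open>J\<close> every value of \<open>f\<close> is
  annihilated by the algebra and does not change when \<open>ab\<close> is added to an argument; hence the
  T-ideal of \<open>f\<close> is \<open>J\<close> plus the span of the values of \<open>f\<close> at linear forms. These are homogeneous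
  of degree \<open>n\<close>, while \<open>J\<close> lives in higher degrees.\<close>

section \<open>Products of commutators\<close>

text \<open>All listed identities have degree n + 1, and each says which forms of that total degree
  lie in \<open>J\<close>. If k = 2r, then S_k and S_(k+1) give the closed and the contracted
  2r-forms, and S_(k+2) and S_(k+3) those of form degree 2r + 2, so \<open>J\<close> contains all
  forms of both degrees. If k = 2r + 1, then S_(k+1) and S_(k+2) give all (2r+2)-forms, while
  S_(k+3) gives only the closed (2r+4)-forms; here f is itself a closed (2r+2)-form and no step
  leads back to 2r-forms, whence \<epsilon> = 0. What shapes the calculus is the missing unit: a
  variable must not be replaced by 1. The computations therefore take place in a unital ring, in
  which arguments are confined to the image of the augmentation ideal and only coefficients are
  arbitrary. Differentiation means substituting x + t h for all natural t and comparing coefficients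
  of powers of t, so that integers are the only scalars that ever have to be cancelled.\<close>

notation commutator ("\<langle>_, _\<rangle>")

text \<open>As a class this lets the form calculus run in a ring where commutators are central on
  the nose, not just modulo an ideal. The type \<open>cpoly\<close> below is the instance that is
  used.\<close>

class central_commutator_ring = ring_1 +
  assumes central: "(a * b - b * a) * c = c * (a * b - b * a)"

lemma commutator_commute: "\<langle>a, b\<rangle> * c = c * \<langle>a, b\<rangle>" for a b c :: "'a::central_commutator_ring"
  unfolding commutator_def by (rule central)

lemma commutator_self [simp]: "\<langle>a, a\<rangle> = 0"
  by (simp add: commutator_def)

lemma commutator_of_nat [simp]: "\<langle>of_nat n, a\<rangle> = 0" "\<langle>a, of_nat n\<rangle> = 0" for a :: "'a::ring_1"
  by (simp_all add: commutator_def mult_of_nat_commute)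

lemma commutator_1 [simp]: "\<langle>1, a\<rangle> = 0" "\<langle>a, 1\<rangle> = 0" for a :: "'a::ring_1"
  by (simp_all add: commutator_def)

lemma commutator_minus: "\<langle>a, b\<rangle> = - \<langle>b, a\<rangle>"
  by (simp add: commutator_def)

lemma commutator_commutator [simp]: "\<langle>\<langle>a, b\<rangle>, c\<rangle> = 0" "\<langle>c, \<langle>a, b\<rangle>\<rangle> = 0"
  for a b c :: "'a::central_commutator_ring"
  using commutator_commute[of a b c] by (simp_all add: commutator_def)

lemma commutator_add: "\<langle>a + b, c\<rangle> = \<langle>a, c\<rangle> + \<langle>b, c\<rangle>" "\<langle>c, a + b\<rangle> = \<langle>c, a\<rangle> + \<langle>c, b\<rangle>"
  by (simp_all add: commutator_def algebra_simps)

lemma commutator_mult: "\<langle>a * b, c\<rangle> = a * \<langle>b, c\<rangle> + \<langle>a, c\<rangle> * b" "\<langle>c, a * b\<rangle> = a * \<langle>c, b\<rangle> + \<langle>c, a\<rangle> * b"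
  by (simp_all add: commutator_def algebra_simps)

text \<open>Expand the vanishing \<langle>\<langle>a * b, c\<rangle>, d\<rangle> by the Leibniz
  rule; the terms with triple commutators drop out and these two products remain.\<close>

lemma commutator_exchange: "\<langle>a, d\<rangle> * \<langle>b, c\<rangle> = - (\<langle>a, c\<rangle> * \<langle>b, d\<rangle>)"
  for a b c d :: "'a::central_commutator_ring"
proof -
  have "\<langle>\<langle>a * b, c\<rangle>, d\<rangle> = 0" by simp
  then show ?thesis
    by (simp add: commutator_mult(1) commutator_add eq_neg_iff_add_eq_0)
qed

lemma commutator_chain [simp]: "\<langle>a, b\<rangle> * \<langle>b, c\<rangle> = 0" for a b c :: "'a::central_commutator_ring"
  using commutator_exchange[of a b b c] by simp

lemma commutator_square: "\<langle>a, b\<rangle> * \<langle>a, b\<rangle> = 0" for a b :: "'a::central_commutator_ring"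
  using commutator_chain[of a b a] by (simp add: commutator_minus[of b a])

text \<open>This exchanges arguments across the border between two factors. Together with
  antisymmetry inside a factor it generates alternation in all arguments.\<close>

lemma commutator_swap_middle: "\<langle>a, b\<rangle> * \<langle>c, d\<rangle> = - (\<langle>a, c\<rangle> * \<langle>b, d\<rangle>)"
  for a b c d :: "'a::central_commutator_ring"
  using commutator_exchange[of a b c d] commutator_exchange[of a c b d]
    commutator_minus[of c b] by simp

text \<open>The arguments form a function on all of \<open>nat\<close>, of which the first
  \<open>2 * r\<close> values count, so that replacing an argument is a function update.\<close>

primrec cprod :: "nat \<Rightarrow> (nat \<Rightarrow> 'a) \<Rightarrow> 'a::ring_1" where
  "cprod 0 y = 1"
| "cprod (Suc r) y = cprod r y * \<langle>y (2 * r), y (2 * r + 1)\<rangle>"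

lemma cprod_commute: "cprod r y * c = c * cprod r y" for c :: "'a::central_commutator_ring"
proof (induction r)
  case (Suc r)
  have "cprod (Suc r) y * c = (cprod r y * c) * \<langle>y (2 * r), y (2 * r + 1)\<rangle>"
    by (simp add: mult.assoc commutator_commute)
  then show ?case by (simp add: Suc mult.assoc)
qed simp

lemma cprod_left_commute: "cprod r y * (c * d) = c * (cprod r y * d)"
  for c :: "'a::central_commutator_ring"
  by (metis cprod_commute mult.assoc)

lemma commutator_left_commute: "\<langle>a, b\<rangle> * (c * d) = c * (\<langle>a, b\<rangle> * d)"
  for c :: "'a::central_commutator_ring"
  by (metis commutator_commute mult.assoc)

lemma cprod_cong: "(\<And>i. i < 2 * r \<Longrightarrow> y i = z i) \<Longrightarrow> cprod r y = cprod r z"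
  by (induction r) auto

lemma cprod_upd_irrelevant [simp]: "2 * r \<le> i \<Longrightarrow> cprod r (y(i := a)) = cprod r y"
  by (rule cprod_cong) auto

declare fun_upd_apply [simp del] comp_apply [simp del] fun_upd_same [simp] fun_upd_other [simp]

lemma less_2_Suc_cases: "i < 2 * Suc r \<Longrightarrow> i < 2 * r \<or> i = 2 * r \<or> i = 2 * r + 1"
  by auto

lemma cprod_add:
  assumes "i < 2 * r"
  shows "cprod r (y(i := a + b)) = cprod r (y(i := a)) + cprod r (y(i := b))"
  using assms
proof (induction r)
  case (Suc r)
  from less_2_Suc_cases[OF Suc.prems] show ?case
    by (elim disjE) (simp_all add: Suc.IH commutator_add distrib_left distrib_right del: fun_upd_apply)
qed simp

lemma cprod_mult:
  fixes a b :: "'a::central_commutator_ring"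
  assumes "i < 2 * r"
  shows "cprod r (y(i := a * b)) = a * cprod r (y(i := b)) + cprod r (y(i := a)) * b"
  using assms
proof (induction r)
  case (Suc r)
  from less_2_Suc_cases[OF Suc.prems] show ?case
    by (elim disjE)
      (simp_all add: Suc.IH commutator_mult distrib_left distrib_right mult.assoc
         cprod_left_commute commutator_commute del: fun_upd_apply)
qed simp

lemma cprod_eq_0:
  assumes "i < 2 * r" "\<And>c. \<langle>y i, c\<rangle> = 0"
  shows "cprod r y = 0"
  using assms(1)
proof (induction r)
  case (Suc r)
  have "\<langle>c, y i\<rangle> = 0" for c
    using assms(2)[of c] commutator_minus[of c "y i"] by simp
  with less_2_Suc_cases[OF Suc.prems] assms(2) show ?case
    by (elim disjE) (simp_all add: Suc.IH)
qed simp

text \<open>The class has no field of scalars. Multiples by natural numbers are enough for the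
  substitutions x + t h.\<close>

lemma cprod_of_nat_mult:
  fixes a :: "'a::central_commutator_ring"
  assumes "i < 2 * r"
  shows "cprod r (y(i := of_nat t * a)) = of_nat t * cprod r (y(i := a))"
proof -
  have "cprod r (y(i := of_nat t)) = 0"
    by (rule cprod_eq_0[OF assms]) simp
  then show ?thesis by (simp add: cprod_mult[OF assms])
qed

lemma cprod_swap_adjacent:
  fixes y :: "nat \<Rightarrow> 'a::central_commutator_ring"
  assumes "Suc i < 2 * r"
  shows "cprod r (y \<circ> transpose i (Suc i)) = - cprod r y"
  using assms
proof (induction r)
  case (Suc r)
  have "Suc i < 2 * r \<or> Suc i = 2 * r \<or> i = 2 * r"
    using Suc.prems by auto
  then consider "Suc i < 2 * r" | "Suc i = 2 * r" | "i = 2 * r"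
    by blast
  then show ?case
  proof cases
    case 1
    then show ?thesis using Suc.IH by (simp add: comp_apply)
  next
    case 2
    then obtain s where r: "r = Suc s" by (cases r) auto
    with 2 have i: "i = 2 * s + 1" by simp
    have "cprod s (y \<circ> transpose i (Suc i)) = cprod s y"
      by (rule cprod_cong) (auto simp: i comp_apply transpose_def)
    moreover have e: "(y \<circ> transpose i (Suc i)) (2 * s) = y (2 * s)"
        "(y \<circ> transpose i (Suc i)) (2 * s + 1) = y (2 * s + 2)"
        "(y \<circ> transpose i (Suc i)) (2 * s + 2) = y (2 * s + 1)"
        "(y \<circ> transpose i (Suc i)) (2 * s + 3) = y (2 * s + 3)"
      by (auto simp: i comp_apply transpose_def)
    ultimately show ?thesis
      using commutator_swap_middle[of "y (2 * s)" "y (2 * s + 2)" "y (2 * s + 1)" "y (2 * s + 3)"]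
      by (simp add: r mult.assoc numeral_2_eq_2 numeral_3_eq_3)
  next
    case 3
    have "cprod r (y \<circ> transpose i (Suc i)) = cprod r y"
      by (rule cprod_cong) (auto simp: 3 comp_apply transpose_def)
    moreover have "(y \<circ> transpose i (Suc i)) (2 * r) = y (2 * r + 1)"
      "(y \<circ> transpose i (Suc i)) (2 * r + 1) = y (2 * r)"
      by (simp_all add: 3 comp_apply)
    ultimately show ?thesis
      using commutator_minus[of "y (2 * r + 1)" "y (2 * r)"] by simp
  qed
qed simp

text \<open>A transposition over a longer distance is a shorter one conjugated by an adjacent one,
  which makes three changes of sign.\<close>

lemma cprod_swap:
  fixes y :: "nat \<Rightarrow> 'a::central_commutator_ring"
  assumes "i < j" "j < 2 * r"
  shows "cprod r (y \<circ> transpose i j) = - cprod r y"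
  using assms
proof (induction j arbitrary: y)
  case (Suc j)
  show ?case
  proof (cases "i = j")
    case True
    then show ?thesis using cprod_swap_adjacent[of j r y] Suc.prems by simp
  next
    case False
    then have "transpose i (Suc j) = transpose j (Suc j) \<circ> transpose i j \<circ> transpose j (Suc j)"
      using Suc.prems by (auto simp: comp_apply transpose_def fun_eq_iff)
    then have "cprod r (y \<circ> transpose i (Suc j))
        = cprod r (((y \<circ> transpose j (Suc j)) \<circ> transpose i j) \<circ> transpose j (Suc j))"
      by (simp add: o_assoc)
    also have "\<dots> = - cprod r ((y \<circ> transpose j (Suc j)) \<circ> transpose i j)"
      using Suc.prems by (intro cprod_swap_adjacent)
    also have "cprod r ((y \<circ> transpose j (Suc j)) \<circ> transpose i j) = - cprod r (y \<circ> transpose j (Suc j))"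
      using Suc.prems False by (intro Suc.IH) auto
    also have "cprod r (y \<circ> transpose j (Suc j)) = - cprod r y"
      using Suc.prems by (intro cprod_swap_adjacent)
    finally show ?thesis by simp
  qed
qed simp

lemma cprod_transpose:
  fixes y :: "nat \<Rightarrow> 'a::central_commutator_ring"
  assumes "i \<noteq> j" "i < 2 * r" "j < 2 * r"
  shows "cprod r (y \<circ> transpose i j) = - cprod r y"
  using assms cprod_swap[of i j r y] cprod_swap[of j i r y]
  by (cases i j rule: linorder_cases) (auto simp: transpose_commute)

lemma cprod_permutes:
  fixes y :: "nat \<Rightarrow> 'a::central_commutator_ring"
  assumes "p permutes {..<2 * r}"
  shows "cprod r (y \<circ> p) = of_int (sign p) * cprod r y"
  using finite_lessThan assms
proof (induction rule: permutes_rev_induct)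
  case (swap a b p)
  then have "permutation p" by (auto intro: permutes_imp_permutation[rotated])
  with swap have "sign (p \<circ> transpose a b) = - sign p"
    by (simp add: sign_compose permutation_swap_id sign_swap_id)
  moreover have "cprod r ((y \<circ> p) \<circ> transpose a b) = - cprod r (y \<circ> p)"
    using swap by (intro cprod_transpose) auto
  ultimately show ?case using swap by (simp add: o_assoc)
next
  case id
  show ?case by (simp only: comp_id sign_id of_int_1 mult_1)
qed

text \<open>Alternation would only show that twice the product vanishes, and the ring may have
  2-torsion. Equal neighbours are therefore treated directly, within one factor and across
  two.\<close>

lemma cprod_repeat_adjacent:
  fixes y :: "nat \<Rightarrow> 'a::central_commutator_ring"
  assumes "Suc i < 2 * r" "y i = y (Suc i)"
  shows "cprod r y = 0"
  using assms(1)
proof (induction r)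
  case (Suc r)
  have "Suc i < 2 * r \<or> Suc i = 2 * r \<or> i = 2 * r"
    using Suc.prems by auto
  then consider "Suc i < 2 * r" | "Suc i = 2 * r" | "i = 2 * r"
    by blast
  then show ?case
  proof cases
    case 2
    then obtain s where r: "r = Suc s" by (cases r) auto
    with 2 have "i = 2 * s + 1" by simp
    then show ?thesis using assms(2)
      by (simp add: r mult.assoc)
  qed (use assms(2) Suc.IH in simp_all)
qed simp

lemma cprod_repeat:
  fixes y :: "nat \<Rightarrow> 'a::central_commutator_ring"
  assumes "y i = y j" "i < j" "j < 2 * r"
  shows "cprod r y = 0"
proof (cases "j = Suc i")
  case True
  then show ?thesis using assms cprod_repeat_adjacent by blast
next
  case False
  then have "cprod r (y \<circ> transpose (Suc i) j) = 0"
    using assms by (intro cprod_repeat_adjacent[of i]) (auto simp: comp_apply transpose_def)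
  then show ?thesis
    using False assms cprod_transpose[of "Suc i" j r y] by auto
qed

lemma commutator_cprod:
  fixes y :: "nat \<Rightarrow> 'a::central_commutator_ring"
  shows "\<langle>a, b\<rangle> * cprod r y = cprod (Suc r) (y(2 * r := a, 2 * r + 1 := b))"
  by (simp add: commutator_commute)

text \<open>Multiplying by the commutator makes a longer product in which \<open>y i\<close> occurs
  twice.\<close>

lemma commutator_cprod_eq_0:
  fixes y :: "nat \<Rightarrow> 'a::central_commutator_ring"
  assumes "i < 2 * r"
  shows "\<langle>y i, b\<rangle> * cprod r y = 0" "\<langle>b, y i\<rangle> * cprod r y = 0"
proof -
  show "\<langle>y i, b\<rangle> * cprod r y = 0"
    unfolding commutator_cprod
    by (rule cprod_repeat[of _ i "2 * r"]) (use assms in auto)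
  then show "\<langle>b, y i\<rangle> * cprod r y = 0"
    by (subst commutator_minus) simp
qed

text \<open>The contraction of dx \<and> dy_0 \<and> ... with the Euler field. Its alternating signs
  are absorbed by putting \<open>x\<close> into the place of \<open>y b\<close>. The argument
  \<open>x\<close> is kept apart because it is the one that is also raised to a power.\<close>

definition econtr :: "nat \<Rightarrow> 'a \<Rightarrow> (nat \<Rightarrow> 'a) \<Rightarrow> 'a::ring_1" where
  "econtr r x y = x * cprod r y - (\<Sum>b<2 * r. y b * cprod r (y(b := x)))"

section \<open>Standard polynomials in terms of commutators\<close>

definition std :: "nat \<Rightarrow> (nat \<Rightarrow> 'a) \<Rightarrow> 'a::ring_1" where
  "std n y = (\<Sum>p | p permutes {..<n}. of_int (sign p) * prod_list (map (\<lambda>i. y (p i)) [0..<n]))"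

lemma std_cong: 
  assumes "\<And>i. i < n \<Longrightarrow> y i = z i"
  shows "std n y = std n z"
proof -
  have "map (\<lambda>i. y (p i)) [0..<n] = map (\<lambda>i. z (p i)) [0..<n]" if "p permutes {..<n}" for p
    using permutes_in_image[OF that] assms by auto
  then show ?thesis
    unfolding std_def
    by (intro sum.cong refl arg_cong2[where f = "(*)"] arg_cong[where f = prod_list]) simp
qed

lemma std_permutes:
  assumes "q permutes {..<n}"
  shows "std n (y \<circ> q) = of_int (sign q) * std n y"
proof -
  have "std n (y \<circ> q) = (\<Sum>p | p permutes {..<n}. of_int (sign q) * (of_int (sign (q \<circ> p))
      * prod_list (map (\<lambda>i. y ((q \<circ> p) i)) [0..<n])))"
    unfolding std_def
  proof (intro sum.cong refl)
    fix p assume "p \<in> {p. p permutes {..<n}}"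
    then have "sign (q \<circ> p) = sign q * sign p"
      using assms by (intro sign_compose) (auto intro: permutes_imp_permutation[rotated])
    then have "of_int (sign q) * (of_int (sign (q \<circ> p))) = (of_int (sign p) :: 'a)"
      by (metis mult.left_neutral mult.assoc of_int_mult sign_idempotent)
    then show "of_int (sign p) * prod_list (map (\<lambda>i. (y \<circ> q) (p i)) [0..<n]) = 
        of_int (sign q) * (of_int (sign (q \<circ> p)) * prod_list (map (\<lambda>i. y ((q \<circ> p) i)) [0..<n]))"
      by (simp add: comp_apply flip: mult.assoc)
  qed
  also have "\<dots> = of_int (sign q) * std n y"
    unfolding std_def sum_distrib_left
    by (rule setum_permutations_compose_left[OF assms, symmetric])
  finally show ?thesis .
qed

text \<open>Sort the permutations by their value b at the last place: each is
  \<open>transpose n b\<close> after a permutation that fixes n. So the last factor is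
  \<open>y b\<close>, and \<open>y n\<close> takes its place among the others.\<close>

lemma std_Suc:
  "std (Suc n) y = std n y * y n - (\<Sum>b<n. std n (y(b := y n)) * y b)"
proof -
  let ?g = "\<lambda>p. of_int (sign p) * prod_list (map (\<lambda>i. y (p i)) [0..<Suc n])"
  have "std (Suc n) y = (\<Sum>b\<in>insert n {..<n}. \<Sum>q | q permutes {..<n}. ?g (transpose n b \<circ> q))"
    unfolding std_def lessThan_Suc by (rule sum_over_permutations_insert) auto
  also have "\<dots> = (\<Sum>q | q permutes {..<n}. ?g q)
     + (\<Sum>b<n. \<Sum>q | q permutes {..<n}. ?g (transpose n b \<circ> q))"
    by (simp del: upt_Suc)
  also have "(\<Sum>q | q permutes {..<n}. ?g q) = std n y * y n"
    unfolding std_def sum_distrib_right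
    by (intro sum.cong refl) (auto simp: permutes_not_in mult.assoc)
  also have "(\<Sum>b<n. \<Sum>q | q permutes {..<n}. ?g (transpose n b \<circ> q))
      = (\<Sum>b<n. - (std n (y(b := y n)) * y b))"
  proof (intro sum.cong refl)
    fix b assume "b \<in> {..<n}"
    then have "b < n" by simp
    have "?g (transpose n b \<circ> q) =
        - (of_int (sign q) * prod_list (map (\<lambda>i. (y(b := y n)) (q i)) [0..<n]) * y b)"
      if q: "q permutes {..<n}" for q
    proof -
      have "permutation q" using q by (auto intro: permutes_imp_permutation[rotated])
      with \<open>b < n\<close> have "sign (transpose n b \<circ> q) = - sign q"
        by (simp add: sign_compose permutation_swap_id sign_swap_id)
      moreover have "map (\<lambda>i. y ((transpose n b \<circ> q) i)) [0..<n] = map (\<lambda>i. (y(b := y n)) (q i)) [0..<n]"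
      proof (intro map_cong refl)
        fix i assume "i \<in> set [0..<n]"
        then have "q i < n" using permutes_in_image[OF q, of i] by simp
        then show "y ((transpose n b \<circ> q) i) = (y(b := y n)) (q i)"
          by (simp add: comp_apply transpose_def fun_upd_apply)
      qed
      moreover have "(transpose n b \<circ> q) n = b"
        using q by (simp add: comp_apply permutes_not_in)
      ultimately show ?thesis by (simp add: mult.assoc del: map_eq_conv)
    qed
    then show "(\<Sum>q | q permutes {..<n}. ?g (transpose n b \<circ> q)) = - (std n (y(b := y n)) * y b)"
      by (simp add: std_def sum_distrib_right sum_negf)
  qed
  finally show ?thesis by (simp add: sum_negf)
qed

text \<open>Each step pairs p with p composed with the transposition of the places 2j and 2j + 1.
  The two products have opposite signs and differ in the order of two neighbouring factors, so they
  add up to a commutator; every pair is counted twice, whence the power of 2.\<close>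

lemma std_pairing:
  fixes y :: "nat \<Rightarrow> 'a::central_commutator_ring"
  assumes "2 * j \<le> n"
  shows "2 ^ j * std n y = (\<Sum>p | p permutes {..<n}. of_int (sign p) *
    (cprod j (y \<circ> p) * prod_list (map (y \<circ> p) [2 * j..<n])))"
  using assms
proof (induction j)
  case 0
  show ?case by (simp add: std_def comp_def)
next
  case (Suc j)
  let ?P = "{p. p permutes {..<n}}"
  let ?q = "transpose (2 * j) (2 * j + 1)"
  define g where "g p = of_int (sign p) * (cprod j (y \<circ> p) * prod_list (map (y \<circ> p) [2 * j..<n]))" for p
  have upt: "[2 * j..<n] = 2 * j # (2 * j + 1) # [2 * Suc j..<n]"
    using Suc.prems by (simp add: upt_rec)
  have g_eq: "g p = of_int (sign p) * (cprod j (y \<circ> p) * ((y \<circ> p) (2 * j) * ((y \<circ> p) (2 * j + 1)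
      * prod_list (map (y \<circ> p) [2 * Suc j..<n]))))" for p
    unfolding g_def upt by (simp only: list.map prod_list.Cons)
  have q: "?q permutes {..<n}"
    using Suc.prems by (intro permutes_swap_id) auto
  have step: "g p + g (p \<circ> ?q) = of_int (sign p) *
      (cprod (Suc j) (y \<circ> p) * prod_list (map (y \<circ> p) [2 * Suc j..<n]))"
    if p: "p permutes {..<n}" for p
  proof -
    have "permutation p" using p by (auto intro: permutes_imp_permutation[rotated])
    then have "sign (p \<circ> ?q) = - sign p"
      by (simp add: sign_compose permutation_swap_id sign_swap_id)
    moreover have "cprod j (y \<circ> (p \<circ> ?q)) = cprod j (y \<circ> p)"
      by (rule cprod_cong) (simp add: comp_apply)
    moreover have "map (y \<circ> (p \<circ> ?q)) [2 * Suc j..<n] = map (y \<circ> p) [2 * Suc j..<n]"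
      by (rule map_cong) (auto simp: comp_apply)
    moreover have "(y \<circ> (p \<circ> ?q)) (2 * j) = (y \<circ> p) (2 * j + 1)"
      "(y \<circ> (p \<circ> ?q)) (2 * j + 1) = (y \<circ> p) (2 * j)"
      by (simp_all add: comp_apply)
    ultimately show ?thesis
      by (simp add: g_eq commutator_def right_diff_distrib left_diff_distrib mult.assoc del: upt_Suc map_eq_conv)
  qed
  have "2 * sum g ?P = sum g ?P + sum (\<lambda>p. g (p \<circ> ?q)) ?P"
    using sum_permutations_compose_right[OF q, of g] by (simp add: mult_2)
  also have "\<dots> = (\<Sum>p\<in>?P. g p + g (p \<circ> ?q))"
    by (simp add: sum.distrib)
  also have "\<dots> = (\<Sum>p\<in>?P. of_int (sign p) *
      (cprod (Suc j) (y \<circ> p) * prod_list (map (y \<circ> p) [2 * Suc j..<n])))"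
    using step by (intro sum.cong) auto
  finally show ?case
    using Suc by (simp add: g_def mult.assoc)
qed

text \<open>After complete pairing the sign of each permutation is compensated by the alternation of
  \<open>cprod\<close>, so all (2r)! terms are equal.\<close>

lemma std_even:
  fixes y :: "nat \<Rightarrow> 'a::central_commutator_ring"
  shows "2 ^ r * std (2 * r) y = of_nat (fact (2 * r)) * cprod r y"
proof -
  have "2 ^ r * std (2 * r) y = (\<Sum>p | p permutes {..<2 * r}. of_int (sign p) * cprod r (y \<circ> p))"
    by (subst std_pairing) simp_all
  also have "\<dots> = (\<Sum>p | p permutes {..<2 * r}. cprod r y)"
  proof (intro sum.cong refl)
    fix p assume "p \<in> {p. p permutes {..<2 * r}}"
    then show "of_int (sign p) * cprod r (y \<circ> p) = cprod r y"
      by (simp add: cprod_permutes flip: mult.assoc of_int_mult)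
  qed
  also have "\<dots> = of_nat (fact (2 * r)) * cprod r y"
    by (simp add: card_permutations[of _ "2 * r"])
  finally show ?thesis .
qed

lemma std_odd:
  fixes y :: "nat \<Rightarrow> 'a::central_commutator_ring"
  shows "2 ^ r * std (Suc (2 * r)) y = of_nat (fact (2 * r)) * econtr r (y (2 * r)) y"
proof -
  have "2 ^ r * std (Suc (2 * r)) y
      = 2 ^ r * std (2 * r) y * y (2 * r) - (\<Sum>b<2 * r. 2 ^ r * std (2 * r) (y(b := y (2 * r))) * y b)"
    by (simp add: std_Suc right_diff_distrib sum_distrib_left mult.assoc)
  also have "\<dots> = of_nat (fact (2 * r)) * econtr r (y (2 * r)) y"
    unfolding std_even econtr_def
    by (simp add: right_diff_distrib sum_distrib_left mult.assoc cprod_commute)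
  finally show ?thesis .
qed

text \<open>The distinguished argument of the contraction should be \<open>y 0\<close>, whose power
  is the second factor of f. The transposition that achieves this is odd only if r > 0.\<close>

lemma std_odd_first:
  fixes y :: "nat \<Rightarrow> 'a::central_commutator_ring"
  assumes "r > 0"
  shows "2 ^ r * std (Suc (2 * r)) y = - (of_nat (fact (2 * r)) * econtr r (y 0) (y(0 := y (2 * r))))"
proof -
  have "std (Suc (2 * r)) (y \<circ> transpose 0 (2 * r)) = - std (Suc (2 * r)) y"
    using assms by (subst std_permutes) (auto intro: permutes_swap_id simp: sign_swap_id)
  moreover have "2 ^ r * std (Suc (2 * r)) (y \<circ> transpose 0 (2 * r))
      = of_nat (fact (2 * r)) * econtr r (y 0) (y \<circ> transpose 0 (2 * r))"
    unfolding std_odd by (simp add: comp_apply)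
  moreover have "econtr r (y 0) (y \<circ> transpose 0 (2 * r)) = econtr r (y 0) (y(0 := y (2 * r)))"
    unfolding econtr_def
    by (intro arg_cong2[where f = "(-)"] arg_cong2[where f = "(*)"] refl sum.cong cprod_cong)
      (auto simp: comp_apply fun_upd_apply transpose_def)
  ultimately show ?thesis by (simp add: minus_equation_iff[of _ "of_nat (fact (2 * r)) * econtr r (y 0) (y(0 := y (2 * r)))"])
qed

section \<open>Polynomial functions and saturated ideals\<close>

text \<open>A polynomial function on \<open>nat\<close>, with coefficients on the right, and its formal derivative.\<close>

inductive pder :: "(nat \<Rightarrow> 'a) \<Rightarrow> (nat \<Rightarrow> 'a::ring_1) \<Rightarrow> bool" where
  pder_monom: "pder (\<lambda>t. of_nat (t ^ j) * c) (\<lambda>t. of_nat (j * t ^ (j - 1)) * c)"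
| pder_add: "pder p p' \<Longrightarrow> pder q q' \<Longrightarrow> pder (\<lambda>t. p t + q t) (\<lambda>t. p' t + q' t)"

lemma pder_const: "pder (\<lambda>t. c) (\<lambda>t. 0)"
  using pder_monom[of 0 c] by simp

lemma pder_affine: "pder (\<lambda>t. a + of_nat t * b) (\<lambda>t. b)"
  using pder_add[OF pder_const[of a] pder_monom[of 1 b]] by simp

lemma of_nat_mult_mult: "of_nat m * a * (of_nat n * b) = of_nat (m * n) * (a * b)" for a b :: "'a::ring_1"
  by (metis mult.assoc mult_of_nat_commute of_nat_mult)

lemma pder_monom_mult:
  "pder q q' \<Longrightarrow> pder (\<lambda>t. of_nat (t ^ j) * c * q t) (\<lambda>t. of_nat (j * t ^ (j - 1)) * c * q t + of_nat (t ^ j) * c * q' t)"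
proof (induction rule: pder.induct)
  case (pder_monom i d)
  have "pder (\<lambda>t. of_nat (t ^ (j + i)) * (c * d)) (\<lambda>t. of_nat ((j + i) * t ^ (j + i - 1)) * (c * d))"
    by (rule pder.pder_monom)
  moreover have "of_nat (t ^ (j + i)) * (c * d) = of_nat (t ^ j) * c * (of_nat (t ^ i) * d)" for t
    by (simp only: of_nat_mult_mult power_add)
  moreover have "of_nat ((j + i) * t ^ (j + i - 1)) * (c * d) =
      of_nat (j * t ^ (j - 1)) * c * (of_nat (t ^ i) * d) + of_nat (t ^ j) * c * (of_nat (i * t ^ (i - 1)) * d)" for t
  proof -
    have "(j + i) * t ^ (j + i - 1) = j * t ^ (j - 1) * t ^ i + t ^ j * (i * t ^ (i - 1))"
      by (cases i; cases j) (auto simp: power_add algebra_simps)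
    then show ?thesis
      by (simp only: of_nat_mult_mult of_nat_add distrib_right)
  qed
  ultimately show ?case by simp
next
  case (pder_add p p' q q')
  from pder.pder_add[OF pder_add.IH] show ?case by (simp add: distrib_left algebra_simps)
qed

lemma pder_mult:
  "pder p p' \<Longrightarrow> pder q q' \<Longrightarrow> pder (\<lambda>t. p t * q t) (\<lambda>t. p' t * q t + p t * q' t)"
proof (induction rule: pder.induct)
  case (pder_monom i d)
  then show ?case by (rule pder_monom_mult)
next
  case (pder_add p1 p1' p2 p2')
  from pder.pder_add[OF pder_add.IH(1)[OF pder_add.prems] pder_add.IH(2)[OF pder_add.prems]]
  show ?case by (simp add: algebra_simps)
qed

text \<open>The derivative of x^m in the direction h, that is the sum of all x^i h x^(m-1-i); h need
  not commute with x.\<close>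

primrec pow_der :: "nat \<Rightarrow> 'a \<Rightarrow> 'a \<Rightarrow> 'a::ring_1" where
  "pow_der 0 x h = 0"
| "pow_der (Suc m) x h = h * x ^ m + x * pow_der m x h"

lemma pder_power: "pder p p' \<Longrightarrow> pder (\<lambda>t. p t ^ m) (\<lambda>t. pow_der m (p t) (p' t))"
proof (induction m)
  case 0
  show ?case using pder_const[of 1] by simp
next
  case (Suc m)
  from pder_mult[OF Suc.prems Suc.IH[OF Suc.prems]] show ?case by simp
qed

text \<open>One sequence of coefficients serves both functions, and every large bound N is allowed
  so that two expansions can be added. The truncated exponent at j = 0 is harmless because its
  coefficient is multiplied by 0.\<close>

lemma pder_expansion:
  "pder p p' \<Longrightarrow> \<exists>n c. \<forall>N\<ge>n. \<forall>t. p t = (\<Sum>j\<le>N. of_nat (t ^ j) * c j) \<and>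
     p' t = (\<Sum>j\<le>N. of_nat (t ^ (j - 1)) * (of_nat j * c j))"
proof (induction rule: pder.induct)
  case (pder_monom i d)
  show ?case
  proof (intro exI[of _ i] exI[of _ "\<lambda>j. if j = i then d else 0"] allI impI conjI)
    fix N t assume "i \<le> N"
    have "(\<Sum>j\<le>N. of_nat (t ^ j) * (if j = i then d else 0)) = (\<Sum>j\<le>N. if j = i then of_nat (t ^ j) * d else 0)"
      by (intro sum.cong) auto
    with \<open>i \<le> N\<close> show "of_nat (t ^ i) * d = (\<Sum>j\<le>N. of_nat (t ^ j) * (if j = i then d else 0))"
      by simp
    have "(\<Sum>j\<le>N. of_nat (t ^ (j - 1)) * (of_nat j * (if j = i then d else 0)))
        = (\<Sum>j\<le>N. if j = i then of_nat (t ^ (j - 1)) * (of_nat j * d) else 0)"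
      by (intro sum.cong) auto
    also have "\<dots> = of_nat (i * t ^ (i - 1)) * d"
      using \<open>i \<le> N\<close> by (simp add: mult.commute[of i] flip: mult.assoc)
    finally show "of_nat (i * t ^ (i - 1)) * d =
        (\<Sum>j\<le>N. of_nat (t ^ (j - 1)) * (of_nat j * (if j = i then d else 0)))" by simp
  qed
next
  case (pder_add p p' q q')
  then obtain n c m d where
    "\<forall>N\<ge>n. \<forall>t. p t = (\<Sum>j\<le>N. of_nat (t ^ j) * c j) \<and> p' t = (\<Sum>j\<le>N. of_nat (t ^ (j - 1)) * (of_nat j * c j))"
    "\<forall>N\<ge>m. \<forall>t. q t = (\<Sum>j\<le>N. of_nat (t ^ j) * d j) \<and> q' t = (\<Sum>j\<le>N. of_nat (t ^ (j - 1)) * (of_nat j * d j))"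
    by blast
  then have "p t + q t = (\<Sum>j\<le>N. of_nat (t ^ j) * (c j + d j)) \<and>
      p' t + q' t = (\<Sum>j\<le>N. of_nat (t ^ (j - 1)) * (of_nat j * (c j + d j)))" if "max n m \<le> N" for N t
    using that by (auto simp: distrib_left sum.distrib)
  then show ?case
    by (intro exI[of _ "max n m"] exI[of _ "\<lambda>j. c j + d j"]) blast
qed

text \<open>Cancelling positive integers modulo \<open>J\<close> is the form in which characteristic
  0 enters the calculus.\<close>

locale saturated_ideal =
  fixes J :: "'a::ring_1 set"
  assumes zero [simp, intro]: "0 \<in> J"
    and add [intro]: "a \<in> J \<Longrightarrow> b \<in> J \<Longrightarrow> a + b \<in> J"
    and mult_left [intro]: "a \<in> J \<Longrightarrow> c * a \<in> J"
    and mult_right [intro]: "a \<in> J \<Longrightarrow> a * c \<in> J"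
    and saturated: "of_nat n * a \<in> J \<Longrightarrow> n > 0 \<Longrightarrow> a \<in> J"
begin

lemma minus [intro]: "a \<in> J \<Longrightarrow> - a \<in> J"
  using mult_left[of a "-1"] by simp

lemma minus_iff [simp]: "- a \<in> J \<longleftrightarrow> a \<in> J"
  using minus[of a] minus[of "- a"] by auto

lemma diff [intro]: "a \<in> J \<Longrightarrow> b \<in> J \<Longrightarrow> a - b \<in> J"
  using add[of a "- b"] by auto

lemma add_cancel: "b \<in> J \<Longrightarrow> a + b \<in> J \<longleftrightarrow> a \<in> J" "b \<in> J \<Longrightarrow> b + a \<in> J \<longleftrightarrow> a \<in> J"
  using diff[of "a + b" b] diff[of "b + a" b] by auto

lemma diff_cancel: "b \<in> J \<Longrightarrow> a - b \<in> J \<longleftrightarrow> a \<in> J" "b \<in> J \<Longrightarrow> b - a \<in> J \<longleftrightarrow> a \<in> J"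
  using add_cancel[of "- b" a] add_cancel[of b "- a"] by auto

lemma sum [intro]: "(\<And>i. i \<in> S \<Longrightarrow> f i \<in> J) \<Longrightarrow> sum f S \<in> J"
  by (induction S rule: infinite_finite_induct) auto

lemma saturated_iff: "n > 0 \<Longrightarrow> of_nat n * a \<in> J \<longleftrightarrow> a \<in> J"
  using saturated by auto

text \<open>With p the polynomial function, 2^(n+1) p(t) - p(2t) has lost the top coefficient, while
  the others are multiplied by the positive integers 2^(n+1) - 2^j. The top one follows at t =
  1.\<close>

lemma vandermonde:
  assumes "\<And>t. (\<Sum>j\<le>n. of_nat (t ^ j) * c j) \<in> J" "j \<le> n"
  shows "c j \<in> J"
  using assms
proof (induction n arbitrary: c j)
  case 0
  from "0.prems"(1)[of 0] "0.prems"(2) show ?case by simp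
next
  case (Suc n)
  let ?p = "\<lambda>t. \<Sum>j\<le>Suc n. of_nat (t ^ j) * c j"
  have *: "c j \<in> J" if "j \<le> n" for j
  proof -
    have "(\<Sum>j\<le>n. of_nat (t ^ j) * (of_nat (2 ^ Suc n - 2 ^ j) * c j)) \<in> J" for t
    proof -
      have "of_nat (2 ^ Suc n) * ?p t - ?p (2 * t)
          = (\<Sum>j\<le>Suc n. of_nat (2 ^ Suc n) * (of_nat (t ^ j) * c j) - of_nat ((2 * t) ^ j) * c j)"
        by (simp only: sum_subtractf sum_distrib_left)
      also have "\<dots> = (\<Sum>j\<le>Suc n. of_nat (t ^ j) * (of_nat (2 ^ Suc n - 2 ^ j) * c j))"
      proof (intro sum.cong refl)
        fix j assume "j \<in> {..Suc n}"
        then have le: "(2::nat) ^ j \<le> 2 ^ Suc n" by (intro power_increasing) auto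
        have "of_nat (2 ^ Suc n) * (of_nat (t ^ j) * c j) - of_nat ((2 * t) ^ j) * c j
            = (of_nat (t ^ j * 2 ^ Suc n) - of_nat (t ^ j * 2 ^ j)) * c j"
          by (simp only: left_diff_distrib of_nat_mult mult.assoc power_mult_distrib
              mult.commute[of _ "t ^ j"])
            (simp only: flip: of_nat_mult mult.assoc, simp only: mult.commute)
        also have "\<dots> = of_nat (t ^ j) * (of_nat (2 ^ Suc n - 2 ^ j) * c j)"
          by (simp only: of_nat_diff[OF le] of_nat_mult left_diff_distrib right_diff_distrib mult.assoc)
        finally show "of_nat (2 ^ Suc n) * (of_nat (t ^ j) * c j) - of_nat ((2 * t) ^ j) * c j
            = of_nat (t ^ j) * (of_nat (2 ^ Suc n - 2 ^ j) * c j)" .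
      qed
      finally have "(\<Sum>j\<le>n. of_nat (t ^ j) * (of_nat (2 ^ Suc n - 2 ^ j) * c j)) = of_nat (2 ^ Suc n) * ?p t - ?p (2 * t)"
        by simp
      moreover have "of_nat (2 ^ Suc n) * ?p t - ?p (2 * t) \<in> J"
        using Suc.prems(1) by blast
      ultimately show ?thesis by simp
    qed
    from Suc.IH[OF this that] show ?thesis
    proof (rule saturated)
      have "(2::nat) ^ j < 2 ^ Suc n" using that by (intro power_strict_increasing) auto
      then show "(0::nat) < 2 ^ Suc n - 2 ^ j" by simp
    qed
  qed
  moreover have "c (Suc n) \<in> J"
  proof -
    have "(\<Sum>j\<le>n. c j) + c (Suc n) \<in> J"
      using Suc.prems(1)[of 1] by simp
    moreover have "(\<Sum>j\<le>n. c j) \<in> J" using * by auto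
    ultimately show ?thesis using add_cancel by blast
  qed
  ultimately show ?case using Suc.prems(2) le_Suc_eq by blast
qed

lemma pder_mem:
  assumes "pder p p'" "\<And>t. p t \<in> J"
  shows "p' t \<in> J"
proof -
  obtain n c where "\<forall>t. p t = (\<Sum>j\<le>n. of_nat (t ^ j) * c j)"
    "\<forall>t. p' t = (\<Sum>j\<le>n. of_nat (t ^ (j - 1)) * (of_nat j * c j))"
    using pder_expansion[OF assms(1)] by blast
  with vandermonde[where n = n and c = c] assms(2) show ?thesis
    by (auto intro!: sum mult_left)
qed

text \<open>A formal integration: the derivative puts every (j+1) c_(j+1) into \<open>J\<close>,
  saturation cancels j + 1, and the increment is the sum of the c_(j+1). This is how changes of an
  argument that also occurs in a power are controlled.\<close>

lemma pder_increment_mem: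
  assumes "pder p p'" "\<And>t. p' t \<in> J"
  shows "p 1 - p 0 \<in> J"
proof -
  obtain n c where *: "\<forall>N\<ge>n. \<forall>t. p t = (\<Sum>j\<le>N. of_nat (t ^ j) * c j) \<and>
     p' t = (\<Sum>j\<le>N. of_nat (t ^ (j - 1)) * (of_nat j * c j))"
    using pder_expansion[OF assms(1)] by blast
  have p: "p t = (\<Sum>j\<le>Suc n. of_nat (t ^ j) * c j)" for t using *[rule_format, of "Suc n"] by simp
  have "p' t = (\<Sum>j\<le>n. of_nat (t ^ j) * (of_nat (Suc j) * c (Suc j)))" for t
    using *[rule_format, of "Suc n"] by (simp add: sum.atMost_Suc_shift del: sum.atMost_Suc of_nat_Suc)
  with assms(2) have "of_nat (Suc j) * c (Suc j) \<in> J" if "j \<le> n" for j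
    using vandermonde[where n = n and c = "\<lambda>j. of_nat (Suc j) * c (Suc j)" and j = j] that by auto
  then have "c (Suc j) \<in> J" if "j \<le> n" for j using saturated[of "Suc j"] that by blast
  moreover have "p 1 - p 0 = (\<Sum>j\<le>n. c (Suc j))"
    by (simp add: p sum.atMost_Suc_shift del: sum.atMost_Suc)
  ultimately show ?thesis by auto
qed

end

section \<open>Closed and contracted forms\<close>

lemma mult_of_nat_left_commute: "a * (of_nat n * b) = of_nat n * (a * b)" for a b :: "'a::ring_1"
  by (metis mult.assoc mult_of_nat_commute)

text \<open>Moving h to the left in x^i h x^(m-1-i) costs i times the central element \<langle>x,
  h\<rangle>, and the numbers i < m add up to \<open>m choose 2\<close>.\<close>

lemma pow_der_eq:
  fixes x h :: "'a::central_commutator_ring"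
  shows "pow_der m x h = of_nat m * (h * x ^ (m - 1)) + of_nat (m choose 2) * (\<langle>x, h\<rangle> * x ^ (m - 2))"
proof (induction m)
  case (Suc m)
  show ?case
  proof (cases m)
    case (Suc k)
    have "x * (of_nat m * (h * x ^ (m - 1))) = of_nat m * (h * x ^ m) + of_nat m * (\<langle>x, h\<rangle> * x ^ k)"
    proof -
      have "x * (h * x ^ k) = h * x ^ m + \<langle>x, h\<rangle> * x ^ k"
        by (simp add: Suc commutator_def left_diff_distrib mult.assoc)
      then show ?thesis
        unfolding mult_of_nat_left_commute[of x m] by (simp add: Suc distrib_left del: of_nat_Suc)
    qed
    moreover have "x * (of_nat (m choose 2) * (\<langle>x, h\<rangle> * x ^ (m - 2))) = of_nat (m choose 2) * (\<langle>x, h\<rangle> * x ^ k)"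
    proof (cases k)
      case (Suc l)
      have "x * (of_nat (m choose 2) * (\<langle>x, h\<rangle> * x ^ l)) = of_nat (m choose 2) * (x * (\<langle>x, h\<rangle> * x ^ l))"
        by (rule mult_of_nat_left_commute)
      also have "x * (\<langle>x, h\<rangle> * x ^ l) = \<langle>x, h\<rangle> * x ^ k"
        by (simp add: Suc commutator_left_commute)
      finally show ?thesis using \<open>m = Suc k\<close> Suc by simp
    qed (simp add: \<open>m = Suc k\<close> numeral_2_eq_2)
    moreover have "Suc m choose 2 = m + (m choose 2)"
      by (simp add: numeral_2_eq_2)
    ultimately show ?thesis
      using Suc.IH by (simp add: Suc distrib_left distrib_right del: binomial_Suc_Suc)
  qed (simp add: numeral_2_eq_2)
qed (simp add: numeral_2_eq_2)

lemma commutator_power: "\<langle>x ^ m, b\<rangle> = of_nat m * (\<langle>x, b\<rangle> * x ^ (m - 1))"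
  for x b :: "'a::central_commutator_ring"
proof (induction m)
  case (Suc m)
  have "x * (of_nat m * (\<langle>x, b\<rangle> * x ^ (m - 1))) = of_nat m * (\<langle>x, b\<rangle> * x ^ m)"
  proof (cases m)
    case (Suc k)
    have "x * (of_nat m * (\<langle>x, b\<rangle> * x ^ k)) = of_nat m * (x * (\<langle>x, b\<rangle> * x ^ k))"
      by (rule mult_of_nat_left_commute)
    then show ?thesis by (simp add: Suc commutator_left_commute)
  qed simp
  then show ?case by (simp add: Suc commutator_mult distrib_right)
qed simp

text \<open>The correction terms in \<open>pow_der_eq\<close> contain a commutator with
  \<open>y b\<close>, which is killed by the product that has \<open>y b\<close> as an
  argument.\<close>

lemma pow_der_cprod:
  fixes y :: "nat \<Rightarrow> 'a::central_commutator_ring"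
  assumes "b < 2 * s"
  shows "pow_der m (y b) h * cprod s y = of_nat m * (h * (y b ^ (m - 1) * cprod s y))"
proof -
  have "\<langle>y b, h\<rangle> * y b ^ (m - 2) * cprod s y = y b ^ (m - 2) * (\<langle>y b, h\<rangle> * cprod s y)"
    by (metis commutator_commute mult.assoc)
  also have "\<dots> = 0" using commutator_cprod_eq_0(1)[OF assms, of y h] by simp
  finally show ?thesis
    by (simp add: pow_der_eq distrib_right mult.assoc)
qed

text \<open>\<open>J\<close> stands for a T-ideal and \<open>A\<close> for the algebra without unit,
  both seen in a unital ring. Variables take values in \<open>A\<close>, whereas \<open>J\<close>
  absorbs multiplication by the whole ring.\<close>

locale ideal_pair = saturated_ideal J for J :: "'a::central_commutator_ring set" +
  fixes A :: "'a set"
  assumes A_zero [simp]: "0 \<in> A"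
    and A_add [simp]: "a \<in> A \<Longrightarrow> b \<in> A \<Longrightarrow> a + b \<in> A"
    and A_mult_left [simp]: "a \<in> A \<Longrightarrow> c * a \<in> A"
    and A_mult_right [simp]: "a \<in> A \<Longrightarrow> a * c \<in> A"
begin

lemma A_uminus [simp]: "a \<in> A \<Longrightarrow> - a \<in> A"
  using A_mult_left[of a "-1"] by simp

lemma A_commutator [simp]: "a \<in> A \<Longrightarrow> \<langle>a, b\<rangle> \<in> A"
  unfolding commutator_def using A_add[of "a * b" "- (b * a)"] by simp

definition args :: "(nat \<Rightarrow> 'a) \<Rightarrow> bool" where
  "args y \<longleftrightarrow> (\<forall>i. y i \<in> A)"

lemma argsD [simp]: "args y \<Longrightarrow> y i \<in> A"
  by (simp add: args_def)

lemma args_upd [simp]: "args y \<Longrightarrow> a \<in> A \<Longrightarrow> args (y(i := a))"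
  by (simp add: args_def fun_upd_apply)

lemma args_comp [simp]: "args y \<Longrightarrow> args (y \<circ> p)"
  by (simp add: args_def comp_apply)

text \<open>In terms of differential forms, with \<open>cprod s y\<close> as \<open>dy\<^sub>0 \<and> \<dots> \<and> dy\<^sub>2\<^sub>s\<^sub>-\<^sub>1\<close>:
  \<open>J\<close> contains the closed \<open>2s\<close>-forms, all \<open>2s\<close>-forms, or the contractions of closed
  \<open>2s+1\<close>-forms with the Euler field, with polynomial coefficients of degree \<open>p\<close>.\<close>

definition closed_forms :: "nat \<Rightarrow> nat \<Rightarrow> bool" where
  "closed_forms s p \<longleftrightarrow> (\<forall>y. args y \<longrightarrow> y 0 ^ p * cprod s y \<in> J)"

definition all_forms :: "nat \<Rightarrow> nat \<Rightarrow> bool" where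
  "all_forms s p \<longleftrightarrow> (\<forall>x y. x \<in> A \<longrightarrow> args y \<longrightarrow> x ^ p * cprod s y \<in> J)"

definition contracted_forms :: "nat \<Rightarrow> nat \<Rightarrow> bool" where
  "contracted_forms s p \<longleftrightarrow> (\<forall>x y. x \<in> A \<longrightarrow> args y \<longrightarrow> econtr s x y * x ^ p \<in> J)"

lemma closed_forms_iff:
  assumes "b < 2 * s"
  shows "closed_forms s p \<longleftrightarrow> (\<forall>y. args y \<longrightarrow> y b ^ p * cprod s y \<in> J)"
proof (cases "b = 0")
  case False
  have iff: "y b ^ p * cprod s y \<in> J \<longleftrightarrow> (y \<circ> transpose 0 b) 0 ^ p * cprod s (y \<circ> transpose 0 b) \<in> J" for y
    using False assms by (simp add: cprod_transpose) (simp add: comp_apply)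
  have "y \<circ> transpose 0 b \<circ> transpose 0 b = y" for y :: "nat \<Rightarrow> 'a"
    by (simp add: fun_eq_iff comp_apply)
  then show ?thesis
    unfolding closed_forms_def iff by (metis args_comp)
qed (simp add: closed_forms_def)

lemma closed_formsD: "closed_forms s p \<Longrightarrow> b < 2 * s \<Longrightarrow> args y \<Longrightarrow> y b ^ p * cprod s y \<in> J"
  using closed_forms_iff by blast

lemma all_imp_closed: "all_forms s p \<Longrightarrow> closed_forms s p"
  by (simp add: all_forms_def closed_forms_def)

lemma pder_cprod:
  fixes y :: "nat \<Rightarrow> 'a"
  assumes "b < 2 * s"
  shows "pder (\<lambda>t. cprod s (y(b := x + of_nat t * z))) (\<lambda>t. cprod s (y(b := z)))"
  by (subst cprod_add[OF assms], subst cprod_of_nat_mult[OF assms]) (rule pder_affine)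

text \<open>The element shown is d(x^p y_b) in place b of the product, again a closed form. It
  arises as the derivative at t = 0 of the given identity with x + t y_b in place b.\<close>

lemma closed_forms_polarized:
  assumes "closed_forms s p" "b < 2 * s" "args y" "x \<in> A"
  shows "x ^ p * cprod s y + of_nat p * (y b * (x ^ (p - 1) * cprod s (y(b := x)))) \<in> J"
proof -
  let ?w = "\<lambda>t. x + of_nat t * y b"
  have w: "pder (\<lambda>t. ?w t ^ p) (\<lambda>t. pow_der p (?w t) (y b))"
    by (rule pder_power, rule pder_affine)
  have c: "pder (\<lambda>t. cprod s (y(b := ?w t))) (\<lambda>t. cprod s (y(b := y b)))"
    by (rule pder_cprod[OF assms(2)])
  have "pder (\<lambda>t. ?w t ^ p * cprod s (y(b := ?w t)))
      (\<lambda>t. pow_der p (?w t) (y b) * cprod s (y(b := ?w t)) + ?w t ^ p * cprod s (y(b := y b)))"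
    by (rule pder_mult[OF w c])
  moreover have "?w t ^ p * cprod s (y(b := ?w t)) \<in> J" for t
    using closed_formsD[OF assms(1,2), of "y(b := ?w t)"] assms by simp
  ultimately have "pow_der p (?w 0) (y b) * cprod s (y(b := ?w 0)) + ?w 0 ^ p * cprod s (y(b := y b)) \<in> J"
    by (rule pder_mem)
  then show ?thesis
    using pow_der_cprod[OF assms(2), of p "y(b := x)" "y b"] by (simp add: add.commute)
qed

lemma closed_forms_contraction:
  assumes "closed_forms s p" "args y" "x \<in> A"
  shows "of_nat (2 * s) * (x ^ p * cprod s y)
    + of_nat p * (\<Sum>b<2 * s. y b * (x ^ (p - 1) * cprod s (y(b := x)))) \<in> J"
proof -
  have "(\<Sum>b<2 * s. x ^ p * cprod s y + of_nat p * (y b * (x ^ (p - 1) * cprod s (y(b := x))))) \<in> J"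
    using assms by (intro sum closed_forms_polarized) simp_all
  then show ?thesis by (simp add: sum.distrib sum_distrib_left)
qed

lemma econtr_power:
  "econtr s x y * x ^ p = x ^ Suc p * cprod s y - (\<Sum>b<2 * s. y b * (x ^ p * cprod s (y(b := x))))"
  for x :: 'a
proof -
  have "x * cprod s y * x ^ p = x ^ Suc p * cprod s y"
    by (simp add: mult.assoc cprod_commute)
  moreover have "y b * cprod s (y(b := x)) * x ^ p = y b * (x ^ p * cprod s (y(b := x)))" for b
    by (simp add: mult.assoc cprod_commute)
  ultimately show ?thesis
    by (simp add: econtr_def left_diff_distrib sum_distrib_right)
qed

text \<open>Modulo closed forms, \<open>closed_forms_contraction\<close> makes the sum in
  \<open>econtr_power\<close> equal to -2s/(p+1) times the leading term. So p + 1 times the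
  contraction is p + 1 + 2s times the leading term, and both integers are positive.\<close>

lemma contracted_iff_all_forms:
  assumes "closed_forms s (Suc p)"
  shows "contracted_forms s p \<longleftrightarrow> all_forms s (Suc p)"
proof -
  have "econtr s x y * x ^ p \<in> J \<longleftrightarrow> x ^ Suc p * cprod s y \<in> J" if "x \<in> A" "args y" for x y
  proof -
    let ?S = "\<Sum>b<2 * s. y b * (x ^ p * cprod s (y(b := x)))"
    let ?T = "of_nat (2 * s) * (x ^ Suc p * cprod s y) + of_nat (Suc p) * ?S"
    have T: "?T \<in> J"
      using closed_forms_contraction[OF assms that(2,1)] by simp
    have "of_nat (Suc p) * (econtr s x y * x ^ p) = of_nat (Suc p + 2 * s) * (x ^ Suc p * cprod s y) - ?T"
      unfolding econtr_power of_nat_add right_diff_distrib distrib_right by simp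
    then have "of_nat (Suc p) * (econtr s x y * x ^ p) \<in> J
        \<longleftrightarrow> of_nat (Suc p + 2 * s) * (x ^ Suc p * cprod s y) \<in> J"
      by (simp only: diff_cancel(1)[OF T])
    then show ?thesis by (simp only: saturated_iff zero_less_Suc add_Suc)
  qed
  then show ?thesis
    unfolding contracted_forms_def all_forms_def by blast
qed

end

section \<open>Implications between the kinds of forms\<close>

lemma cprod_entry_left_commute:
  fixes y :: "nat \<Rightarrow> 'a::central_commutator_ring"
  assumes "b < 2 * s"
  shows "y b * (c * (e * cprod s y)) = c * (y b * (e * cprod s y))"
proof -
  have "\<langle>y b, c\<rangle> * (e * cprod s y) = 0"
    using commutator_cprod_eq_0(1)[OF assms, of y c] by (simp add: commutator_left_commute)
  then show ?thesis by (simp add: commutator_def left_diff_distrib mult.assoc)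
qed

text \<open>With the commutator counted as a further factor, this is the transposition of the places
  b and 2s.\<close>

lemma commutator_exchange_cprod:
  fixes y :: "nat \<Rightarrow> 'a::central_commutator_ring"
  assumes "b < 2 * s"
  shows "\<langle>y b, c\<rangle> * cprod s (y(b := x)) = - (\<langle>x, c\<rangle> * cprod s y)"
proof -
  have "y(b := x, 2 * s := y b, 2 * s + 1 := c) = y(2 * s := x, 2 * s + 1 := c) \<circ> transpose b (2 * s)"
    using assms by (auto simp: fun_eq_iff comp_apply fun_upd_apply transpose_def)
  then show ?thesis
    unfolding commutator_cprod using assms by (simp only:) (rule cprod_transpose, simp_all)
qed

text \<open>A commutator is central with square zero, so the binomial expansion stops after the
  linear term.\<close>

lemma power_add_commutator:
  fixes x a b :: "'a::central_commutator_ring"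
  shows "(x + \<langle>a, b\<rangle>) ^ p = x ^ p + of_nat p * (\<langle>a, b\<rangle> * x ^ (p - 1))"
proof (induction p)
  case (Suc p)
  let ?c = "\<langle>a, b\<rangle>"
  have "(x + ?c) ^ Suc p = x ^ Suc p + ?c * x ^ p + of_nat p * (x * (?c * x ^ (p - 1)))
      + of_nat p * (?c * ?c * x ^ (p - 1))"
    by (simp only: power_Suc Suc distrib_left distrib_right mult_of_nat_left_commute mult.assoc add.assoc)
  also have "of_nat p * (x * (?c * x ^ (p - 1))) = of_nat p * (?c * x ^ p)"
    by (cases p) (simp_all add: commutator_left_commute)
  also have "?c * ?c * x ^ (p - 1) = 0"
    by (simp add: commutator_square)
  finally show ?case by (simp add: distrib_right)
qed simp

lemma cprod_add_commutator:
  fixes y :: "nat \<Rightarrow> 'a::central_commutator_ring"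
  assumes "b < 2 * s"
  shows "cprod s (y(b := x + \<langle>c, d\<rangle>)) = cprod s (y(b := x))"
proof -
  have "cprod s (y(b := \<langle>c, d\<rangle>)) = 0"
    by (rule cprod_eq_0[OF assms]) simp
  then show ?thesis by (simp add: cprod_add[OF assms])
qed

context ideal_pair
begin

lemma closed_formsD_upd:
  "closed_forms s p \<Longrightarrow> b < 2 * s \<Longrightarrow> args y \<Longrightarrow> x \<in> A \<Longrightarrow> x ^ p * cprod s (y(b := x)) \<in> J"
  using closed_formsD[of s p b "y(b := x)"] by simp

lemma closed_forms_degree_Suc:
  assumes "closed_forms s p"
  shows "closed_forms s (Suc p)"
  using assms mult_left by (auto simp: closed_forms_def mult.assoc)

text \<open>Multiply the relation \<open>closed_forms_contraction\<close> by x. In each summand x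
  can be moved past \<open>y b\<close> because it is an argument of the product, and the sum becomes
  \<open>?S\<close>, whose terms are closed forms times coefficients. Hence both parts of the
  contraction lie in \<open>J\<close>.\<close>

lemma closed_imp_contracted:
  assumes "closed_forms s p" "s > 0"
  shows "contracted_forms s p"
  unfolding contracted_forms_def
proof (intro allI impI)
  fix x y assume x: "x \<in> A" and y: "args y"
  let ?S = "\<Sum>b<2 * s. y b * (x ^ p * cprod s (y(b := x)))"
  let ?T = "\<Sum>b<2 * s. y b * (x ^ (p - 1) * cprod s (y(b := x)))"
  have S: "?S \<in> J"
    using x y by (intro sum mult_left closed_formsD_upd[OF assms(1)]) simp_all
  have T: "x * (of_nat (2 * s) * (x ^ p * cprod s y) + of_nat p * ?T) \<in> J"
    using closed_forms_contraction[OF assms(1) y x] by (rule mult_left)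
  have "of_nat p * (x * ?T) = of_nat p * ?S"
  proof (cases p)
    case (Suc q)
    have "x * (y b * (x ^ q * cprod s (y(b := x)))) = y b * (x ^ p * cprod s (y(b := x)))"
      if "b < 2 * s" for b
      using cprod_entry_left_commute[OF that, of "y(b := x)" "y b" "x ^ q"] by (simp add: Suc mult.assoc)
    then show ?thesis by (simp add: sum_distrib_left Suc del: of_nat_Suc)
  qed simp
  then have "x * (of_nat (2 * s) * (x ^ p * cprod s y) + of_nat p * ?T)
      = of_nat (2 * s) * (x ^ Suc p * cprod s y) + of_nat p * ?S"
    by (simp only: distrib_left mult_of_nat_left_commute power_Suc mult.assoc)
  with T have "of_nat (2 * s) * (x ^ Suc p * cprod s y) + of_nat p * ?S \<in> J"
    by (simp only:)
  then have "of_nat (2 * s) * (x ^ Suc p * cprod s y) \<in> J"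
    by (simp only: add_cancel(1)[OF mult_left[OF S]])
  then have "x ^ Suc p * cprod s y \<in> J"
    by (rule saturated) (use assms in simp)
  with S show "econtr s x y * x ^ p \<in> J"
    unfolding econtr_power by (rule diff[rotated])
qed

text \<open>Add \<langle>y_2s, y_(2s+1)\<rangle> to \<open>y 0\<close>: the product does not notice
  a central summand, while the linear term of the power supplies one more commutator factor.\<close>

lemma closed_imp_closed_Suc:
  assumes "closed_forms s (Suc p)" "s > 0"
  shows "closed_forms (Suc s) p"
  unfolding closed_forms_def
proof (intro allI impI)
  fix y assume y: "args y"
  let ?c = "\<langle>y (2 * s), y (2 * s + 1)\<rangle>" and ?x = "y 0"
  have "(?x + ?c) ^ Suc p * cprod s (y(0 := ?x + ?c)) \<in> J"
    using y assms by (intro closed_formsD_upd) simp_all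
  also have "cprod s (y(0 := ?x + ?c)) = cprod s y"
    using assms by (simp add: cprod_add_commutator)
  also have "(?x + ?c) ^ Suc p * cprod s y = ?x ^ Suc p * cprod s y + of_nat (Suc p) * (?x ^ p * cprod (Suc s) y)"
    by (simp add: power_add_commutator distrib_right mult.assoc cprod_left_commute
        commutator_left_commute cprod_commute del: power_Suc of_nat_Suc)
  finally have "of_nat (Suc p) * (?x ^ p * cprod (Suc s) y) \<in> J"
    using assms y by (simp only: add_cancel(2)[OF closed_formsD[OF assms(1)]])
  then show "?x ^ p * cprod (Suc s) y \<in> J"
    by (rule saturated) simp
qed

lemma contracted_forms_degree_Suc:
  assumes "contracted_forms s p"
  shows "contracted_forms s (Suc p)"
  using assms mult_right by (auto simp: contracted_forms_def power_Suc2 simp del: power_Suc simp flip: mult.assoc)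

text \<open>Substitute \<open>x\<^sup>2\<close> for one of the arguments.\<close>

lemma contracted_imp_closed:
  assumes "contracted_forms s p" "s > 0"
  shows "closed_forms s (p + 2)"
  unfolding closed_forms_def
proof (intro allI impI)
  fix y assume y: "args y"
  let ?x = "y 0"
  let ?z = "y(0 := ?x * ?x)"
  have pos: "0 < 2 * s" using assms by simp
  have z: "cprod s ?z = ?x * cprod s y + ?x * cprod s y"
    by (simp add: cprod_mult[OF pos] cprod_commute)
  \<comment> \<open>With x in place b and x * x in place 0, the Leibniz rule leaves only products in
    which x is repeated.\<close>
  have "cprod s (?z(b := ?x)) = 0" if "0 < b" "b < 2 * s" for b
  proof -
    have "cprod s (y(b := ?x)) = 0"
      using that by (intro cprod_repeat[of _ 0 b]) auto
    moreover have "?z(b := ?x) = y(b := ?x, 0 := ?x * ?x)"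
      using that by (simp add: fun_upd_twist)
    moreover have "y(b := ?x, 0 := ?x) = y(b := ?x)"
      using that by (simp add: fun_eq_iff fun_upd_apply)
    ultimately show ?thesis by (simp add: cprod_mult[OF pos])
  qed
  then have "(\<Sum>b<2 * s. ?z b * (?x ^ p * cprod s (?z(b := ?x))))
      = (\<Sum>b<2 * s. if b = 0 then ?x * ?x * (?x ^ p * cprod s y) else 0)"
    by (intro sum.cong) auto
  also have "\<dots> = ?x ^ (p + 2) * cprod s y"
    using pos by (simp add: mult.assoc)
  finally have "econtr s ?x ?z * ?x ^ p = ?x ^ Suc p * cprod s ?z - ?x ^ (p + 2) * cprod s y"
    unfolding econtr_power by (simp only:)
  \<comment> \<open>The differential of x * x contributes this form twice, and the only surviving
    term of the sum takes it away once.\<close>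
  also have "\<dots> = ?x ^ (p + 2) * cprod s y"
  proof -
    have "?x ^ p * (?x * e) = ?x * (?x ^ p * e)" for e
      by (simp add: power_commutes flip: mult.assoc)
    then show ?thesis unfolding z by (simp add: distrib_left mult.assoc)
  qed
  finally show "?x ^ (p + 2) * cprod s y \<in> J"
    using assms(1) y unfolding contracted_forms_def by (metis A_mult_left argsD args_upd)
qed

text \<open>Commute with a new variable.\<close>

lemma contracted_imp_closed_Suc:
  assumes "contracted_forms s p"
  shows "closed_forms (Suc s) p"
  unfolding closed_forms_iff[of "2 * s" "Suc s", simplified]
proof (intro allI impI)
  fix y assume y: "args y"
  let ?x = "y (2 * s)" and ?c = "y (2 * s + 1)"
  let ?F = "econtr s ?x y * ?x ^ p"
  have comm: "\<langle>a * cprod s z, ?c\<rangle> = \<langle>a, ?c\<rangle> * cprod s z" for a :: 'a and z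
    by (simp add: commutator_def left_diff_distrib mult.assoc cprod_commute)
  have "\<langle>y b * ?x ^ p, ?c\<rangle> * cprod s (y(b := ?x)) = - (?x ^ p * (\<langle>?x, ?c\<rangle> * cprod s y))"
    if "b < 2 * s" for b
  proof -
    have "\<langle>?x, ?c\<rangle> * cprod s (y(b := ?x)) = 0"
      using commutator_cprod_eq_0(1)[OF that, of "y(b := ?x)" ?c] by simp
    then have "\<langle>?x ^ p, ?c\<rangle> * cprod s (y(b := ?x)) = 0"
      by (simp add: commutator_power commutator_left_commute mult.assoc)
    moreover have "\<langle>y b, ?c\<rangle> * ?x ^ p * cprod s (y(b := ?x)) = - (?x ^ p * (\<langle>?x, ?c\<rangle> * cprod s y))"
      using commutator_exchange_cprod[OF that, of y ?c ?x]
      by (simp add: commutator_left_commute mult.assoc)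
    ultimately show ?thesis by (simp add: commutator_mult distrib_right mult.assoc)
  qed
  then have "(\<Sum>b<2 * s. \<langle>y b * ?x ^ p, ?c\<rangle> * cprod s (y(b := ?x)))
      = - (of_nat (2 * s) * (?x ^ p * (\<langle>?x, ?c\<rangle> * cprod s y)))"
    by simp
  moreover have "\<langle>?F, ?c\<rangle> = \<langle>?x ^ Suc p, ?c\<rangle> * cprod s y - (\<Sum>b<2 * s. \<langle>y b * ?x ^ p, ?c\<rangle> * cprod s (y(b := ?x)))"
  proof -
    have "\<langle>a - b, ?c\<rangle> = \<langle>a, ?c\<rangle> - \<langle>b, ?c\<rangle>" for a b
      by (simp add: commutator_def algebra_simps)
    moreover have "\<langle>sum f S, ?c\<rangle> = (\<Sum>b\<in>S. \<langle>f b, ?c\<rangle>)" for f and S :: "nat set"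
      by (simp add: commutator_def sum_distrib_left sum_distrib_right sum_subtractf)
    ultimately show ?thesis
      unfolding econtr_power by (simp only: comm flip: mult.assoc)
  qed
  moreover have "\<langle>?x ^ Suc p, ?c\<rangle> * cprod s y = of_nat (Suc p) * (?x ^ p * (\<langle>?x, ?c\<rangle> * cprod s y))"
    by (simp add: commutator_power commutator_left_commute mult.assoc del: power_Suc of_nat_Suc)
  \<comment> \<open>The power contributes p + 1 copies, and each of the 2s terms of the sum one
    more, because its sign changes twice.\<close>
  ultimately have "\<langle>?F, ?c\<rangle> = of_nat (Suc p + 2 * s) * (?x ^ p * (\<langle>?x, ?c\<rangle> * cprod s y))"
    by (simp only: of_nat_add distrib_right diff_minus_eq_add)
  moreover have "\<langle>?F, ?c\<rangle> \<in> J"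
  proof -
    have F: "?F \<in> J" using assms y by (simp add: contracted_forms_def)
    show ?thesis unfolding commutator_def by (intro diff mult_left[OF F] mult_right[OF F])
  qed
  ultimately have "of_nat (Suc p + 2 * s) * (?x ^ p * (\<langle>?x, ?c\<rangle> * cprod s y)) \<in> J"
    by simp
  then have "?x ^ p * (\<langle>?x, ?c\<rangle> * cprod s y) \<in> J"
    by (rule saturated) simp
  then show "?x ^ p * (cprod s y * \<langle>?x, y (Suc (2 * s))\<rangle>) \<in> J"
    by (simp add: commutator_commute)
qed

text \<open>Add a commutator to \<open>x\<close>.\<close>

lemma contracted_imp_all_Suc:
  assumes "contracted_forms s (Suc p)"
  shows "all_forms (Suc s) (Suc p)"
  unfolding all_forms_def
proof (intro allI impI)
  fix x y assume x: "x \<in> A" and y: "args y"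
  let ?c = "\<langle>y (2 * s), y (2 * s + 1)\<rangle>"
  let ?D = "cprod (Suc s) y" and ?S = "\<Sum>b<2 * s. y b * (x ^ p * cprod (Suc s) (y(b := x)))"
  let ?E = "econtr s x y"
  have "econtr s (x + ?c) y = ?E + ?c * cprod s y"
    by (simp add: econtr_def cprod_add_commutator distrib_right)
  then have "econtr s (x + ?c) y * (x + ?c) ^ Suc p
    = (?E + ?c * cprod s y) * (x ^ Suc p + of_nat (Suc p) * (?c * x ^ p))"
    by (simp only: power_add_commutator diff_Suc_1)
  also have "\<dots> = ?E * x ^ Suc p + (of_nat (Suc p) * (?c * (?E * x ^ p)) + x ^ Suc p * ?D)"
  proof -
    have 1: "?E * (of_nat (Suc p) * (?c * x ^ p)) = of_nat (Suc p) * (?c * (?E * x ^ p))"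
      by (simp only: mult_of_nat_left_commute commutator_left_commute)
    \<comment> \<open>The term of second order in the added commutator contains its square.\<close>
    have "?c * cprod s y * (?c * x ^ p) = ?c * ?c * (cprod s y * x ^ p)"
      by (simp only: commutator_left_commute[of _ _ "cprod s y"] mult.assoc)
    then have 2: "?c * cprod s y * (of_nat (Suc p) * (?c * x ^ p)) = 0"
      by (simp only: mult_of_nat_left_commute commutator_square mult_zero_left mult_zero_right)
    have "?c * cprod s y * x ^ Suc p = ?c * (x ^ Suc p * cprod s y)"
      by (simp only: mult.assoc cprod_commute)
    also have "\<dots> = x ^ Suc p * (?c * cprod s y)"
      by (rule commutator_left_commute)
    also have "\<dots> = x ^ Suc p * ?D"
      by (simp only: cprod.simps cprod_commute)
    finally have 3: "?c * cprod s y * x ^ Suc p = x ^ Suc p * ?D" .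
    show ?thesis by (simp only: distrib_left distrib_right 1 2 3 add_0_right) (simp only: add_ac)
  qed
  also have "?c * (?E * x ^ p) = x ^ Suc p * ?D - ?S"
  proof -
    have *: "?c * (z * (x ^ p * cprod s (y(b := x)))) = z * (x ^ p * cprod (Suc s) (y(b := x)))"
      if "b < 2 * s" for b z
    proof -
      have "?c * (z * (x ^ p * cprod s (y(b := x)))) = z * (x ^ p * (?c * cprod s (y(b := x))))"
        by (simp only: commutator_left_commute[of _ _ z] commutator_left_commute[of _ _ "x ^ p"])
      also have "?c * cprod s (y(b := x)) = cprod (Suc s) (y(b := x))"
        using that by (simp add: commutator_commute)
      finally show ?thesis .
    qed
    have "?c * (x ^ Suc p * cprod s y) = x ^ Suc p * (?c * cprod s y)"
      by (rule commutator_left_commute)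
    also have "?c * cprod s y = ?D"
      by (simp add: commutator_commute)
    finally have "?c * (x ^ Suc p * cprod s y) = x ^ Suc p * ?D" .
    moreover have "?c * (\<Sum>b<2 * s. y b * (x ^ p * cprod s (y(b := x)))) = ?S"
      unfolding sum_distrib_left by (intro sum.cong refl *) simp
    ultimately show ?thesis
      unfolding econtr_power by (simp only: right_diff_distrib)
  qed
  finally have "econtr s (x + ?c) y * (x + ?c) ^ Suc p
      = ?E * x ^ Suc p + (of_nat (Suc p) * (x ^ Suc p * ?D - ?S) + x ^ Suc p * ?D)" .
  moreover have "econtr s (x + ?c) y * (x + ?c) ^ Suc p \<in> J" and E: "?E * x ^ Suc p \<in> J"
    using assms x y by (simp_all add: contracted_forms_def del: power_Suc)
  ultimately have "of_nat (Suc p) * (x ^ Suc p * ?D - ?S) + x ^ Suc p * ?D \<in> J"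
    by (simp only: add_cancel(2)[OF E])
  \<comment> \<open>Polarized closed forms of degree 2s + 2, summed over the first 2s places only:
    added to the relation above they cancel \<open>?S\<close> and leave a positive multiple of
    x^(p+1) \<open>?D\<close>.\<close>
  moreover have "(\<Sum>b<2 * s. x ^ Suc p * ?D + of_nat (Suc p) * (y b * (x ^ p * cprod (Suc s) (y(b := x))))) \<in> J"
    using closed_forms_polarized[OF contracted_imp_closed_Suc[OF assms] _ y x]
    by (intro sum) (simp del: power_Suc of_nat_Suc cprod.simps)
  then have "of_nat (2 * s) * (x ^ Suc p * ?D) + of_nat (Suc p) * ?S \<in> J"
    by (simp add: sum.distrib sum_distrib_left del: power_Suc of_nat_Suc cprod.simps)
  ultimately have "(of_nat (Suc p) * (x ^ Suc p * ?D - ?S) + x ^ Suc p * ?D)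
      + (of_nat (2 * s) * (x ^ Suc p * ?D) + of_nat (Suc p) * ?S) \<in> J"
    by (rule add)
  also have "(of_nat (Suc p) * (x ^ Suc p * ?D - ?S) + x ^ Suc p * ?D)
      + (of_nat (2 * s) * (x ^ Suc p * ?D) + of_nat (Suc p) * ?S) = of_nat (Suc p + 1 + 2 * s) * (x ^ Suc p * ?D)"
    by (simp only: of_nat_add of_nat_1 distrib_right right_diff_distrib mult_1) simp
  finally show "x ^ Suc p * ?D \<in> J"
    by (rule saturated) simp
qed


text \<open>The left factor \<open>K\<close> makes it possible to linearize an expression in which
  another factor has already been pulled out.\<close>

lemma polarized:
  assumes "\<And>x. x \<in> A \<Longrightarrow> K * (x ^ p * cprod s y) \<in> J" "x \<in> A" "h \<in> A"
  shows "K * (pow_der p x h * cprod s y) \<in> J"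
proof -
  let ?w = "\<lambda>t. x + of_nat t * h"
  have w: "pder (\<lambda>t. ?w t ^ p) (\<lambda>t. pow_der p (?w t) h)"
    by (rule pder_power, rule pder_affine)
  have "pder (\<lambda>t. ?w t ^ p * cprod s y) (\<lambda>t. pow_der p (?w t) h * cprod s y + ?w t ^ p * 0)"
    by (rule pder_mult[OF w pder_const])
  from pder_mult[OF pder_const[of K] this]
  have "pder (\<lambda>t. K * (?w t ^ p * cprod s y)) (\<lambda>t. K * (pow_der p (?w t) h * cprod s y))"
    by simp
  then have "K * (pow_der p (?w 0) h * cprod s y) \<in> J"
    by (rule pder_mem) (use assms in simp)
  then show ?thesis by simp
qed

lemma polarized_entry:
  assumes "\<And>x. x \<in> A \<Longrightarrow> K * (x ^ Suc q * cprod s y) \<in> J" "b < 2 * s" "args y" "h \<in> A"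
  shows "K * (h * (y b ^ q * cprod s y)) \<in> J"
proof -
  have "K * (pow_der (Suc q) (y b) h * cprod s y) \<in> J"
    using assms by (intro polarized) auto
  also have "K * (pow_der (Suc q) (y b) h * cprod s y) = of_nat (Suc q) * (K * (h * (y b ^ q * cprod s y)))"
    by (simp only: pow_der_cprod[OF assms(2)] mult_of_nat_left_commute diff_Suc_1)
  finally show ?thesis by (rule saturated) simp
qed

lemma closed_forms_commutator:
  assumes "closed_forms (Suc s) q" "args y" "x \<in> A" "b \<in> A"
  shows "x ^ q * (\<langle>x, b\<rangle> * cprod s y) \<in> J"
  using closed_formsD[OF assms(1), of "2 * s" "y(2 * s := x, 2 * s + 1 := b)"] assms
  unfolding commutator_cprod by (simp del: cprod.simps)

lemma all_forms_commutator:
  assumes "all_forms (Suc s) (Suc q)" "args y" "x \<in> A" "b \<in> A" "c \<in> A"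
  shows "c * (x ^ q * (\<langle>x, b\<rangle> * cprod s y)) \<in> J"
proof -
  let ?z = "y(2 * s := x, 2 * s + 1 := b)"
  have "1 * (c * (?z (2 * s) ^ q * cprod (Suc s) ?z)) \<in> J"
    using assms by (intro polarized_entry) (simp_all del: cprod.simps power_Suc add: all_forms_def)
  then show ?thesis unfolding commutator_cprod by (simp del: cprod.simps)
qed

section \<open>Even degree forms\<close>

text \<open>Linearizing x^(q+1) replaces one factor x by an arbitrary b. The order of b and x
  matters only up to a term with \<langle>x, b\<rangle>, which is a closed form with one commutator
  more.\<close>

lemma all_forms_mult:
  assumes "all_forms s (Suc q)" "q > 0 \<Longrightarrow> closed_forms (Suc s) (q - 1)"
    and "args y" "x \<in> A" "b \<in> A"
  shows "b * (x ^ q * cprod s y) \<in> J" "x ^ q * (b * cprod s y) \<in> J"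
proof -
  \<comment> \<open>The proviso covers q = 0, where q - 1 is truncated but the coefficients n that
    occur vanish.\<close>
  have c: "of_nat n * (\<langle>x, b\<rangle> * x ^ (q - 1)) * cprod s y \<in> J" if "q = 0 \<Longrightarrow> n = 0" for n
  proof (cases "q = 0")
    case False
    then have "x ^ (q - 1) * (\<langle>x, b\<rangle> * cprod s y) \<in> J"
      using assms by (intro closed_forms_commutator) simp_all
    then have "\<langle>x, b\<rangle> * x ^ (q - 1) * cprod s y \<in> J"
      by (simp only: mult.assoc commutator_left_commute)
    then show ?thesis by (simp only: mult.assoc mult_left)
  qed (use that in simp)
  have "1 * (pow_der (Suc q) x b * cprod s y) \<in> J"
    using assms by (intro polarized) (simp_all del: power_Suc pow_der.simps add: all_forms_def)
  also have "1 * (pow_der (Suc q) x b * cprod s y) = of_nat (Suc q) * (b * (x ^ q * cprod s y))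
      + of_nat (Suc q choose 2) * (\<langle>x, b\<rangle> * x ^ (q - 1)) * cprod s y"
  proof -
    have "Suc q - 1 = q" "Suc q - 2 = q - 1" by simp_all
    then show ?thesis by (simp only: pow_der_eq mult_1 distrib_right mult.assoc)
  qed
  finally have "of_nat (Suc q) * (b * (x ^ q * cprod s y)) \<in> J"
    by (subst (asm) add_cancel(1)[OF c]) (simp_all add: numeral_2_eq_2)
  then show *: "b * (x ^ q * cprod s y) \<in> J"
    by (rule saturated) simp
  have "x ^ q * (b * cprod s y) = b * (x ^ q * cprod s y) + of_nat q * (\<langle>x, b\<rangle> * x ^ (q - 1)) * cprod s y"
    unfolding commutator_power[symmetric] by (simp add: commutator_def left_diff_distrib mult.assoc)
  then show "x ^ q * (b * cprod s y) \<in> J"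
    using add[OF * c[of q]] by simp
qed

lemma even_form_mult:
  assumes "all_forms s (Suc m)" "m > 0 \<Longrightarrow> closed_forms (Suc s) (m - 1)" "s > 0"
    and "args y" "b \<in> A"
  shows "b * (y 0 ^ m * cprod s y) \<in> J" "y 0 ^ m * cprod s y * b \<in> J"
  using all_forms_mult[OF assms(1,2), of y "y 0" b] assms by (simp_all add: mult.assoc cprod_commute)

lemma even_form_perturb:
  assumes "all_forms s (Suc m)" "m > 0 \<Longrightarrow> closed_forms (Suc s) (m - 1)" "s > 0"
    and "args y" "a \<in> A" "b \<in> A" "0 < i" "i < 2 * s"
  shows "y 0 ^ m * cprod s (y(i := y i + a * b)) - y 0 ^ m * cprod s y \<in> J"
proof -
  have "y 0 ^ m * cprod s (y(i := y i + a * b)) - y 0 ^ m * cprod s y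
    = y 0 ^ m * (a * cprod s (y(i := b))) + y 0 ^ m * (b * cprod s (y(i := a)))"
    by (simp add: cprod_add cprod_mult assms cprod_commute distrib_left)
  then show ?thesis
    using assms by (auto intro!: add all_forms_mult(2))
qed

text \<open>Here the altered argument also occurs in the power. The change is integrated along y_0 +
  t ab, so that only the derivative has to be placed in \<open>J\<close>.\<close>

lemma even_form_perturb_first:
  assumes "all_forms s (Suc m)" "m > 0 \<Longrightarrow> closed_forms (Suc s) (m - 1)" "s > 0"
    and "args y" "a \<in> A" "b \<in> A"
  shows "(y 0 + a * b) ^ m * cprod s (y(0 := y 0 + a * b)) - y 0 ^ m * cprod s y \<in> J"
proof -
  let ?w = "\<lambda>t. y 0 + of_nat t * (a * b)"
  have pos: "0 < 2 * s" using assms by simp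
  have w: "pder (\<lambda>t. ?w t ^ m) (\<lambda>t. pow_der m (?w t) (a * b))"
    by (rule pder_power, rule pder_affine)
  have c: "pder (\<lambda>t. cprod s (y(0 := ?w t))) (\<lambda>t. cprod s (y(0 := a * b)))"
    by (rule pder_cprod[OF pos])
  have "pder (\<lambda>t. ?w t ^ m * cprod s (y(0 := ?w t)))
      (\<lambda>t. pow_der m (?w t) (a * b) * cprod s (y(0 := ?w t)) + ?w t ^ m * cprod s (y(0 := a * b)))"
    by (rule pder_mult[OF w c])
  then have "?w 1 ^ m * cprod s (y(0 := ?w 1)) - ?w 0 ^ m * cprod s (y(0 := ?w 0)) \<in> J"
  proof (rule pder_increment_mem)
    fix t
    have x: "?w t \<in> A" using assms by simp
    have "?w t ^ m * cprod s (y(0 := a * b)) = ?w t ^ m * (a * cprod s (y(0 := b))) + ?w t ^ m * (b * cprod s (y(0 := a)))"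
      by (simp add: cprod_mult[OF pos] cprod_commute distrib_left)
    moreover have "?w t ^ m * (a * cprod s (y(0 := b))) \<in> J" "?w t ^ m * (b * cprod s (y(0 := a))) \<in> J"
      using assms x by (intro all_forms_mult(2); simp)+
    ultimately have 1: "?w t ^ m * cprod s (y(0 := a * b)) \<in> J"
      using add by simp
    let ?y = "y(0 := ?w t)"
    have 2: "pow_der m (?w t) (a * b) * cprod s ?y \<in> J"
    proof (cases m)
      case (Suc q)
      have "a * (b * (?y 0 ^ q * cprod s ?y)) \<in> J"
        using assms x pos Suc by (intro polarized_entry all_forms_mult(1)) (auto simp del: power_Suc)
      then have "of_nat m * (a * b * (?w t ^ q * cprod s ?y)) \<in> J"
        by (simp add: mult.assoc mult_left)
      also have "of_nat m * (a * b * (?w t ^ q * cprod s ?y)) = pow_der m (?y 0) (a * b) * cprod s ?y"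
        using pow_der_cprod[OF pos, of m ?y "a * b"] Suc by simp
      finally show ?thesis by simp
    qed simp
    show "pow_der m (?w t) (a * b) * cprod s ?y + ?w t ^ m * cprod s (y(0 := a * b)) \<in> J"
      using 1 2 by (rule add[rotated])
  qed
  then show ?thesis by simp
qed

section \<open>Contractions\<close>

text \<open>A second linearization pulls two factors out of x^(m+2). The reordering terms now carry
  the coefficient a in front of a commutator, so closed forms no longer suffice for them and
  \<open>all_forms (Suc s) m\<close> is assumed.\<close>

lemma all_forms_mult2:
  assumes "all_forms s (m + 2)" "all_forms (Suc s) m"
    and "args y" "x \<in> A" "a \<in> A" "b \<in> A"
  shows "a * (b * (x ^ m * cprod s y)) \<in> J" "a * (x ^ m * (b * cprod s y)) \<in> J"
proof -
  have c: "a * (of_nat n * (\<langle>x, b\<rangle> * x ^ (m - 1)) * cprod s y) \<in> J" if "m = 0 \<Longrightarrow> n = 0" for n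
  proof (cases m)
    case (Suc q)
    then have "a * (x ^ q * (\<langle>x, b\<rangle> * cprod s y)) \<in> J"
      using assms by (intro all_forms_commutator) simp_all
    then have "a * (\<langle>x, b\<rangle> * x ^ (m - 1) * cprod s y) \<in> J"
      by (simp only: mult.assoc commutator_left_commute Suc diff_Suc_1)
    then show ?thesis by (simp only: mult.assoc mult_left mult_of_nat_left_commute)
  qed (use that in simp)
  have "a * (z ^ Suc m * cprod s y) \<in> J" if "z \<in> A" for z
    using assms that
    by (intro all_forms_mult(1)) (simp_all del: power_Suc add: all_imp_closed)
  then have "a * (pow_der (Suc m) x b * cprod s y) \<in> J"
    using assms by (intro polarized)
  also have "a * (pow_der (Suc m) x b * cprod s y) = of_nat (Suc m) * (a * (b * (x ^ m * cprod s y)))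
      + a * (of_nat (Suc m choose 2) * (\<langle>x, b\<rangle> * x ^ (m - 1)) * cprod s y)"
  proof -
    have "Suc m - 1 = m" "Suc m - 2 = m - 1" by simp_all
    then show ?thesis by (simp only: pow_der_eq distrib_left distrib_right mult.assoc mult_of_nat_left_commute)
  qed
  finally have "of_nat (Suc m) * (a * (b * (x ^ m * cprod s y))) \<in> J"
    by (subst (asm) add_cancel(1)[OF c]) (simp_all add: numeral_2_eq_2)
  then show *: "a * (b * (x ^ m * cprod s y)) \<in> J"
    by (rule saturated) simp
  have "a * (x ^ m * (b * cprod s y)) = a * (b * (x ^ m * cprod s y)) + a * (of_nat m * (\<langle>x, b\<rangle> * x ^ (m - 1)) * cprod s y)"
    unfolding commutator_power[symmetric] by (simp add: commutator_def left_diff_distrib right_diff_distrib mult.assoc)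
  then show "a * (x ^ m * (b * cprod s y)) \<in> J"
    using add[OF * c[of m]] by simp
qed

lemma odd_form_mult:
  assumes "all_forms s (m + 2)" "all_forms (Suc s) m"
    and "args y" "x \<in> A" "c \<in> A"
  shows "c * (econtr s x y * x ^ m) \<in> J" "econtr s x y * x ^ m * c \<in> J"
proof -
  have "c * (x ^ Suc m * cprod s y) \<in> J" and r: "x ^ Suc m * (c * cprod s y) \<in> J"
    using assms by (intro all_forms_mult; simp add: all_imp_closed)+
  moreover have "c * (\<Sum>b<2 * s. y b * (x ^ m * cprod s (y(b := x)))) \<in> J"
    unfolding sum_distrib_left using assms by (intro sum all_forms_mult2) simp_all
  ultimately show "c * (econtr s x y * x ^ m) \<in> J"
    unfolding econtr_power right_diff_distrib by (intro diff)
  have "x ^ Suc m * cprod s y * c \<in> J"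
    using r by (simp only: mult.assoc cprod_commute)
  moreover have "(\<Sum>b<2 * s. y b * (x ^ m * cprod s (y(b := x)))) * c \<in> J"
    unfolding sum_distrib_right mult.assoc cprod_commute[of s _ c]
    using assms by (intro sum all_forms_mult2(2)) simp_all
  ultimately show "econtr s x y * x ^ m * c \<in> J"
    unfolding econtr_power left_diff_distrib by (rule diff)
qed

lemma econtr_add:
  assumes "i < 2 * s"
  shows "econtr s x (y(i := a + b)) = econtr s x (y(i := a)) + econtr s x (y(i := b))"
proof -
  have "(y(i := a + b)) j * cprod s (y(i := a + b, j := x))
      = (y(i := a)) j * cprod s (y(i := a, j := x)) + (y(i := b)) j * cprod s (y(i := b, j := x))"
    if "j < 2 * s" for j
  proof (cases "j = i")
    case False
    then show ?thesis
      by (simp add: fun_upd_twist[of i j] cprod_add[OF assms] distrib_left)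
  qed (simp add: distrib_right)
  then have "(\<Sum>j<2 * s. (y(i := a + b)) j * cprod s (y(i := a + b, j := x)))
      = (\<Sum>j<2 * s. (y(i := a)) j * cprod s (y(i := a, j := x)))
        + (\<Sum>j<2 * s. (y(i := b)) j * cprod s (y(i := b, j := x)))"
    by (simp flip: sum.distrib)
  then show ?thesis
    unfolding econtr_def by (simp add: cprod_add[OF assms] distrib_left)
qed

lemma odd_form_perturb:
  assumes "all_forms s (m + 2)" "all_forms (Suc s) m"
    and "args y" "x \<in> A" "a \<in> A" "b \<in> A" "i < 2 * s"
  shows "econtr s x (y(i := y i + a * b)) * x ^ m - econtr s x y * x ^ m \<in> J"
proof -
  let ?z = "y(i := a * b)"
  have "x ^ Suc m * (a * cprod s (y(i := b))) \<in> J" "x ^ Suc m * (b * cprod s (y(i := a))) \<in> J"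
    using assms by (intro all_forms_mult(2); simp add: all_imp_closed)+
  then have "x ^ Suc m * cprod s ?z \<in> J"
    using add by (simp add: cprod_mult[OF assms(7)] cprod_commute distrib_left del: power_Suc)
  moreover have "(\<Sum>j<2 * s. ?z j * (x ^ m * cprod s (?z(j := x)))) \<in> J"
  proof (intro sum)
    fix j assume "j \<in> {..<2 * s}"
    show "?z j * (x ^ m * cprod s (?z(j := x))) \<in> J"
    proof (cases "j = i")
      case True
      then show ?thesis using assms by (simp add: mult.assoc all_forms_mult2(1))
    next
      case False
      then have "?z j * (x ^ m * cprod s (?z(j := x))) = y j * (x ^ m * (a * cprod s (y(j := x, i := b))))
          + y j * (x ^ m * (b * cprod s (y(j := x, i := a))))"
        by (simp add: fun_upd_twist[of i j] cprod_mult[OF assms(7)] distrib_left cprod_commute[of s _ b])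
      moreover have "y j * (x ^ m * (a * cprod s (y(j := x, i := b)))) \<in> J"
        "y j * (x ^ m * (b * cprod s (y(j := x, i := a)))) \<in> J"
        using assms by (intro all_forms_mult2(2); simp)+
      ultimately show ?thesis using add by simp
    qed
  qed
  ultimately have "econtr s x ?z * x ^ m \<in> J"
    unfolding econtr_power by (rule diff)
  then show ?thesis by (simp add: econtr_add[OF assms(7)] distrib_right)
qed

lemma econtr_add_first: "econtr s (x + of_nat t * h) y = econtr s x y + of_nat t * econtr s h y"
  for h :: 'a
proof -
  have "y b * cprod s (y(b := x + of_nat t * h))
      = y b * cprod s (y(b := x)) + of_nat t * (y b * cprod s (y(b := h)))" if "b < 2 * s" for b
    by (simp add: cprod_add[OF that] cprod_of_nat_mult[OF that] distrib_left mult_of_nat_left_commute)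
  then show ?thesis
    by (simp add: econtr_def distrib_right sum.distrib sum_distrib_left right_diff_distrib mult.assoc)
qed

text \<open>The element x occurs in the power and in every term of the contraction, so the change is
  again integrated along x + t ab.\<close>

lemma odd_form_perturb_first:
  assumes "all_forms s (m + 2)" "all_forms (Suc s) m"
    and "args y" "x \<in> A" "a \<in> A" "b \<in> A"
  shows "econtr s (x + a * b) y * (x + a * b) ^ m - econtr s x y * x ^ m \<in> J"
proof -
  let ?h = "a * b"
  let ?w = "\<lambda>t. x + of_nat t * ?h"
  have w: "pder (\<lambda>t. ?w t ^ m) (\<lambda>t. pow_der m (?w t) ?h)"
    by (rule pder_power, rule pder_affine)
  have c: "pder (\<lambda>t. econtr s (?w t) y) (\<lambda>t. econtr s ?h y)"
    unfolding econtr_add_first by (rule pder_affine)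
  have "pder (\<lambda>t. econtr s (?w t) y * ?w t ^ m)
      (\<lambda>t. econtr s ?h y * ?w t ^ m + econtr s (?w t) y * pow_der m (?w t) ?h)"
    by (rule pder_mult[OF c w])
  then have "econtr s (?w 1) y * ?w 1 ^ m - econtr s (?w 0) y * ?w 0 ^ m \<in> J"
  proof (rule pder_increment_mem)
    fix t
    define v where "v = ?w t"
    have v: "v \<in> A" using assms by (simp add: v_def)
    have "econtr s ?h y * v ^ m = a * (b * (v ^ m * cprod s y)) - (\<Sum>j<2 * s. y j * (v ^ m * cprod s (y(j := ?h))))"
      by (simp add: econtr_def left_diff_distrib sum_distrib_right mult.assoc cprod_commute[of s _ "v ^ m"])
    moreover have "a * (b * (v ^ m * cprod s y)) \<in> J"
      using assms v by (intro all_forms_mult2)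
    moreover have "(\<Sum>j<2 * s. y j * (v ^ m * cprod s (y(j := ?h)))) \<in> J"
    proof (intro sum)
      fix j assume "j \<in> {..<2 * s}"
      then have j: "j < 2 * s" by simp
      have "y j * (v ^ m * (a * cprod s (y(j := b)))) \<in> J" "y j * (v ^ m * (b * cprod s (y(j := a)))) \<in> J"
        using assms v by (intro all_forms_mult2(2); simp)+
      then show "y j * (v ^ m * cprod s (y(j := ?h))) \<in> J"
        using add by (simp add: cprod_mult[OF j] cprod_commute[of s _ b] distrib_left)
    qed
    ultimately have 1: "econtr s ?h y * v ^ m \<in> J"
      using diff by simp
    have 2: "econtr s v y * pow_der m v ?h \<in> J"
    proof (cases m)
      case (Suc q)
      \<comment> \<open>The leading term of the contraction puts v in front of the derivative, and v
        * \<open>pow_der m\<close> is \<open>pow_der (Suc m)\<close> without its first summand; this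
        brings \<open>pow_der_eq\<close> into play.\<close>
      have "v * pow_der m v ?h * cprod s y = of_nat m * (a * (b * (v ^ m * cprod s y)))
          + of_nat (Suc m choose 2) * (a * (v ^ q * (\<langle>v, b\<rangle> * cprod s y)) + b * (v ^ q * (\<langle>v, a\<rangle> * cprod s y)))"
      proof -
        have "v * pow_der m v ?h = pow_der (Suc m) v ?h - ?h * v ^ m"
          by simp
        also have "\<dots> = of_nat m * (?h * v ^ m) + of_nat (Suc m choose 2) * (\<langle>v, ?h\<rangle> * v ^ q)"
          unfolding pow_der_eq by (simp add: Suc distrib_right numeral_2_eq_2 del: binomial_Suc_Suc)
        finally show ?thesis
          by (simp add: commutator_mult distrib_left distrib_right mult.assoc commutator_left_commute)
      qed
      moreover have "a * (b * (v ^ m * cprod s y)) \<in> J"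
        using assms v by (intro all_forms_mult2)
      moreover have "a * (v ^ q * (\<langle>v, b\<rangle> * cprod s y)) \<in> J" "b * (v ^ q * (\<langle>v, a\<rangle> * cprod s y)) \<in> J"
        using assms v Suc by (intro all_forms_commutator; simp)+
      ultimately have "v * pow_der m v ?h * cprod s y \<in> J"
        by (auto intro!: add mult_left)
      moreover have "(\<Sum>j<2 * s. y j * (pow_der m v ?h * cprod s (y(j := v)))) \<in> J"
      proof (intro sum)
        fix j assume "j \<in> {..<2 * s}"
        then have j: "j < 2 * s" by simp
        let ?y = "y(j := v)"
        \<comment> \<open>Two factors are pulled out with z free; the third, b, then comes from
          linearizing z at the entry v.\<close>
        have "y j * a * (z ^ Suc q * cprod s ?y) \<in> J" if "z \<in> A" for z
          using assms v that all_forms_mult2(1)[of s m ?y z "y j" a] by (simp add: Suc mult.assoc)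
        then have "y j * a * (b * (?y j ^ q * cprod s ?y)) \<in> J"
          using assms j v by (intro polarized_entry) simp_all
        then have "of_nat m * (y j * a * (b * (?y j ^ q * cprod s ?y))) \<in> J"
          by (rule mult_left)
        also have "of_nat m * (y j * a * (b * (?y j ^ q * cprod s ?y))) = y j * (pow_der m (?y j) ?h * cprod s ?y)"
          unfolding pow_der_cprod[OF j] by (simp only: Suc mult.assoc mult_of_nat_left_commute diff_Suc_1)
        finally show "y j * (pow_der m v ?h * cprod s ?y) \<in> J" by simp
      qed
      ultimately have "v * pow_der m v ?h * cprod s y - (\<Sum>j<2 * s. y j * (pow_der m v ?h * cprod s (y(j := v)))) \<in> J"
        by (rule diff)
      also have "v * pow_der m v ?h * cprod s y - (\<Sum>j<2 * s. y j * (pow_der m v ?h * cprod s (y(j := v))))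
          = econtr s v y * pow_der m v ?h"
        by (simp add: econtr_def left_diff_distrib sum_distrib_right mult.assoc
            cprod_commute[of s _ "pow_der m v ?h"])
      finally show ?thesis .
    qed simp
    show "econtr s ?h y * ?w t ^ m + econtr s (?w t) y * pow_der m (?w t) ?h \<in> J"
      using add[OF 1 2] by (simp add: v_def)
  qed
  then show ?thesis by simp
qed

end

section \<open>Standard identities as conditions on forms\<close>

lemma econtr_cong: "(\<And>i. i < 2 * s \<Longrightarrow> y i = z i) \<Longrightarrow> econtr s x y = econtr s x z"
  unfolding econtr_def
  by (intro arg_cong2[where f = "(-)"] arg_cong2[where f = "(*)"] refl sum.cong cprod_cong)
    (auto simp: fun_upd_apply)

text \<open>The sign \<sigma> unites r = 0, where no arguments are exchanged, with r > 0, where an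
  odd transposition moves \<open>y 0\<close> to the front of the contraction.\<close>

lemma std_odd_sign:
  obtains \<sigma> :: int where "\<sigma> = 1 \<or> \<sigma> = - 1"
    "\<And>y :: nat \<Rightarrow> 'a::central_commutator_ring. of_nat (2 ^ r) * std (Suc (2 * r)) y
      = of_int \<sigma> * (of_nat (fact (2 * r)) * econtr r (y 0) (y(0 := y (2 * r))))"
proof (cases "r = 0")
  case True
  have "of_nat (2 ^ r) * std (Suc (2 * r)) y
      = of_int 1 * (of_nat (fact (2 * r)) * econtr r (y 0) (y(0 := y (2 * r))))"
    for y :: "nat \<Rightarrow> 'a"
    using std_odd[of 0 y] by (simp add: True)
  then show ?thesis using that[of 1] by blast
next
  case False
  have "of_nat (2 ^ r) * std (Suc (2 * r)) y
      = of_int (- 1) * (of_nat (fact (2 * r)) * econtr r (y 0) (y(0 := y (2 * r))))"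
    for y :: "nat \<Rightarrow> 'a"
    using std_odd_first[of r y] False by simp
  then show ?thesis using that[of "- 1"] by blast
qed

context ideal_pair
begin

definition std_forms :: "nat \<Rightarrow> nat \<Rightarrow> bool" where
  "std_forms n p \<longleftrightarrow> (\<forall>y. args y \<longrightarrow> std n y * y 0 ^ p \<in> J)"

lemma scaled_iff:
  assumes "of_nat m * a = of_int \<sigma> * (of_nat n * b)" "\<sigma> = 1 \<or> \<sigma> = - 1" "m > 0" "n > 0"
  shows "a \<in> J \<longleftrightarrow> b \<in> J"
proof -
  have "a \<in> J \<longleftrightarrow> of_nat m * a \<in> J" using saturated_iff[OF assms(3)] by simp
  also have "\<dots> \<longleftrightarrow> of_nat n * b \<in> J" unfolding assms(1) using assms(2) by auto
  also have "\<dots> \<longleftrightarrow> b \<in> J" by (rule saturated_iff[OF assms(4)])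
  finally show ?thesis .
qed

lemma std_even_mem_iff: "c * std (2 * r) y * d \<in> J \<longleftrightarrow> c * cprod r y * d \<in> J"
proof -
  have "of_nat (2 ^ r) * (c * std (2 * r) y * d) = c * (of_nat (2 ^ r) * std (2 * r) y) * d"
    by (simp only: mult.assoc mult_of_nat_left_commute[of c])
  also have "\<dots> = c * (of_nat (fact (2 * r)) * cprod r y) * d"
    using std_even[of r y] by simp
  also have "\<dots> = of_int 1 * (of_nat (fact (2 * r)) * (c * cprod r y * d))"
    by (simp only: mult.assoc mult_of_nat_left_commute[of c] of_int_1 mult_1)
  finally show ?thesis by (rule scaled_iff) auto
qed

lemma std_forms_even: "std_forms (2 * r) p \<longleftrightarrow> closed_forms r p"
proof -
  have "std (2 * r) y * y 0 ^ p \<in> J \<longleftrightarrow> y 0 ^ p * cprod r y \<in> J" for y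
    using std_even_mem_iff[of 1 r y "y 0 ^ p"] by (simp add: cprod_commute[of r y "y 0 ^ p"])
  then show ?thesis by (simp add: std_forms_def closed_forms_def)
qed

lemma std_forms_odd: "std_forms (Suc (2 * r)) p \<longleftrightarrow> contracted_forms r p"
proof -
  obtain \<sigma> where \<sigma>: "\<sigma> = 1 \<or> \<sigma> = - 1"
    and eq: "\<And>y :: nat \<Rightarrow> 'a. of_nat (2 ^ r) * std (Suc (2 * r)) y
      = of_int \<sigma> * (of_nat (fact (2 * r)) * econtr r (y 0) (y(0 := y (2 * r))))"
    using std_odd_sign by blast
  have iff: "std (Suc (2 * r)) y * y 0 ^ p \<in> J \<longleftrightarrow> econtr r (y 0) (y(0 := y (2 * r))) * y 0 ^ p \<in> J" for y
  proof (rule scaled_iff[OF _ \<sigma>])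
    show "of_nat (2 ^ r) * (std (Suc (2 * r)) y * y 0 ^ p)
      = of_int \<sigma> * (of_nat (fact (2 * r)) * (econtr r (y 0) (y(0 := y (2 * r))) * y 0 ^ p))"
      using eq[of y] by (simp only: flip: mult.assoc)
  qed auto
  have "econtr r x y * x ^ p \<in> J" if "std_forms (Suc (2 * r)) p" "x \<in> A" "args y" for x y
  proof -
    \<comment> \<open>Place 0 is reserved for x, so \<open>y 0\<close> is parked in place 2r, from
      which the formula for \<open>std\<close> fetches it back.\<close>
    let ?z = "y(2 * r := y 0, 0 := x)"
    have "econtr r x (?z(0 := ?z (2 * r))) = econtr r x y"
      by (rule econtr_cong) (auto simp: fun_upd_apply)
    moreover have "std (Suc (2 * r)) ?z * ?z 0 ^ p \<in> J"
      by (rule that(1)[unfolded std_forms_def, rule_format]) (use that in simp)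
    ultimately show ?thesis
      unfolding iff by simp
  qed
  then show ?thesis
    unfolding contracted_forms_def using iff by (auto simp: std_forms_def)
qed

text \<open>For even k the assumption is about contractions, and the substitution of a square leads
  to \<open>std_forms k (m + 2)\<close>. For odd k it is about closed forms.\<close>

theorem std_forms_consequences:
  assumes "std_forms (Suc k) m"
  shows "std_forms (Suc k) (Suc m)" "even k \<Longrightarrow> k > 0 \<Longrightarrow> std_forms k (m + 2)"
    "std_forms (k + 2) m" "m > 0 \<Longrightarrow> std_forms (k + 3) (m - 1)"
proof -
  have "std_forms (Suc k) (Suc m) \<and> (even k \<and> k > 0 \<longrightarrow> std_forms k (m + 2)) \<and>
    std_forms (k + 2) m \<and> (m > 0 \<longrightarrow> std_forms (k + 3) (m - 1))"
  proof (cases "even k")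
    case True
    then obtain r where k: "k = 2 * r" by blast
    have e: "std_forms k p \<longleftrightarrow> closed_forms r p" "std_forms (Suc k) p \<longleftrightarrow> contracted_forms r p"
      "std_forms (k + 2) p \<longleftrightarrow> closed_forms (Suc r) p" "std_forms (k + 3) p \<longleftrightarrow> contracted_forms (Suc r) p" for p
      using std_forms_even[of r p] std_forms_odd[of r p] std_forms_even[of "Suc r" p] std_forms_odd[of "Suc r" p]
      by (simp_all add: k eval_nat_numeral)
    have c: "contracted_forms r m" using assms e by simp
    \<comment> \<open>Adding a commutator yields all forms, commuting yields the closed ones, and
      Euler's formula then returns the contractions.\<close>
    have "contracted_forms (Suc r) q" if "m = Suc q" for q
      using contracted_imp_all_Suc[of r q] contracted_imp_closed_Suc[OF c] c that
      by (simp add: contracted_iff_all_forms)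
    then have "m > 0 \<longrightarrow> contracted_forms (Suc r) (m - 1)"
      by (cases m) auto
    then show ?thesis
      unfolding e using contracted_forms_degree_Suc[OF c] contracted_imp_closed[OF c] contracted_imp_closed_Suc[OF c] k by auto
  next
    case False
    then obtain r where k: "k = 2 * r + 1" by (elim oddE)
    have e: "std_forms (Suc k) p \<longleftrightarrow> closed_forms (Suc r) p" "std_forms (k + 2) p \<longleftrightarrow> contracted_forms (Suc r) p"
      "std_forms (k + 3) p \<longleftrightarrow> closed_forms (Suc (Suc r)) p" for p
      using std_forms_even[of "Suc r" p] std_forms_odd[of "Suc r" p] std_forms_even[of "Suc (Suc r)" p]
      by (simp_all add: k eval_nat_numeral)
    have c: "closed_forms (Suc r) m" using assms e by simp
    have "m > 0 \<longrightarrow> closed_forms (Suc (Suc r)) (m - 1)"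
      using closed_imp_closed_Suc[of "Suc r" "m - 1"] c by (cases m) auto
    then show ?thesis
      unfolding e using closed_forms_degree_Suc[OF c] closed_imp_contracted[OF c] False by simp
  qed
  then show "std_forms (Suc k) (Suc m)" "even k \<Longrightarrow> k > 0 \<Longrightarrow> std_forms k (m + 2)"
    "std_forms (k + 2) m" "m > 0 \<Longrightarrow> std_forms (k + 3) (m - 1)" by auto
qed

lemma std_forms_closure_odd:
  assumes "all_forms r (m + 2)" "all_forms (Suc r) m"
    and "args y" "a \<in> A" "b \<in> A"
  shows "b * (std (Suc (2 * r)) y * y 0 ^ m) \<in> J" "std (Suc (2 * r)) y * y 0 ^ m * b \<in> J"
    "i \<le> 2 * r \<Longrightarrow> std (Suc (2 * r)) (y(i := y i + a * b)) * (y(i := y i + a * b)) 0 ^ m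
      - std (Suc (2 * r)) y * y 0 ^ m \<in> J"
proof -
  obtain \<sigma> where \<sigma>: "\<sigma> = 1 \<or> \<sigma> = - 1"
    and eq: "\<And>y :: nat \<Rightarrow> 'a. of_nat (2 ^ r) * std (Suc (2 * r)) y
      = of_int \<sigma> * (of_nat (fact (2 * r)) * econtr r (y 0) (y(0 := y (2 * r))))"
    using std_odd_sign by blast
  let ?F = "\<lambda>y. std (Suc (2 * r)) y * y 0 ^ m"
  let ?G = "\<lambda>y. econtr r (y 0) (y(0 := y (2 * r))) * y 0 ^ m"
  have FG: "of_nat (2 ^ r) * ?F y = of_int \<sigma> * (of_nat (fact (2 * r)) * ?G y)" for y :: "nat \<Rightarrow> 'a"
    using eq[of y] by (simp only: flip: mult.assoc)
  have "b * ?F y \<in> J \<longleftrightarrow> b * ?G y \<in> J"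
  proof (rule scaled_iff[OF _ \<sigma>])
    show "of_nat (2 ^ r) * (b * ?F y) = of_int \<sigma> * (of_nat (fact (2 * r)) * (b * ?G y))"
      using \<sigma> FG[of y]
      by (auto simp only: mult_of_nat_left_commute[of b, symmetric] of_int_1 of_int_minus mult_1 mult_minus_left mult_minus_right)
  qed auto
  then show "b * ?F y \<in> J"
    using assms by (simp add: odd_form_mult(1))
  have "?F y * b \<in> J \<longleftrightarrow> ?G y * b \<in> J"
  proof (rule scaled_iff[OF _ \<sigma>])
    show "of_nat (2 ^ r) * (?F y * b) = of_int \<sigma> * (of_nat (fact (2 * r)) * (?G y * b))"
      using FG[of y] by (simp only: flip: mult.assoc)
  qed auto
  then show "?F y * b \<in> J"
    using assms by (simp add: odd_form_mult(2))
  assume i: "i \<le> 2 * r"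
  let ?z = "y(i := y i + a * b)"
  have "?F ?z - ?F y \<in> J \<longleftrightarrow> ?G ?z - ?G y \<in> J"
  proof (rule scaled_iff[OF _ \<sigma>])
    show "of_nat (2 ^ r) * (?F ?z - ?F y) = of_int \<sigma> * (of_nat (fact (2 * r)) * (?G ?z - ?G y))"
      using FG[of ?z] FG[of y] by (simp only: right_diff_distrib)
  qed auto
  moreover have "?G ?z - ?G y \<in> J"
  proof -
    let ?y = "y(0 := y (2 * r))"
    \<comment> \<open>In the contraction \<open>y 0\<close> is the distinguished argument and
      \<open>y (2 * r)\<close> sits in place 0; the other arguments keep their places.\<close>
    consider "i = 0" | "0 < i" "i < 2 * r" | "i = 2 * r" "r > 0"
      using i by fastforce
    then show ?thesis
    proof cases
      case 1
      then have "econtr r (?z 0) (?z(0 := ?z (2 * r))) = econtr r (y 0 + a * b) ?y"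
        by (auto intro!: econtr_cong simp: fun_upd_apply)
      then show ?thesis
        using assms 1 odd_form_perturb_first[of r m ?y "y 0" a b] by simp
    next
      case 2
      then have "econtr r (?z 0) (?z(0 := ?z (2 * r))) = econtr r (y 0) (?y(i := ?y i + a * b))"
        by (auto intro!: econtr_cong simp: fun_upd_apply)
      then show ?thesis
        using assms 2 odd_form_perturb[of r m ?y "y 0" a b i] by simp
    next
      case 3
      then have "econtr r (?z 0) (?z(0 := ?z (2 * r))) = econtr r (y 0) (?y(0 := ?y 0 + a * b))"
        by (auto intro!: econtr_cong simp: fun_upd_apply)
      then show ?thesis
        using assms 3 odd_form_perturb[of r m ?y "y 0" a b 0] by simp
    qed
  qed
  ultimately show "?F ?z - ?F y \<in> J" by simp
qed

lemma std_forms_closure_even: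
  assumes "all_forms r (Suc m)" "m > 0 \<Longrightarrow> closed_forms (Suc r) (m - 1)" "r > 0"
    and "args y" "a \<in> A" "b \<in> A"
  shows "b * (std (2 * r) y * y 0 ^ m) \<in> J" "std (2 * r) y * y 0 ^ m * b \<in> J"
    "i < 2 * r \<Longrightarrow> std (2 * r) (y(i := y i + a * b)) * (y(i := y i + a * b)) 0 ^ m
      - std (2 * r) y * y 0 ^ m \<in> J"
proof -
  let ?F = "\<lambda>y. std (2 * r) y * y 0 ^ m"
  let ?G = "\<lambda>y. y 0 ^ m * cprod r y"
  show "b * ?F y \<in> J"
    using even_form_mult(1)[OF assms(1-4,6)] std_even_mem_iff[of b r y "y 0 ^ m"]
    by (simp add: mult.assoc cprod_commute[of r y "y 0 ^ m"])
  show "?F y * b \<in> J"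
    using even_form_mult(2)[OF assms(1-4,6)] std_even_mem_iff[of 1 r y "y 0 ^ m * b"]
      cprod_commute[of r y "y 0 ^ m"] by (simp flip: mult.assoc)
  assume i: "i < 2 * r"
  let ?z = "y(i := y i + a * b)"
  have FG: "of_nat (2 ^ r) * ?F y = of_int 1 * (of_nat (fact (2 * r)) * ?G y)" for y :: "nat \<Rightarrow> 'a"
    using std_even[of r y] cprod_commute[of r y "y 0 ^ m"] by (simp add: mult.assoc flip: mult.assoc[of "2 ^ r"])
  have "?F ?z - ?F y \<in> J \<longleftrightarrow> ?G ?z - ?G y \<in> J"
  proof (rule scaled_iff)
    show "of_nat (2 ^ r) * (?F ?z - ?F y) = of_int 1 * (of_nat (fact (2 * r)) * (?G ?z - ?G y))"
      using FG[of ?z] FG[of y] by (simp only: right_diff_distrib)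
  qed auto
  moreover have "?G ?z - ?G y \<in> J"
    using even_form_perturb[OF assms, of i] even_form_perturb_first[OF assms] i
    by (cases "i = 0") simp_all
  ultimately show "?F ?z - ?F y \<in> J" by simp
qed

text \<open>Euler's formula combines neighbouring identities of the list into statements about all
  forms, which is what the two preceding lemmas ask for.\<close>

theorem std_forms_closure:
  assumes "even k \<Longrightarrow> k > 0 \<Longrightarrow> std_forms k (m + 2)" "std_forms (Suc k) (Suc m)"
    "std_forms (k + 2) m" "m > 0 \<Longrightarrow> std_forms (k + 3) (m - 1)"
    and "args y" "a \<in> A" "b \<in> A"
  shows "b * (std (Suc k) y * y 0 ^ m) \<in> J" "std (Suc k) y * y 0 ^ m * b \<in> J"
    "i \<le> k \<Longrightarrow> std (Suc k) (y(i := y i + a * b)) * (y(i := y i + a * b)) 0 ^ m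
      - std (Suc k) y * y 0 ^ m \<in> J"
proof -
  have "b * (std (Suc k) y * y 0 ^ m) \<in> J \<and> std (Suc k) y * y 0 ^ m * b \<in> J \<and>
    (i \<le> k \<longrightarrow> std (Suc k) (y(i := y i + a * b)) * (y(i := y i + a * b)) 0 ^ m
      - std (Suc k) y * y 0 ^ m \<in> J)"
  proof (cases "even k")
    case True
    then obtain r where k: "k = 2 * r" by blast
    have e: "std_forms k p \<longleftrightarrow> closed_forms r p" "std_forms (Suc k) p \<longleftrightarrow> contracted_forms r p"
      "std_forms (k + 2) p \<longleftrightarrow> closed_forms (Suc r) p" "std_forms (k + 3) p \<longleftrightarrow> contracted_forms (Suc r) p" for p
      using std_forms_even[of r p] std_forms_odd[of r p] std_forms_even[of "Suc r" p] std_forms_odd[of "Suc r" p]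
      by (simp_all add: k eval_nat_numeral)
    have c: "contracted_forms r (Suc m)" "closed_forms (Suc r) m"
      "m > 0 \<Longrightarrow> contracted_forms (Suc r) (m - 1)" "r > 0 \<Longrightarrow> closed_forms r (m + 2)"
      using assms(1-4) unfolding e by (simp_all add: k)
    \<comment> \<open>For k = 0 the first identity is missing, but the contraction with r = 0 is x
      itself, so the second one already gives the power x^(m+2).\<close>
    have "closed_forms r (Suc (Suc m))" if "r = 0"
      unfolding closed_forms_def
    proof (intro allI impI)
      fix y assume "args y"
      then have "econtr r (y 0) y * y 0 ^ Suc m \<in> J" using c(1) by (simp add: contracted_forms_def)
      then show "y 0 ^ Suc (Suc m) * cprod r y \<in> J" by (simp add: that econtr_def)
    qed
    with c(4) have "closed_forms r (Suc (Suc m))" by (cases "r = 0") simp_all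
    with c(1) have 1: "all_forms r (m + 2)"
      by (simp add: contracted_iff_all_forms)
    have 2: "all_forms (Suc r) m"
    proof (cases m)
      case 0
      \<comment> \<open>With coefficients of degree 0 closed and arbitrary forms coincide.\<close>
      with c(2) show ?thesis by (auto simp: closed_forms_def all_forms_def)
    next
      case (Suc q)
      with c(2,3) show ?thesis by (simp add: contracted_iff_all_forms)
    qed
    show ?thesis
      using std_forms_closure_odd[OF 1 2 assms(5-7)] k by blast
  next
    case False
    then obtain r where k: "k = 2 * r + 1" by (elim oddE)
    have e: "std_forms (Suc k) p \<longleftrightarrow> closed_forms (Suc r) p" "std_forms (k + 2) p \<longleftrightarrow> contracted_forms (Suc r) p"
      "std_forms (k + 3) p \<longleftrightarrow> closed_forms (Suc (Suc r)) p" for p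
      using std_forms_even[of "Suc r" p] std_forms_odd[of "Suc r" p] std_forms_even[of "Suc (Suc r)" p]
      by (simp_all add: k eval_nat_numeral)
    have c: "closed_forms (Suc r) (Suc m)" "contracted_forms (Suc r) m"
      "m > 0 \<Longrightarrow> closed_forms (Suc (Suc r)) (m - 1)"
      using assms(2-4) unfolding e by simp_all
    then have 1: "all_forms (Suc r) (Suc m)" by (simp add: contracted_iff_all_forms)
    have "i \<le> k \<longleftrightarrow> i < 2 * Suc r" "Suc k = 2 * Suc r" using k by auto
    then show ?thesis
      using std_forms_closure_even[OF 1 c(3) _ assms(5-7)] by simp
  qed
  then show "b * (std (Suc k) y * y 0 ^ m) \<in> J" "std (Suc k) y * y 0 ^ m * b \<in> J"
    "i \<le> k \<Longrightarrow> std (Suc k) (y(i := y i + a * b)) * (y(i := y i + a * b)) 0 ^ m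
      - std (Suc k) y * y 0 ^ m \<in> J" by auto
qed

end

section \<open>The free algebra\<close>

lemma ncpoly_induct [consumes 1, case_names zero single add]:
  fixes p :: "'k::field ncpoly"
  assumes "\<And>w. w \<in> Poly_Mapping.keys p \<Longrightarrow> Q w"
    and "P 0" "\<And>w c. Q w \<Longrightarrow> P (Poly_Mapping.single w c)"
    and "\<And>p q. P p \<Longrightarrow> P q \<Longrightarrow> P (p + q)"
  shows "P p"
proof -
  have "P (\<Sum>w\<in>S. Poly_Mapping.single w (Poly_Mapping.lookup p w))" if "finite S" "S \<subseteq> Poly_Mapping.keys p" for S
    using that by (induction S) (auto intro: assms)
  moreover have "p = (\<Sum>w\<in>Poly_Mapping.keys p. Poly_Mapping.single w (Poly_Mapping.lookup p w))"
    by (rule poly_mapping_eqI) (simp add: lookup_sum lookup_single when_def not_in_keys_iff_lookup_eq_zero)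
  ultimately show ?thesis using finite_keys by (metis order_refl)
qed

abbreviation scal :: "'k \<Rightarrow> 'k::field ncpoly" where
  "scal c \<equiv> Poly_Mapping.single 0 c"

abbreviation const_term :: "'k::field ncpoly \<Rightarrow> 'k" where
  "const_term p \<equiv> Poly_Mapping.lookup p 0"

definition aug :: "'k::field ncpoly set" where
  "aug = {p. const_term p = 0}"

lemma word_plus_eq_0_iff [simp]: "u + v = 0 \<longleftrightarrow> u = 0 \<and> v = (0 :: word)"
  by (cases u; cases v) (auto simp: plus_word_def zero_word_def)

lemma scal_commute: "scal c * p = p * scal c"
  by (rule ncpoly_induct[of p "\<lambda>_. True"])
    (simp_all add: mult_single distrib_left distrib_right mult.commute)

lemma scal_mult: "scal (c * d) = scal c * scal d"
  by (simp add: mult_single)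

lemma const_term_mult: "const_term (p * q) = const_term p * const_term q"
proof (rule ncpoly_induct[of p "\<lambda>_. True"])
  fix w c
  show "const_term (Poly_Mapping.single w c * q) = const_term (Poly_Mapping.single w c) * const_term q"
    by (rule ncpoly_induct[of q "\<lambda>_. True"])
      (simp_all add: mult_single lookup_single when_def distrib_left lookup_add)
qed (simp_all add: distrib_right lookup_add)

lemma const_term_minus: "const_term (p - q) = const_term p - const_term q"
  by (simp add: lookup_minus)

lemma const_term_commutator: "const_term \<langle>p, q\<rangle> = 0"
  by (simp add: commutator_def const_term_minus const_term_mult)

lemma aug_decompose: "p = scal (const_term p) + (p - scal (const_term p))" "p - scal (const_term p) \<in> aug"
  by (simp_all add: aug_def lookup_minus)

lemma aug_closed [simp]:
  "0 \<in> aug" "p \<in> aug \<Longrightarrow> q \<in> aug \<Longrightarrow> p + q \<in> aug" "p \<in> aug \<Longrightarrow> q \<in> aug \<Longrightarrow> p - q \<in> aug"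
  "p \<in> aug \<Longrightarrow> p * q \<in> aug" "p \<in> aug \<Longrightarrow> q * p \<in> aug"
  by (simp_all add: aug_def lookup_add lookup_minus const_term_mult)

lemma X_in_aug [simp]: "X i \<in> aug"
  by (simp add: aug_def X_def lookup_single when_def zero_word_def)

lemma carrier_free_alg [simp]: "carrier free_alg = aug"
  by (simp add: free_alg_def aug_def)

lemma free_alg_simps [simp]:
  "add free_alg = (+)" "zero free_alg = 0" "mult free_alg = (*)" "smult free_alg c p = scal c * p"
  by (simp_all add: free_alg_def)

lemma single_Cons: "Poly_Mapping.single (Word (i # l)) c = X i * Poly_Mapping.single (Word l) c"
  by (simp add: X_def mult_single plus_word_def)

lemma single_word: "Poly_Mapping.single w c = scal c * prod_list (map X (letters w))"
proof -
  have "Poly_Mapping.single (Word l) c = scal c * prod_list (map X l)" for l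
  proof (induction l)
    case (Cons i l)
    then show ?case by (simp add: single_Cons scal_commute mult.assoc)
  qed (simp add: zero_word_def[symmetric])
  then show ?thesis by (cases w) simp
qed

section \<open>Substitution\<close>

definition subst :: "(nat \<Rightarrow> 'k ncpoly) \<Rightarrow> 'k::field ncpoly \<Rightarrow> 'k ncpoly" where
  "subst g p = (\<Sum>w\<in>Poly_Mapping.keys p. scal (Poly_Mapping.lookup p w) * prod_list (map g (letters w)))"

lemma subst_superset:
  assumes "finite S" "Poly_Mapping.keys p \<subseteq> S"
  shows "subst g p = (\<Sum>w\<in>S. scal (Poly_Mapping.lookup p w) * prod_list (map g (letters w)))"
  unfolding subst_def
  by (rule sum.mono_neutral_left) (use assms in \<open>auto simp: not_in_keys_iff_lookup_eq_zero\<close>)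

lemma subst_0 [simp]: "subst g 0 = 0"
  by (simp add: subst_def)

lemma subst_add: "subst g (p + q) = subst g p + subst g q"
proof -
  let ?S = "Poly_Mapping.keys p \<union> Poly_Mapping.keys q"
  have "subst g (p + q) = (\<Sum>w\<in>?S. scal (Poly_Mapping.lookup (p + q) w) * prod_list (map g (letters w)))"
    by (rule subst_superset) (simp_all add: keys_add)
  also have "\<dots> = subst g p + subst g q"
    by (simp add: subst_superset[of ?S] lookup_add single_add distrib_right sum.distrib)
  finally show ?thesis .
qed

lemma subst_single: "subst g (Poly_Mapping.single w c) = scal c * prod_list (map g (letters w))"
  by (cases "c = 0") (simp_all add: subst_def)

lemma subst_mult: "subst g (p * q) = subst g p * subst g q"
proof (rule ncpoly_induct[of p "\<lambda>_. True"])
  fix w c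
  show "subst g (Poly_Mapping.single w c * q) = subst g (Poly_Mapping.single w c) * subst g q"
  proof (rule ncpoly_induct[of q "\<lambda>_. True"])
    fix v d
    let ?W = "prod_list (map g (letters w))" and ?V = "prod_list (map g (letters v))"
    have "scal c * ?W * (scal d * ?V) = scal c * (?W * scal d) * ?V"
      by (simp only: mult.assoc)
    also have "\<dots> = scal c * scal d * (?W * ?V)"
      unfolding scal_commute[of d ?W, symmetric] by (simp only: mult.assoc)
    finally have "scal c * ?W * (scal d * ?V) = scal c * scal d * (?W * ?V)" .
    then show "subst g (Poly_Mapping.single w c * Poly_Mapping.single v d)
        = subst g (Poly_Mapping.single w c) * subst g (Poly_Mapping.single v d)"
      by (simp add: mult_single subst_single plus_word_def scal_mult)
  qed (simp_all add: subst_add distrib_left)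
qed (simp_all add: subst_add distrib_right)

text \<open>Unital endomorphisms of the algebra with unit; on the augmentation ideal they are
  exactly the endomorphisms of the free algebra without unit.\<close>

locale endo =
  fixes \<phi> :: "'k::field ncpoly \<Rightarrow> 'k ncpoly"
  assumes hom_add: "\<phi> (p + q) = \<phi> p + \<phi> q"
    and hom_mult: "\<phi> (p * q) = \<phi> p * \<phi> q"
    and hom_scal: "\<phi> (scal c) = scal c"
    and hom_aug: "p \<in> aug \<Longrightarrow> \<phi> p \<in> aug"
begin

lemma hom_0 [simp]: "\<phi> 0 = 0"
  using hom_scal[of 0] by simp

lemma hom_1 [simp]: "\<phi> 1 = 1"
  using hom_scal[of 1] by simp

lemma hom_diff: "\<phi> (p - q) = \<phi> p - \<phi> q"
  using hom_add[of "p - q" q] by simp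

lemma hom_power: "\<phi> (p ^ m) = \<phi> p ^ m"
  by (induction m) (simp_all add: hom_mult)

lemma in_alg_hom: "\<phi> \<in> alg_hom free_alg free_alg"
  by (auto simp: alg_hom_def hom_add hom_mult hom_scal hom_aug)

end

lemma endo_subst:
  assumes "\<And>i. g i \<in> aug"
  shows "endo (subst g)"
proof
  show "subst g (p + q) = subst g p + subst g q" for p q by (rule subst_add)
  show "subst g (p * q) = subst g p * subst g q" for p q by (rule subst_mult)
  show "subst g (scal c) = scal c" for c by (simp add: subst_single zero_word_def)
  have l: "prod_list (map g l) \<in> aug" if "l \<noteq> []" for l
    using that by (cases l) (simp_all add: assms)
  show "subst g p \<in> aug" if "p \<in> aug" for p
  proof (rule ncpoly_induct[of p "\<lambda>w. letters w \<noteq> []"])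
    fix w assume "w \<in> Poly_Mapping.keys p"
    with that have "w \<noteq> 0" by (auto simp: aug_def in_keys_iff)
    then show "letters w \<noteq> []" by (cases w) (simp add: zero_word_def)
  qed (simp_all add: subst_add subst_single l)
qed

lemma subst_X [simp]: "subst g (X i) = g i"
  by (simp add: X_def subst_single)

text \<open>A member of \<open>alg_hom\<close> is arbitrary outside the carrier. Its restriction is
  extended by fixing constant terms, as required of a unital map.\<close>

lemma alg_hom_extend:
  assumes "\<phi> \<in> alg_hom free_alg free_alg"
  obtains \<phi>' where "endo \<phi>'" "\<And>p. p \<in> aug \<Longrightarrow> \<phi>' p = \<phi> p"
proof
  let ?r = "\<lambda>p. p - scal (const_term p)"
  let ?\<phi> = "\<lambda>p. scal (const_term p) + \<phi> (?r p)"
  have add: "\<phi> (p + q) = \<phi> p + \<phi> q" and mult: "\<phi> (p * q) = \<phi> p * \<phi> q"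
    and scal: "\<phi> (scal c * p) = scal c * \<phi> p" and aug: "\<phi> p \<in> aug"
    if "p \<in> aug" "q \<in> aug" for p q c
    using assms that by (simp_all add: alg_hom_def Pi_iff)
  have zero: "\<phi> 0 = 0" using add[of 0 0] by simp
  show "?\<phi> p = \<phi> p" if "p \<in> aug" for p
    using that by (simp add: aug_def)
  show "endo ?\<phi>"
  proof
    fix p q :: "'a ncpoly" and c
    have r: "?r p \<in> aug" "?r q \<in> aug" by (rule aug_decompose)+
    have "?r (p + q) = ?r p + ?r q"
      by (simp add: lookup_add single_add)
    then have "\<phi> (?r (p + q)) = \<phi> (?r p) + \<phi> (?r q)"
      by (simp only: add[OF r])
    then show "?\<phi> (p + q) = ?\<phi> p + ?\<phi> q"
      unfolding lookup_add by (simp add: single_add)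
    have rpq: "?r (p * q) = scal (const_term p) * ?r q + scal (const_term q) * ?r p + ?r p * ?r q"
      by (simp add: const_term_mult scal_mult algebra_simps scal_commute[of "const_term q" p]
          scal_commute[of "const_term q" "scal (const_term p)"])
    have rmult: "\<phi> (?r (p * q)) = scal (const_term p) * \<phi> (?r q) + scal (const_term q) * \<phi> (?r p) + \<phi> (?r p) * \<phi> (?r q)"
      unfolding rpq using r by (simp add: add scal mult)
    have "scal (const_term (p * q)) = scal (const_term p) * scal (const_term q)"
      unfolding const_term_mult scal_mult ..
    with rmult have "?\<phi> (p * q) = scal (const_term p) * scal (const_term q) + (scal (const_term p) * \<phi> (?r q)
        + scal (const_term q) * \<phi> (?r p) + \<phi> (?r p) * \<phi> (?r q))"
      by (rule arg_cong2[where f = "(+)", rotated])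
    also have "\<dots> = ?\<phi> p * ?\<phi> q"
      unfolding scal_commute[of "const_term q" "\<phi> (?r p)"] distrib_left distrib_right
      by (simp add: add_ac)
    finally show "?\<phi> (p * q) = ?\<phi> p * ?\<phi> q" .
    show "?\<phi> (scal c) = scal c" by (simp add: zero)
    show "?\<phi> p \<in> aug" if "p \<in> aug"
      using that aug[OF that that] by (simp add: aug_def)
  qed
qed

lemma endo_eq_subst:
  assumes "endo \<phi>"
  shows "\<phi> p = subst (\<lambda>i. \<phi> (X i)) p"
proof -
  interpret endo \<phi> by fact
  have l: "\<phi> (prod_list (map X l)) = prod_list (map (\<lambda>i. \<phi> (X i)) l)" for l
    by (induction l) (simp_all add: hom_mult)
  show ?thesis
  proof (rule ncpoly_induct[of p "\<lambda>_. True"])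
    fix w c
    have "\<phi> (Poly_Mapping.single w c) = \<phi> (scal c * prod_list (map X (letters w)))"
      by (rule arg_cong[OF single_word])
    then show "\<phi> (Poly_Mapping.single w c) = subst (\<lambda>i. \<phi> (X i)) (Poly_Mapping.single w c)"
      by (simp only: subst_single hom_mult hom_scal l)
  qed (simp_all add: subst_add hom_add)
qed

section \<open>T-ideals\<close>

text \<open>A constant acts as a scalar, so an ideal of the algebra without unit absorbs
  multiplication by the whole unital ring.\<close>

lemma T_ideal_free_alg_iff:
  "T_ideal free_alg I \<longleftrightarrow> I \<subseteq> aug \<and> 0 \<in> I \<and> (\<forall>p\<in>I. \<forall>q\<in>I. p + q \<in> I) \<and>
     (\<forall>p\<in>I. \<forall>q. p * q \<in> I \<and> q * p \<in> I) \<and> (\<forall>\<phi>. endo \<phi> \<longrightarrow> \<phi> ` I \<subseteq> I)" (is "?L \<longleftrightarrow> ?R")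
proof
  assume L: ?L
  then have alg: "alg_ideal free_alg I" and hom: "\<And>\<phi>. \<phi> \<in> alg_hom free_alg free_alg \<Longrightarrow> \<phi> ` I \<subseteq> I"
    by (simp_all add: T_ideal_def)
  note ideal = alg[unfolded alg_ideal_def carrier_free_alg free_alg_simps]
  have "p * q \<in> I" "q * p \<in> I" if "p \<in> I" for p q
  proof -
    let ?c = "scal (const_term q)" and ?r = "q - scal (const_term q)"
    have "?c * p + p * ?r \<in> I" "?c * p + ?r * p \<in> I"
      using that ideal aug_decompose(2)[of q] by blast+
    then show "p * q \<in> I" "q * p \<in> I"
      by (simp_all add: algebra_simps scal_commute[of "const_term q" p])
  qed
  moreover have "\<forall>\<phi>. endo \<phi> \<longrightarrow> \<phi> ` I \<subseteq> I"
    using hom endo.in_alg_hom by blast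
  ultimately show ?R using ideal by simp
next
  assume R: ?R
  have "\<phi> ` I \<subseteq> I" if \<phi>: "\<phi> \<in> alg_hom free_alg free_alg" for \<phi>
  proof -
    obtain \<phi>' where "endo \<phi>'" "\<And>p. p \<in> aug \<Longrightarrow> \<phi>' p = \<phi> p"
      using alg_hom_extend[OF \<phi>] by blast
    moreover have "p \<in> aug" if "p \<in> I" for p using R that by blast
    ultimately show ?thesis using R by (metis image_cong)
  qed
  with R show ?L unfolding T_ideal_def alg_ideal_def carrier_free_alg free_alg_simps by simp
qed

lemma T_idealI:
  assumes "I \<subseteq> aug" "0 \<in> I" "\<And>p q. p \<in> I \<Longrightarrow> q \<in> I \<Longrightarrow> p + q \<in> I"
    "\<And>p q. p \<in> I \<Longrightarrow> p * q \<in> I" "\<And>p q. p \<in> I \<Longrightarrow> q * p \<in> I"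
    "\<And>\<phi> p. endo \<phi> \<Longrightarrow> p \<in> I \<Longrightarrow> \<phi> p \<in> I"
  shows "T_ideal free_alg I"
  using assms by (auto simp: T_ideal_free_alg_iff)

lemma
  assumes "T_ideal free_alg I"
  shows T_ideal_aug: "p \<in> I \<Longrightarrow> p \<in> aug" and T_ideal_0: "0 \<in> I"
    and T_ideal_add: "p \<in> I \<Longrightarrow> q \<in> I \<Longrightarrow> p + q \<in> I"
    and T_ideal_mult_right: "p \<in> I \<Longrightarrow> p * q \<in> I" and T_ideal_mult_left: "p \<in> I \<Longrightarrow> q * p \<in> I"
    and T_ideal_endo: "endo \<phi> \<Longrightarrow> p \<in> I \<Longrightarrow> \<phi> p \<in> I"
  using assms unfolding T_ideal_free_alg_iff image_subset_iff by blast+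

lemma T_ideal_diff: "T_ideal free_alg I \<Longrightarrow> p \<in> I \<Longrightarrow> q \<in> I \<Longrightarrow> p - q \<in> I"
  using T_ideal_add[of I p "- 1 * q"] T_ideal_mult_left[of I q "- 1"] by simp

lemma T_ideal_saturated_ideal:
  fixes I :: "'k::field_char_0 ncpoly set"
  assumes "T_ideal free_alg I"
  shows "saturated_ideal I"
proof
  fix n and a :: "'k ncpoly" assume "of_nat n * a \<in> I" "n > 0"
  then have "scal (1 / of_nat n) * (of_nat n * a) \<in> I"
    using T_ideal_mult_left[OF assms] by blast
  also have "scal (1 / of_nat n) * (of_nat n * a) = a"
  proof -
    have "scal (1 / of_nat n) * (of_nat n * a) = scal (1 / of_nat n) * scal (of_nat n) * a"
      by (simp add: mult.assoc)
    also have "\<dots> = a" using \<open>n > 0\<close> unfolding scal_mult[symmetric] by simp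
    finally show ?thesis .
  qed
  finally show "a \<in> I" .
qed (use assms T_ideal_0 T_ideal_add T_ideal_mult_left T_ideal_mult_right in blast)+

lemma T_ideal_aug_self: "T_ideal free_alg aug"
  by (rule T_idealI) (auto simp: endo.hom_aug)

lemma T_ideal_gen_props:
  assumes "G \<subseteq> aug"
  shows "T_ideal free_alg (T_ideal_gen free_alg G)" "G \<subseteq> T_ideal_gen free_alg G"
    "\<And>J. T_ideal free_alg J \<Longrightarrow> G \<subseteq> J \<Longrightarrow> T_ideal_gen free_alg G \<subseteq> J"
proof -
  show "T_ideal free_alg (T_ideal_gen free_alg G)"
    unfolding T_ideal_gen_def
  proof (rule T_idealI, goal_cases)
    case 1
    then show ?case using T_ideal_aug_self assms by blast
  qed (auto intro: T_ideal_0 T_ideal_add T_ideal_mult_left T_ideal_mult_right T_ideal_endo)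
qed (auto simp: T_ideal_gen_def)

section \<open>Homogeneous components\<close>

lemma lookup_homog_part:
  "Poly_Mapping.lookup (homog_part d p) w = (if length (letters w) = d then Poly_Mapping.lookup p w else 0)"
  by (auto simp: homog_part_def lookup_sum lookup_single when_def not_in_keys_iff_lookup_eq_zero
      sum.delta if_distrib cong: if_cong)

lemma homog_part_add: "homog_part d (p + q) = homog_part d p + homog_part d q"
  by (rule poly_mapping_eqI) (simp add: lookup_homog_part lookup_add)

lemma homog_part_diff: "homog_part d (p - q) = homog_part d p - homog_part d q"
  by (rule poly_mapping_eqI) (simp add: lookup_homog_part lookup_minus)

lemma homog_part_0 [simp]: "homog_part d 0 = 0"
  by (rule poly_mapping_eqI) (simp add: lookup_homog_part)

lemma homog_part_single:
  "homog_part d (Poly_Mapping.single w c) = (if length (letters w) = d then Poly_Mapping.single w c else 0)"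
  by (rule poly_mapping_eqI) (auto simp: lookup_homog_part lookup_single when_def)

lemma homog_part_homog_part: "homog_part d (homog_part e p) = (if d = e then homog_part d p else 0)"
  by (rule poly_mapping_eqI) (auto simp: lookup_homog_part)

lemma subst_scale_expansion:
  "\<exists>N0. \<forall>N\<ge>N0. \<forall>t. subst (\<lambda>i. of_nat t * X i) p = (\<Sum>d\<le>N. of_nat (t ^ d) * homog_part d p)"
proof (rule ncpoly_induct[of p "\<lambda>_. True"])
  fix w :: word and c :: 'a
  have l: "prod_list (map (\<lambda>i. of_nat t * X i) l) = of_nat (t ^ length l) * prod_list (map X l)" for t l
    by (induction l) (simp_all add: of_nat_mult_mult del: of_nat_power)
  show "\<exists>N0. \<forall>N\<ge>N0. \<forall>t. subst (\<lambda>i. of_nat t * X i) (Poly_Mapping.single w c)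
      = (\<Sum>d\<le>N. of_nat (t ^ d) * homog_part d (Poly_Mapping.single w c))"
  proof (intro exI[of _ "length (letters w)"] allI impI)
    fix N t assume N: "length (letters w) \<le> N"
    have "(\<Sum>d\<le>N. of_nat (t ^ d) * homog_part d (Poly_Mapping.single w c))
        = (\<Sum>d\<le>N. if length (letters w) = d then of_nat (t ^ d) * Poly_Mapping.single w c else 0)"
      by (intro sum.cong) (auto simp: homog_part_single)
    also have "\<dots> = of_nat (t ^ length (letters w)) * Poly_Mapping.single w c"
      using N by simp
    finally show "subst (\<lambda>i. of_nat t * X i) (Poly_Mapping.single w c)
      = (\<Sum>d\<le>N. of_nat (t ^ d) * homog_part d (Poly_Mapping.single w c))"
      unfolding subst_single l mult_of_nat_left_commute by (simp only: single_word[of w c])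
  qed
next
  fix p q :: "'a ncpoly"
  assume "\<exists>N0. \<forall>N\<ge>N0. \<forall>t. subst (\<lambda>i. of_nat t * X i) p = (\<Sum>d\<le>N. of_nat (t ^ d) * homog_part d p)"
    "\<exists>N0. \<forall>N\<ge>N0. \<forall>t. subst (\<lambda>i. of_nat t * X i) q = (\<Sum>d\<le>N. of_nat (t ^ d) * homog_part d q)"
  then obtain M N where
    "\<forall>n\<ge>M. \<forall>t. subst (\<lambda>i. of_nat t * X i) p = (\<Sum>d\<le>n. of_nat (t ^ d) * homog_part d p)"
    "\<forall>n\<ge>N. \<forall>t. subst (\<lambda>i. of_nat t * X i) q = (\<Sum>d\<le>n. of_nat (t ^ d) * homog_part d q)"
    by blast
  then have "subst (\<lambda>i. of_nat t * X i) (p + q) = (\<Sum>d\<le>n. of_nat (t ^ d) * homog_part d (p + q))"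
    if "max M N \<le> n" for n t
    using that by (auto simp: subst_add homog_part_add distrib_left sum.distrib)
  then show "\<exists>N0. \<forall>N\<ge>N0. \<forall>t. subst (\<lambda>i. of_nat t * X i) (p + q) = (\<Sum>d\<le>N. of_nat (t ^ d) * homog_part d (p + q))"
    by (intro exI[of _ "max M N"]) blast
qed simp_all

text \<open>Replacing every generator by t times itself multiplies the component of degree d by t^d,
  and \<open>vandermonde\<close> separates the components.\<close>

lemma T_ideal_homogeneous:
  fixes I :: "'k::field_char_0 ncpoly set"
  assumes "T_ideal free_alg I" "p \<in> I"
  shows "homog_part d p \<in> I"
proof -
  interpret saturated_ideal I by (rule T_ideal_saturated_ideal) fact
  obtain N0 where N0: "\<forall>N\<ge>N0. \<forall>t. subst (\<lambda>i. of_nat t * X i) p = (\<Sum>d\<le>N. of_nat (t ^ d) * homog_part d p)"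
    using subst_scale_expansion[of p] by blast
  have s: "subst (\<lambda>i. of_nat t * X i) p \<in> I" for t
    by (rule T_ideal_endo[OF assms(1) endo_subst assms(2)]) simp
  have "(\<Sum>d\<le>max N0 d. of_nat (t ^ d) * homog_part d p) \<in> I" for t
    using s[of t] N0[rule_format, of "max N0 d" t] by simp
  from vandermonde[where n = "max N0 d" and c = "\<lambda>d. homog_part d p", OF this] show ?thesis
    by simp
qed

section \<open>Filtration by order\<close>

definition order_ge :: "nat \<Rightarrow> 'k::field ncpoly set" where
  "order_ge n = {p. \<forall>w\<in>Poly_Mapping.keys p. n \<le> length (letters w)}"

lemma order_ge_add: "p \<in> order_ge n \<Longrightarrow> q \<in> order_ge n \<Longrightarrow> p + q \<in> order_ge n"
  using keys_add[of p q] by (auto simp: order_ge_def)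

lemma order_ge_mult: "p \<in> order_ge m \<Longrightarrow> q \<in> order_ge n \<Longrightarrow> p * q \<in> order_ge (m + n)"
  using keys_mult[of p q] by (fastforce simp: order_ge_def plus_word_def)

lemma order_ge_0 [simp]: "p \<in> order_ge 0" "0 \<in> order_ge n"
  by (simp_all add: order_ge_def)

lemma order_ge_mono: "p \<in> order_ge m \<Longrightarrow> n \<le> m \<Longrightarrow> p \<in> order_ge n"
  using le_trans unfolding order_ge_def by blast

lemma order_ge_mult_left: "p \<in> order_ge n \<Longrightarrow> q * p \<in> order_ge n"
  using order_ge_mult[of q 0 p n] by simp

lemma order_ge_mult_right: "p \<in> order_ge n \<Longrightarrow> p * q \<in> order_ge n"
  using order_ge_mult[of p n q 0] by simp

lemma aug_eq_order_ge: "aug = order_ge 1"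
proof -
  have "1 \<le> length (letters w) \<longleftrightarrow> w \<noteq> 0" for w by (cases w) (auto simp: zero_word_def Suc_le_eq)
  then show ?thesis by (auto simp: aug_def order_ge_def in_keys_iff)
qed

lemma order_ge_prod_list: "(\<And>i. g i \<in> aug) \<Longrightarrow> prod_list (map g l) \<in> order_ge (length l)"
proof (induction l)
  case (Cons i l)
  then have "g i * prod_list (map g l) \<in> order_ge (1 + length l)"
    by (intro order_ge_mult) (simp_all add: aug_eq_order_ge)
  then show ?case by simp
qed simp

lemma order_ge_power: "p \<in> aug \<Longrightarrow> p ^ m \<in> order_ge m"
  using order_ge_prod_list[of "\<lambda>_. p" "replicate m 0"] by (simp add: map_replicate_const prod_list_replicate)

lemma order_ge_endo:
  assumes "endo \<phi>" "p \<in> order_ge n"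
  shows "\<phi> p \<in> order_ge n"
proof (subst endo_eq_subst[OF assms(1)], rule ncpoly_induct[of p "\<lambda>w. n \<le> length (letters w)"])
  fix w and c :: 'a assume n: "n \<le> length (letters w)"
  have "prod_list (map (\<lambda>i. \<phi> (X i)) (letters w)) \<in> order_ge (length (letters w))"
    by (rule order_ge_prod_list) (simp add: endo.hom_aug[OF assms(1)])
  then have "prod_list (map (\<lambda>i. \<phi> (X i)) (letters w)) \<in> order_ge n"
    using n by (rule order_ge_mono)
  then show "subst (\<lambda>i. \<phi> (X i)) (Poly_Mapping.single w c) \<in> order_ge n"
    unfolding subst_single by (rule order_ge_mult_left)
qed (use assms(2) in \<open>simp_all add: subst_add order_ge_add\<close>, simp add: order_ge_def)

lemma homog_part_order_ge: "p \<in> order_ge n \<Longrightarrow> d < n \<Longrightarrow> homog_part d p = 0"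
  by (rule poly_mapping_eqI)
    (auto simp: lookup_homog_part order_ge_def not_le simp flip: not_in_keys_iff_lookup_eq_zero)

lemma order_ge_truncate: "p - (\<Sum>d\<le>n. homog_part d p) \<in> order_ge (Suc n)"
  by (auto simp: order_ge_def in_keys_iff lookup_minus lookup_sum lookup_homog_part sum.delta not_less_eq_eq
      split: if_splits)

text \<open>An endomorphism mixes degrees, so the components of \<phi> p are not directly
  accessible. The set is therefore rewritten as \<open>I\<close> plus the polynomials of order above
  n, and both parts are stable under endomorphisms.\<close>

lemma T_ideal_low_degree:
  fixes I :: "'k::field_char_0 ncpoly set"
  assumes I: "T_ideal free_alg I"
  shows "T_ideal free_alg {p \<in> aug. \<forall>d\<le>n. homog_part d p \<in> I}"
proof -
  let ?H = "{p \<in> aug. \<forall>d\<le>n. homog_part d p \<in> I}"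
  interpret saturated_ideal I by (rule T_ideal_saturated_ideal) fact
  have H: "p \<in> ?H \<longleftrightarrow> p \<in> aug \<and> (\<exists>i\<in>I. p - i \<in> order_ge (Suc n))" for p
  proof (intro iffI)
    assume "p \<in> ?H"
    then have "(\<Sum>d\<le>n. homog_part d p) \<in> I" by (intro sum) simp
    then show "p \<in> aug \<and> (\<exists>i\<in>I. p - i \<in> order_ge (Suc n))"
      using order_ge_truncate \<open>p \<in> ?H\<close> by blast
  next
    assume "p \<in> aug \<and> (\<exists>i\<in>I. p - i \<in> order_ge (Suc n))"
    then obtain i where i: "i \<in> I" "p - i \<in> order_ge (Suc n)" "p \<in> aug" by blast
    have "homog_part d p = homog_part d i" if "d \<le> n" for d
      using homog_part_order_ge[OF i(2), of d] that by (simp add: homog_part_diff)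
    with i T_ideal_homogeneous[OF I] show "p \<in> ?H" by simp
  qed
  show ?thesis
  proof (rule T_idealI)
    fix p q assume "p \<in> ?H"
    then obtain i where i: "i \<in> I" "p - i \<in> order_ge (Suc n)" "p \<in> aug" using H by blast
    have "p * q - i * q \<in> order_ge (Suc n)" "q * p - q * i \<in> order_ge (Suc n)"
      using order_ge_mult_left[OF i(2), of q] order_ge_mult_right[OF i(2), of q]
      by (simp_all add: algebra_simps)
    with i show "p * q \<in> ?H" "q * p \<in> ?H"
      unfolding H by auto
  next
    fix \<phi> :: "'k ncpoly \<Rightarrow> 'k ncpoly" and p assume \<phi>: "endo \<phi>" and "p \<in> ?H"
    then obtain i where i: "i \<in> I" "p - i \<in> order_ge (Suc n)" "p \<in> aug" using H by blast
    have "\<phi> p - \<phi> i \<in> order_ge (Suc n)"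
      using order_ge_endo[OF \<phi> i(2)] by (simp add: endo.hom_diff[OF \<phi>])
    with i show "\<phi> p \<in> ?H"
      unfolding H using endo.hom_aug[OF \<phi>] T_ideal_endo[OF I \<phi>] by blast
  qed (auto simp: homog_part_add)
qed

lemma alg_homI:
  assumes "\<And>a. a \<in> carrier B \<Longrightarrow> \<phi> a \<in> carrier C"
    "\<And>a b. a \<in> carrier B \<Longrightarrow> b \<in> carrier B \<Longrightarrow> \<phi> (add B a b) = add C (\<phi> a) (\<phi> b)"
    "\<And>a b. a \<in> carrier B \<Longrightarrow> b \<in> carrier B \<Longrightarrow> \<phi> (mult B a b) = mult C (\<phi> a) (\<phi> b)"
    "\<And>c a. a \<in> carrier B \<Longrightarrow> \<phi> (smult B c a) = smult C c (\<phi> a)"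
  shows "\<phi> \<in> alg_hom B C"
  using assms by (simp add: alg_hom_def)

lemma
  assumes "\<phi> \<in> alg_hom B C"
  shows alg_hom_closed: "a \<in> carrier B \<Longrightarrow> \<phi> a \<in> carrier C"
    and alg_hom_add: "a \<in> carrier B \<Longrightarrow> b \<in> carrier B \<Longrightarrow> \<phi> (add B a b) = add C (\<phi> a) (\<phi> b)"
    and alg_hom_mult: "a \<in> carrier B \<Longrightarrow> b \<in> carrier B \<Longrightarrow> \<phi> (mult B a b) = mult C (\<phi> a) (\<phi> b)"
    and alg_hom_smult: "a \<in> carrier B \<Longrightarrow> \<phi> (smult B c a) = smult C c (\<phi> a)"
  using assms by (auto simp: alg_hom_def)

section \<open>T-ideals of the relatively free algebra\<close>

locale quotient_by =
  fixes I :: "'k::field ncpoly set"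
  assumes I: "T_ideal free_alg I"
begin

abbreviation p :: "'k ncpoly \<Rightarrow> 'k ncpoly set" where
  "p \<equiv> coset free_alg I"

abbreviation Q :: "('k, 'k ncpoly set) alg" where
  "Q \<equiv> quot free_alg I"

lemma p_eq_iff: "p a = p b \<longleftrightarrow> a - b \<in> I"
proof
  assume "p a = p b"
  moreover have "a + 0 \<in> p a" unfolding coset_def using T_ideal_0[OF I] by (intro image_eqI[of _ _ 0]) simp_all
  ultimately show "a - b \<in> I" by (auto simp: coset_def)
next
  assume ab: "a - b \<in> I"
  have "a + i = b + (a - b + i)" "b + i = a + (i - (a - b))" for i by simp_all
  then show "p a = p b"
    using T_ideal_add[OF I ab] T_ideal_diff[OF I _ ab] unfolding coset_def free_alg_simps by fast
qed

lemma mem_p_iff: "a \<in> p b \<longleftrightarrow> a - b \<in> I"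
proof
  assume "a - b \<in> I"
  then show "a \<in> p b" unfolding coset_def by (intro image_eqI[of _ _ "a - b"]) simp_all
qed (auto simp: coset_def)

lemma self_mem_p: "a \<in> p a"
  by (simp add: mem_p_iff T_ideal_0[OF I])

lemma Q_carrier: "carrier Q = p ` aug"
  by (simp add: quot_def)

lemma Q_zero: "zero Q = p 0"
  by (simp add: quot_def)

text \<open>The operations of \<open>quot\<close> are unions over representatives. They collapse to
  a single coset because all choices give the same one.\<close>

lemma Q_add: "add Q (p a) (p b) = p (a + b)"
proof -
  have "p (a' + b') = p (a + b)" if "a' \<in> p a" "b' \<in> p b" for a' b'
    using T_ideal_add[OF I that[unfolded mem_p_iff]] by (simp add: p_eq_iff algebra_simps)
  then have "(\<Union>a'\<in>p a. \<Union>b'\<in>p b. p (a' + b')) = p (a + b)"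
    by (intro UN_constant_eq[OF self_mem_p] ballI)
  then show ?thesis by (simp add: quot_def)
qed

lemma Q_mult: "mult Q (p a) (p b) = p (a * b)"
proof -
  have "p (a' * b') = p (a * b)" if "a' \<in> p a" "b' \<in> p b" for a' b'
  proof -
    have "(a' - a) * b' + a * (b' - b) \<in> I"
      using that[unfolded mem_p_iff] I by (intro T_ideal_add[OF I] T_ideal_mult_left[OF I] T_ideal_mult_right[OF I])
    then show ?thesis by (simp add: p_eq_iff algebra_simps)
  qed
  then have "(\<Union>a'\<in>p a. \<Union>b'\<in>p b. p (a' * b')) = p (a * b)"
    by (intro UN_constant_eq[OF self_mem_p] ballI)
  then show ?thesis by (simp add: quot_def)
qed

lemma Q_smult: "smult Q c (p a) = p (scal c * a)"
proof -
  have "p (scal c * a') = p (scal c * a)" if "a' \<in> p a" for a'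
    using T_ideal_mult_left[OF I that[unfolded mem_p_iff], of "scal c"] by (simp add: p_eq_iff algebra_simps)
  then have "(\<Union>a'\<in>p a. p (scal c * a')) = p (scal c * a)"
    by (intro UN_constant_eq[OF self_mem_p] ballI)
  then show ?thesis by (simp add: quot_def)
qed

text \<open>The first letter is kept apart because the carrier contains no coset of the empty word,
  on which a homomorphism could be evaluated.\<close>

lemma aug_induct [consumes 1, case_names zero word add]:
  assumes "a \<in> aug" "P 0" "\<And>i l c. P (scal c * (X i * prod_list (map X l)))"
    "\<And>a b. a \<in> aug \<Longrightarrow> b \<in> aug \<Longrightarrow> P a \<Longrightarrow> P b \<Longrightarrow> P (a + b)"
  shows "P (a :: 'k ncpoly)"
proof -
  have "P a \<and> a \<in> aug"
  proof (rule ncpoly_induct[of a "\<lambda>w. letters w \<noteq> []"])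
    fix w assume "w \<in> Poly_Mapping.keys a"
    with assms(1) have "w \<noteq> 0" by (auto simp: aug_def in_keys_iff)
    then show "letters w \<noteq> []" by (cases w) (simp add: zero_word_def)
  next
    fix w and c :: 'k assume "letters w \<noteq> []"
    then obtain i l where "letters w = i # l" by (cases "letters w") auto
    then have "Poly_Mapping.single w c = scal c * (X i * prod_list (map X l))"
      using single_word[of w c] by simp
    then show "P (Poly_Mapping.single w c) \<and> Poly_Mapping.single w c \<in> aug"
      using assms(3) by simp
  qed (use assms(2,4) in auto)
  then show ?thesis ..
qed

text \<open>Freeness: choose preimages of the images of the generators and substitute them.\<close>

lemma lift_endomorphism:
  assumes \<psi>: "\<psi> \<in> alg_hom Q Q"
  obtains \<phi> where "endo \<phi>" "\<And>a. a \<in> aug \<Longrightarrow> \<psi> (p a) = p (\<phi> a)"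
proof -
  have "\<exists>g. g \<in> aug \<and> \<psi> (p (X i)) = p g" for i
    using alg_hom_closed[OF \<psi>, of "p (X i)"] by (auto simp: Q_carrier)
  then obtain g where g: "\<And>i. g i \<in> aug" "\<And>i. \<psi> (p (X i)) = p (g i)" by metis
  interpret endo "subst g" by (rule endo_subst) (rule g)
  have psi_add: "\<psi> (p (a + b)) = add Q (\<psi> (p a)) (\<psi> (p b))"
    and mult: "\<psi> (p (a * b)) = mult Q (\<psi> (p a)) (\<psi> (p b))"
    and smult: "\<psi> (p (scal c * a)) = smult Q c (\<psi> (p a))" if "a \<in> aug" "b \<in> aug" for a b c
    using that alg_hom_add[OF \<psi>, of "p a" "p b"] alg_hom_mult[OF \<psi>, of "p a" "p b"]
      alg_hom_smult[OF \<psi>, of "p a" c]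
    by (simp_all add: Q_carrier Q_add Q_mult Q_smult)
  have word: "\<psi> (p (X i * prod_list (map X l))) = p (subst g (X i * prod_list (map X l)))" for i l
  proof (induction l arbitrary: i)
    case (Cons j l)
    have "\<psi> (p (X i * (X j * prod_list (map X l)))) = mult Q (p (g i)) (p (subst g (X j * prod_list (map X l))))"
      by (simp add: mult Cons.IH g)
    then show ?case by (simp add: Q_mult hom_mult)
  qed (simp add: g)
  have "\<psi> (p a) = p (subst g a)" if "a \<in> aug" for a
    using that
  proof (induction rule: aug_induct)
    case zero
    have "\<psi> (p 0) = \<psi> (p (scal 0 * 0))" by simp
    also have "\<dots> = smult Q 0 (\<psi> (p 0))" using smult[of 0 0 0] by simp
    also have "\<dots> = p 0"
    proof -
      obtain b where "\<psi> (p 0) = p b"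
        using alg_hom_closed[OF \<psi>, of "p 0"] by (auto simp: Q_carrier)
      then show ?thesis by (simp add: Q_smult)
    qed
    finally show ?case by simp
  next
    case (word i l c)
    have "\<psi> (p (scal c * (X i * prod_list (map X l)))) = smult Q c (\<psi> (p (X i * prod_list (map X l))))"
      by (rule smult[of _ 0]) simp_all
    then show ?case
      by (simp only: \<open>\<psi> (p (X i * prod_list (map X l))) = _\<close> Q_smult hom_mult[of "scal c"] hom_scal)
  next
    case (add a b)
    then show ?case by (simp add: psi_add Q_add hom_add)
  qed
  with that[of "subst g"] endo_axioms show ?thesis by blast
qed

lemma endomorphism_descends:
  assumes "endo \<phi>"
  obtains \<psi> where "\<psi> \<in> alg_hom Q Q" "\<And>a. \<psi> (p a) = p (\<phi> a)"
proof -
  interpret endo \<phi> by fact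
  define \<psi> where "\<psi> U = (\<Union>a\<in>U. p (\<phi> a))" for U
  have eq: "\<psi> (p a) = p (\<phi> a)" for a
  proof -
    have "p (\<phi> a') = p (\<phi> a)" if "a' \<in> p a" for a'
      using T_ideal_endo[OF I assms that[unfolded mem_p_iff]] by (simp add: p_eq_iff hom_diff)
    then show ?thesis unfolding \<psi>_def by (intro UN_constant_eq[OF self_mem_p] ballI)
  qed
  have "\<psi> \<in> alg_hom Q Q"
    by (rule alg_homI) (auto simp: Q_carrier eq Q_add Q_mult Q_smult hom_add hom_mult hom_scal hom_aug)
  with eq that show ?thesis by blast
qed

lemma T_ideal_image:
  assumes J: "T_ideal free_alg J"
  shows "T_ideal Q (p ` J)"
  unfolding T_ideal_def alg_ideal_def
proof (intro conjI ballI allI)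
  show "p ` J \<subseteq> carrier Q" using T_ideal_aug[OF J] by (auto simp: Q_carrier)
  show "zero Q \<in> p ` J" using T_ideal_0[OF J] by (simp add: Q_zero)
next
  fix U V assume "U \<in> p ` J" "V \<in> p ` J"
  then show "add Q U V \<in> p ` J" using T_ideal_add[OF J] by (auto simp: Q_add)
next
  fix U c assume "U \<in> p ` J"
  then show "smult Q c U \<in> p ` J" using T_ideal_mult_left[OF J] by (auto simp: Q_smult)
next
  fix U V assume "U \<in> p ` J" "V \<in> carrier Q"
  then show "mult Q U V \<in> p ` J" "mult Q V U \<in> p ` J"
    using T_ideal_mult_left[OF J] T_ideal_mult_right[OF J] by (auto simp: Q_mult Q_carrier)
next
  fix \<psi> assume "\<psi> \<in> alg_hom Q Q"
  then obtain \<phi> where "endo \<phi>" and eq: "\<And>a. a \<in> aug \<Longrightarrow> \<psi> (p a) = p (\<phi> a)"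
    using lift_endomorphism by blast
  show "\<psi> ` p ` J \<subseteq> p ` J"
  proof clarify
    fix a assume "a \<in> J"
    then show "\<psi> (p a) \<in> p ` J"
      using eq[OF T_ideal_aug[OF J]] T_ideal_endo[OF J \<open>endo \<phi>\<close>] by simp
  qed
qed

lemma T_ideal_preimage:
  assumes K: "T_ideal Q K"
  shows "T_ideal free_alg {a \<in> aug. p a \<in> K}"
proof -
  have ideal: "alg_ideal Q K" and hom: "\<And>\<psi>. \<psi> \<in> alg_hom Q Q \<Longrightarrow> \<psi> ` K \<subseteq> K"
    using K by (simp_all add: T_ideal_def)
  note ideal = ideal[unfolded alg_ideal_def Q_carrier]
  show ?thesis
    unfolding T_ideal_def
  proof (intro conjI ballI)
    show "alg_ideal free_alg {a \<in> aug. p a \<in> K}"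
      unfolding alg_ideal_def
    proof (intro conjI ballI allI)
      show "zero free_alg \<in> {a \<in> aug. p a \<in> K}"
        using ideal by (simp add: Q_zero)
    next
      fix a b assume ab: "a \<in> {a \<in> aug. p a \<in> K}" "b \<in> {a \<in> aug. p a \<in> K}"
      then have "add Q (p a) (p b) \<in> K" using ideal by blast
      then show "add free_alg a b \<in> {a \<in> aug. p a \<in> K}"
        using ab by (simp add: Q_add)
    next
      fix a c assume a: "a \<in> {a \<in> aug. p a \<in> K}"
      then have "smult Q c (p a) \<in> K" using ideal by blast
      then show "smult free_alg c a \<in> {a \<in> aug. p a \<in> K}"
        using a by (simp add: Q_smult)
    next
      fix a b :: "'k ncpoly" assume a: "a \<in> {a \<in> aug. p a \<in> K}" and "b \<in> carrier free_alg"
      then have "p b \<in> p ` aug" by simp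
      then have "mult Q (p a) (p b) \<in> K" "mult Q (p b) (p a) \<in> K"
        using a ideal by blast+
      then show "mult free_alg a b \<in> {a \<in> aug. p a \<in> K}" "mult free_alg b a \<in> {a \<in> aug. p a \<in> K}"
        using a by (simp_all add: Q_mult)
    qed simp
  next
    fix \<phi> :: "'k ncpoly \<Rightarrow> 'k ncpoly" assume "\<phi> \<in> alg_hom free_alg free_alg"
    then obtain \<phi>' where \<phi>': "endo \<phi>'" "\<And>a. a \<in> aug \<Longrightarrow> \<phi>' a = \<phi> a" using alg_hom_extend by blast
    obtain \<psi> where "\<psi> \<in> alg_hom Q Q" "\<And>a. \<psi> (p a) = p (\<phi>' a)" using endomorphism_descends[OF \<phi>'(1)] by blast
    then have "p (\<phi>' a) \<in> K" if "p a \<in> K" for a using hom that by (metis image_subset_iff)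
    then show "\<phi> ` {a \<in> aug. p a \<in> K} \<subseteq> {a \<in> aug. p a \<in> K}"
      using \<phi>'(2) endo.hom_aug[OF \<phi>'(1)] by (auto simp flip: \<phi>'(2))
  qed
qed

text \<open>T-ideals of the quotient correspond to T-ideals of the free algebra above
  \<open>I\<close>, since endomorphisms lift in one direction and descend in the other.\<close>

lemma T_ideal_gen_quot:
  assumes "G \<subseteq> aug"
  shows "T_ideal_gen Q (p ` G) = p ` T_ideal_gen free_alg (G \<union> I)"
proof
  let ?J = "T_ideal_gen free_alg (G \<union> I)"
  have GI: "G \<union> I \<subseteq> aug" using assms T_ideal_aug[OF I] by blast
  show "T_ideal_gen Q (p ` G) \<subseteq> p ` ?J"
    unfolding T_ideal_gen_def[of Q]
  proof (intro Inter_lower CollectI conjI)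
    show "T_ideal Q (p ` ?J)" by (rule T_ideal_image) (rule T_ideal_gen_props(1)[OF GI])
    show "p ` G \<subseteq> p ` ?J" using T_ideal_gen_props(2)[OF GI] by blast
  qed
  show "p ` ?J \<subseteq> T_ideal_gen Q (p ` G)"
    unfolding T_ideal_gen_def[of Q]
  proof (intro Inter_greatest)
    fix K assume "K \<in> {K. T_ideal Q K \<and> p ` G \<subseteq> K}"
    then have K: "T_ideal Q K" "p ` G \<subseteq> K" by auto
    have "p i \<in> K" if "i \<in> I" for i
    proof -
      have "p i = zero Q" using that by (simp add: Q_zero p_eq_iff)
      then show ?thesis using K(1) by (simp add: T_ideal_def alg_ideal_def)
    qed
    then have "G \<union> I \<subseteq> {a \<in> aug. p a \<in> K}" using K(2) GI by blast
    then have "?J \<subseteq> {a \<in> aug. p a \<in> K}"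
      by (rule T_ideal_gen_props(3)[OF GI T_ideal_preimage[OF K(1)]])
    then show "p ` ?J \<subseteq> K" by blast
  qed
qed

end

section \<open>The quotient by all triple commutators\<close>

text \<open>A type cannot depend on the T-ideal under study, so only the ideal common to all of them
  is divided out as a type; the T-ideal then enters as an ideal of the quotient. Scalars and signs
  are absorbed by u and v.\<close>

inductive_set comm_ideal :: "'k::field ncpoly set" where
  comm_ideal_0: "0 \<in> comm_ideal"
| comm_ideal_step: "p \<in> comm_ideal \<Longrightarrow> p + u * \<langle>\<langle>a, b\<rangle>, c\<rangle> * v \<in> comm_ideal"

lemma comm_ideal_gen: "\<langle>\<langle>a, b\<rangle>, c\<rangle> \<in> comm_ideal"
  using comm_ideal_step[OF comm_ideal_0, of 1 a b c 1] by simp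

lemma comm_ideal_add:
  assumes "p \<in> comm_ideal" "q \<in> comm_ideal"
  shows "p + q \<in> comm_ideal"
  using assms(2,1)
proof (induction rule: comm_ideal.induct)
  case (comm_ideal_step q u a b c v)
  then show ?case
    using comm_ideal.comm_ideal_step[of "p + q" u a b c v] by (simp add: add.assoc)
qed simp

lemma comm_ideal_mult_left: "p \<in> comm_ideal \<Longrightarrow> q * p \<in> comm_ideal"
proof (induction rule: comm_ideal.induct)
  case (comm_ideal_step p u a b c v)
  then show ?case
    using comm_ideal.comm_ideal_step[of "q * p" "q * u" a b c v] by (simp add: distrib_left mult.assoc)
qed (simp add: comm_ideal_0)

lemma comm_ideal_mult_right: "p \<in> comm_ideal \<Longrightarrow> p * q \<in> comm_ideal"
proof (induction rule: comm_ideal.induct)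
  case (comm_ideal_step p u a b c v)
  then show ?case
    using comm_ideal.comm_ideal_step[of "p * q" u a b c "v * q"] by (simp add: distrib_right mult.assoc)
qed (simp add: comm_ideal_0)

lemma comm_ideal_minus: "p \<in> comm_ideal \<Longrightarrow> - p \<in> comm_ideal"
  using comm_ideal_mult_left[of p "- 1"] by simp

text \<open>This keeps 1 out of the ideal, so that 0 and 1 differ in \<open>cpoly\<close>.\<close>

lemma comm_ideal_const_term: "p \<in> comm_ideal \<Longrightarrow> const_term p = 0"
  by (induction rule: comm_ideal.induct) (simp_all add: lookup_add const_term_mult const_term_commutator)

lemma comm_ideal_diff: "p \<in> comm_ideal \<Longrightarrow> q \<in> comm_ideal \<Longrightarrow> p - q \<in> comm_ideal"
  using comm_ideal_add[of p "- q"] comm_ideal_minus[of q] by simp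

quotient_type (overloaded) 'k cpoly = "'k::field ncpoly" / "\<lambda>p q. p - q \<in> comm_ideal"
proof (rule equivpI)
  show "reflp (\<lambda>p q :: 'k ncpoly. p - q \<in> comm_ideal)"
    by (rule reflpI) (simp add: comm_ideal_0)
  show "symp (\<lambda>p q :: 'k ncpoly. p - q \<in> comm_ideal)"
  proof (rule sympI)
    fix p q :: "'k ncpoly" assume "p - q \<in> comm_ideal"
    then show "q - p \<in> comm_ideal" using comm_ideal_minus[of "p - q"] by simp
  qed
  show "transp (\<lambda>p q :: 'k ncpoly. p - q \<in> comm_ideal)"
  proof (rule transpI)
    fix p q r :: "'k ncpoly" assume "p - q \<in> comm_ideal" "q - r \<in> comm_ideal"
    then show "p - r \<in> comm_ideal" using comm_ideal_add[of "p - q" "q - r"] by simp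
  qed
qed

instantiation cpoly :: (field) central_commutator_ring
begin

lift_definition zero_cpoly :: "'a cpoly" is 0 .
lift_definition one_cpoly :: "'a cpoly" is 1 .
lift_definition plus_cpoly :: "'a cpoly \<Rightarrow> 'a cpoly \<Rightarrow> 'a cpoly" is "(+)"
proof -
  fix a b c d :: "'a ncpoly" assume "a - b \<in> comm_ideal" "c - d \<in> comm_ideal"
  then have "(a - b) + (c - d) \<in> comm_ideal" by (rule comm_ideal_add)
  then show "a + c - (b + d) \<in> comm_ideal" by (simp add: algebra_simps)
qed
lift_definition minus_cpoly :: "'a cpoly \<Rightarrow> 'a cpoly \<Rightarrow> 'a cpoly" is "(-)"
proof -
  fix a b c d :: "'a ncpoly" assume "a - b \<in> comm_ideal" "c - d \<in> comm_ideal"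
  then have "(a - b) - (c - d) \<in> comm_ideal" by (rule comm_ideal_diff)
  then show "a - c - (b - d) \<in> comm_ideal" by (simp add: algebra_simps)
qed
lift_definition uminus_cpoly :: "'a cpoly \<Rightarrow> 'a cpoly" is uminus
  using comm_ideal_minus by fastforce
lift_definition times_cpoly :: "'a cpoly \<Rightarrow> 'a cpoly \<Rightarrow> 'a cpoly" is "(*)"
proof -
  fix a b c d :: "'a ncpoly" assume "a - b \<in> comm_ideal" "c - d \<in> comm_ideal"
  then have "b * (c - d) + (a - b) * c \<in> comm_ideal"
    by (intro comm_ideal_add comm_ideal_mult_left comm_ideal_mult_right)
  then show "a * c - b * d \<in> comm_ideal" by (simp add: algebra_simps)
qed

instance
proof
  fix a b c :: "'a cpoly"
  show "(0 :: 'a cpoly) \<noteq> 1"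
    by transfer (use comm_ideal_const_term[of "- 1"] in auto)
  show "(a * b - b * a) * c = c * (a * b - b * a)"
    by transfer (use comm_ideal_gen in \<open>simp add: commutator_def\<close>)
qed (transfer, simp add: algebra_simps comm_ideal_0)+

end

abbreviation \<pi> :: "'k::field ncpoly \<Rightarrow> 'k cpoly" where
  "\<pi> \<equiv> abs_cpoly"

lemma pi_simps: "\<pi> (p + q) = \<pi> p + \<pi> q" "\<pi> (p - q) = \<pi> p - \<pi> q" "\<pi> (p * q) = \<pi> p * \<pi> q" "\<pi> 0 = 0" "\<pi> 1 = 1"
  "\<pi> (- p) = - \<pi> p"
  by (simp_all add: plus_cpoly.abs_eq minus_cpoly.abs_eq times_cpoly.abs_eq zero_cpoly.abs_eq one_cpoly.abs_eq
      uminus_cpoly.abs_eq)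

lemma pi_surj: obtains p where "\<pi> p = x"
  using Quotient_abs_rep[OF Quotient_cpoly] by blast

lemma pi_of_nat: "\<pi> (of_nat n) = of_nat n"
  by (induction n) (simp_all add: pi_simps)

lemma pi_power: "\<pi> (p ^ n) = \<pi> p ^ n"
  by (induction n) (simp_all add: pi_simps)

lemma std_hom:
  fixes h :: "'a::ring_1 \<Rightarrow> 'b::ring_1"
  assumes "\<And>a b. h (a + b) = h a + h b" "\<And>a b. h (a * b) = h a * h b" "h 1 = 1"
  shows "h (std n y) = std n (\<lambda>i. h (y i))"
proof -
  have zero: "h 0 = 0" using assms(1)[of 0 0] by simp
  have minus: "h (- a) = - h a" for a
    using assms(1)[of a "- a"] zero by (simp add: eq_neg_iff_add_eq_0 add.commute)
  have "h (sum f S) = (\<Sum>i\<in>S. h (f i))" for f and S :: "(nat \<Rightarrow> nat) set"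
    by (induction S rule: infinite_finite_induct) (simp_all add: zero assms)
  moreover have "h (prod_list l) = prod_list (map h l)" for l
    by (induction l) (simp_all add: assms)
  moreover have "h (of_int (sign p)) = of_int (sign p)" for p :: "nat \<Rightarrow> nat"
    by (cases p rule: sign_cases) (simp_all add: assms minus)
  ultimately show ?thesis by (simp add: std_def assms comp_def)
qed

lemma std_poly_eq_std: "std_poly n = std n X"
  by (simp add: std_poly_def std_def)

lemma pi_std: "\<pi> (std n y * y 0 ^ m) = std n (\<lambda>i. \<pi> (y i)) * \<pi> (y 0) ^ m"
proof -
  have "\<pi> (std n y) = std n (\<lambda>i. \<pi> (y i))"
    by (rule std_hom) (simp_all add: pi_simps)
  then show ?thesis by (simp add: pi_simps pi_power)
qed

section \<open>Transfer between the free algebra and its quotient\<close>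

locale T_ideal_mod =
  fixes J :: "'k::field_char_0 ncpoly set"
  assumes T: "T_ideal free_alg J" and comm: "comm_ideal \<subseteq> J"
begin

lemma pi_mem_iff: "\<pi> p \<in> \<pi> ` J \<longleftrightarrow> p \<in> J"
proof
  assume "\<pi> p \<in> \<pi> ` J"
  then obtain q where "q \<in> J" "p - q \<in> comm_ideal"
    by (auto simp: cpoly.abs_eq_iff)
  then show "p \<in> J" using T_ideal_add[OF T, of "p - q" q] comm by auto
qed simp

sublocale ideal_pair "\<pi> ` J" "\<pi> ` aug"
proof
  show "0 \<in> \<pi> ` J" by (metis T_ideal_0[OF T] imageI pi_simps(4))
  show "0 \<in> \<pi> ` aug" by (metis aug_closed(1) imageI pi_simps(4))
next
  fix a b :: "'k cpoly" assume "a \<in> \<pi> ` J" "b \<in> \<pi> ` J"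
  then show "a + b \<in> \<pi> ` J" using T_ideal_add[OF T] by (auto simp flip: pi_simps)
next
  fix a c :: "'k cpoly" assume "a \<in> \<pi> ` J"
  moreover obtain p where "c = \<pi> p" using pi_surj[of c] by metis
  ultimately show "c * a \<in> \<pi> ` J" "a * c \<in> \<pi> ` J"
    using T_ideal_mult_left[OF T] T_ideal_mult_right[OF T] by (auto simp flip: pi_simps)
next
  fix n and a :: "'k cpoly" assume na: "of_nat n * a \<in> \<pi> ` J" "0 < n"
  obtain p where p: "a = \<pi> p" using pi_surj[of a] by metis
  interpret S: saturated_ideal J by (rule T_ideal_saturated_ideal) (rule T)
  have "of_nat n * p \<in> J" using na(1) by (simp add: p pi_mem_iff flip: pi_of_nat pi_simps)
  then have "p \<in> J" using na(2) S.saturated by blast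
  then show "a \<in> \<pi> ` J" by (simp add: p)
next
  fix a b :: "'k cpoly" assume "a \<in> \<pi> ` aug" "b \<in> \<pi> ` aug"
  then show "a + b \<in> \<pi> ` aug" by (auto simp flip: pi_simps)
next
  fix a c :: "'k cpoly" assume "a \<in> \<pi> ` aug"
  moreover obtain p where "c = \<pi> p" using pi_surj[of c] by metis
  ultimately show "c * a \<in> \<pi> ` aug" "a * c \<in> \<pi> ` aug"
    by (auto simp flip: pi_simps)
qed

lemma std_mem_iff: "std n (\<lambda>i. \<pi> (y i)) * \<pi> (y 0) ^ m \<in> \<pi> ` J \<longleftrightarrow> std n y * y 0 ^ m \<in> J"
  by (simp only: pi_mem_iff flip: pi_std)

lemma args_pi: "(\<And>i. y i \<in> aug) \<Longrightarrow> args (\<lambda>i. \<pi> (y i))"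
  by (simp add: args_def)

text \<open>Any family of arguments in the quotient lifts to polynomials without constant term, and
  substituting these for the generators stays in the T-ideal.\<close>

lemma std_forms_iff: "std_forms n m \<longleftrightarrow> std_poly n * X 0 ^ m \<in> J"
proof
  assume "std_forms n m"
  then have "std n (\<lambda>i. \<pi> (X i)) * \<pi> (X 0) ^ m \<in> \<pi> ` J"
    unfolding std_forms_def by (elim allE[of _ "\<lambda>i. \<pi> (X i)"]) (simp add: args_pi)
  then show "std_poly n * X 0 ^ m \<in> J" by (simp add: std_mem_iff std_poly_eq_std)
next
  assume mem: "std_poly n * X 0 ^ m \<in> J"
  show "std_forms n m"
    unfolding std_forms_def
  proof (intro allI impI)
    fix z :: "nat \<Rightarrow> 'k cpoly" assume "args z"
    then have "\<exists>p. p \<in> aug \<and> z i = \<pi> p" for i by (auto simp: args_def)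
    then obtain y where y: "\<And>i. y i \<in> aug" "z = (\<lambda>i. \<pi> (y i))" by metis
    interpret endo "subst y" by (rule endo_subst) (rule y)
    have "subst y (std n X) = std n (\<lambda>i. subst y (X i))"
      by (rule std_hom) (simp_all add: hom_add hom_mult)
    then have "subst y (std_poly n * X 0 ^ m) = std n y * y 0 ^ m"
      by (simp add: std_poly_eq_std hom_mult hom_power)
    then have "std n y * y 0 ^ m \<in> J"
      using T_ideal_endo[OF T endo_axioms mem] by simp
    then show "std n z * z 0 ^ m \<in> \<pi> ` J" by (simp add: y(2) std_mem_iff)
  qed
qed

end

section \<open>Order and degree of standard polynomials\<close>

lemma std_order_ge:
  assumes "\<And>i. y i \<in> aug"
  shows "std n y \<in> order_ge n"
proof -
  have s: "sum f S \<in> order_ge n" if "\<And>i. i \<in> S \<Longrightarrow> f i \<in> order_ge n" for f and S :: "(nat \<Rightarrow> nat) set"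
    using that by (induction S rule: infinite_finite_induct) (simp_all add: order_ge_add)
  show ?thesis
    unfolding std_def
  proof (rule s)
    fix p :: "nat \<Rightarrow> nat"
    have "prod_list (map (\<lambda>i. y (p i)) [0..<n]) \<in> order_ge n"
      using order_ge_prod_list[of "\<lambda>i. y (p i)" "[0..<n]"] assms by simp
    then show "of_int (sign p) * prod_list (map (\<lambda>i. y (p i)) [0..<n]) \<in> order_ge n"
      by (rule order_ge_mult_left)
  qed
qed

abbreviation homog :: "nat \<Rightarrow> 'k::field ncpoly \<Rightarrow> bool" where
  "homog n p \<equiv> homog_part n p = p"

lemma homog_iff: "homog n p \<longleftrightarrow> (\<forall>w\<in>Poly_Mapping.keys p. length (letters w) = n)"
proof
  assume "homog n p"
  then show "\<forall>w\<in>Poly_Mapping.keys p. length (letters w) = n"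
    by (metis in_keys_iff lookup_homog_part)
next
  assume "\<forall>w\<in>Poly_Mapping.keys p. length (letters w) = n"
  then show "homog n p"
    by (intro poly_mapping_eqI) (auto simp: lookup_homog_part in_keys_iff)
qed

lemma homog_mult: "homog m p \<Longrightarrow> homog n q \<Longrightarrow> homog (m + n) (p * q)"
  using keys_mult[of p q] unfolding homog_iff by (fastforce simp: plus_word_def)

lemma homog_scal_mult: "homog n p \<Longrightarrow> homog n (scal c * p)"
  using homog_mult[of 0 "scal c" n p] by (simp add: homog_part_single zero_word_def)

lemma homog_prod_list: "(\<And>i. homog 1 (g i)) \<Longrightarrow> homog (length l) (prod_list (map g l))"
proof (induction l)
  case Nil
  then show ?case by (simp add: homog_part_single zero_word_def flip: single_one)
next
  case (Cons i l)
  have "homog (1 + length l) (g i * prod_list (map g l))"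
    by (rule homog_mult[OF Cons.prems Cons.IH[OF Cons.prems]])
  then show ?case by simp
qed

lemma homog_power: "homog 1 p \<Longrightarrow> homog m (p ^ m)"
  using homog_prod_list[of "\<lambda>_. p" "replicate m 0"] by (simp add: map_replicate_const prod_list_replicate)

lemma homog_std:
  assumes "\<And>i. homog 1 (y i)"
  shows "homog n (std n y)"
proof -
  have s: "homog n (sum f S)" if "\<And>i. i \<in> S \<Longrightarrow> homog n (f i)" for f and S :: "(nat \<Rightarrow> nat) set"
    using that by (induction S rule: infinite_finite_induct) (simp_all add: homog_part_add)
  show ?thesis
    unfolding std_def
  proof (rule s)
    fix p :: "nat \<Rightarrow> nat"
    have "homog n (prod_list (map (\<lambda>i. y (p i)) [0..<n]))"
      using homog_prod_list[of "\<lambda>i. y (p i)" "[0..<n]"] assms by simp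
    moreover have "of_int (sign p) = scal (of_int (sign p))" by simp
    ultimately show "homog n (of_int (sign p) * prod_list (map (\<lambda>i. y (p i)) [0..<n]))"
      using homog_scal_mult by metis
  qed
qed

lemma homog_part_1_aug: "homog_part 1 p \<in> aug"
  by (simp add: aug_def lookup_homog_part zero_word_def)

section \<open>The T-ideal of f modulo the listed identities\<close>

locale std_consequences = T_ideal_mod J for J :: "'k::field_char_0 ncpoly set" +
  fixes k m :: nat
  assumes even_mem: "even k \<Longrightarrow> k > 0 \<Longrightarrow> std_poly k * X 0 ^ (m + 2) \<in> J"
    and mem1: "std_poly (Suc k) * X 0 ^ Suc m \<in> J"
    and mem2: "std_poly (k + 2) * X 0 ^ m \<in> J"
    and mem3: "m > 0 \<Longrightarrow> std_poly (k + 3) * X 0 ^ (m - 1) \<in> J"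
begin

abbreviation F :: "(nat \<Rightarrow> 'k ncpoly) \<Rightarrow> 'k ncpoly" where
  "F y \<equiv> std (Suc k) y * y 0 ^ m"

lemma F_mult:
  assumes "\<And>i. y i \<in> aug" "b \<in> aug"
  shows "F y * b \<in> J" "b * F y \<in> J"
proof -
  note c = std_forms_closure(1,2)[OF _ _ _ _ args_pi[OF assms(1)] imageI[OF assms(2)] imageI[OF assms(2)],
      unfolded std_forms_iff, OF even_mem mem1 mem2 mem3]
  have "\<pi> (F y * b) \<in> \<pi> ` J" "\<pi> (b * F y) \<in> \<pi> ` J"
    using c by (simp_all add: pi_simps(3)[of "F y" b] pi_simps(3)[of b "F y"] pi_std del: power_Suc)
  then show "F y * b \<in> J" "b * F y \<in> J" by (simp_all only: pi_mem_iff)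
qed

lemma F_perturb_product:
  assumes "\<And>i. y i \<in> aug" "a \<in> aug" "b \<in> aug" "i \<le> k"
  shows "F (y(i := y i + a * b)) - F y \<in> J"
proof -
  note c = std_forms_closure(3)[OF _ _ _ _ args_pi[OF assms(1)] imageI[OF assms(2)] imageI[OF assms(3)] assms(4),
      unfolded std_forms_iff, OF even_mem mem1 mem2 mem3]
  have upd: "(\<lambda>j. \<pi> ((y(i := y i + a * b)) j)) = (\<lambda>j. \<pi> (y j))(i := \<pi> (y i) + \<pi> a * \<pi> b)"
    by (auto simp: fun_eq_iff fun_upd_apply pi_simps)
  from upd have upd0: "\<pi> ((y(i := y i + a * b)) 0) = ((\<lambda>j. \<pi> (y j))(i := \<pi> (y i) + \<pi> a * \<pi> b)) 0"
    by (rule fun_cong)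
  have "\<pi> (F (y(i := y i + a * b)) - F y) \<in> \<pi> ` J"
    using c unfolding pi_simps(2) pi_std upd upd0 by simp
  then show ?thesis by (simp only: pi_mem_iff)
qed

lemma F_perturb:
  assumes "\<And>i. y i \<in> aug" "h \<in> order_ge 2" "i \<le> k"
  shows "F (y(i := y i + h)) - F y \<in> J"
proof -
  \<comment> \<open>The family y is quantified inside the induction: adding a sum of two terms
    perturbs a family that the first term has already altered. A word of length at least 2 is a
    product of two elements of \<open>aug\<close>.\<close>
  have "h \<in> aug \<and> (\<forall>y. (\<forall>i. y i \<in> aug) \<longrightarrow> F (y(i := y i + h)) - F y \<in> J)"
  proof (rule ncpoly_induct[of h "\<lambda>w. 2 \<le> length (letters w)"])
    fix w and c :: 'k assume "2 \<le> length (letters w)"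
    then obtain j j' l where w: "w = Word (j # j' # l)"
      by (cases w; cases "letters w"; cases "tl (letters w)") auto
    have s: "Poly_Mapping.single w c = X j * (X j' * Poly_Mapping.single (Word l) c)"
      by (simp add: w single_Cons)
    show "Poly_Mapping.single w c \<in> aug \<and>
        (\<forall>y. (\<forall>i. y i \<in> aug) \<longrightarrow> F (y(i := y i + Poly_Mapping.single w c)) - F y \<in> J)"
      unfolding s using assms(3) by (auto intro!: F_perturb_product)
  next
    fix p q
    assume p: "p \<in> aug \<and> (\<forall>y. (\<forall>i. y i \<in> aug) \<longrightarrow> F (y(i := y i + p)) - F y \<in> J)"
      and q: "q \<in> aug \<and> (\<forall>y. (\<forall>i. y i \<in> aug) \<longrightarrow> F (y(i := y i + q)) - F y \<in> J)"
    have "F (y(i := y i + (p + q))) - F y \<in> J" if y: "\<forall>i. y i \<in> aug" for y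
    proof -
      let ?z = "y(i := y i + p)"
      have "\<forall>j. ?z j \<in> aug" using y p by (simp add: fun_upd_apply)
      then have "F (?z(i := ?z i + q)) - F ?z \<in> J" "F ?z - F y \<in> J"
        using y p q by blast+
      then have "(F (?z(i := ?z i + q)) - F ?z) + (F ?z - F y) \<in> J"
        by (rule T_ideal_add[OF T])
      then show ?thesis by (simp add: add.assoc)
    qed
    with p q show "p + q \<in> aug \<and> (\<forall>y. (\<forall>i. y i \<in> aug) \<longrightarrow> F (y(i := y i + (p + q))) - F y \<in> J)"
      by simp
  qed (use assms(2) in \<open>simp_all add: order_ge_def T_ideal_0[OF T]\<close>)
  then show ?thesis using assms(1) by blast
qed

lemma aug_linear_part: "p \<in> aug \<Longrightarrow> p - homog_part 1 p \<in> order_ge 2"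
  by (auto simp: aug_eq_order_ge order_ge_def in_keys_iff lookup_minus lookup_homog_part split: if_splits)
    (metis One_nat_def Suc_1 Suc_leI in_keys_iff le_neq_implies_less)

lemma F_linear_part:
  assumes y: "\<And>i. y i \<in> aug"
  shows "F y - F (\<lambda>i. homog_part 1 (y i)) \<in> J"
proof -
  \<comment> \<open>The arguments are made linear one at a time; \<open>z j\<close> is obtained from
    \<open>z (Suc j)\<close> by adding a polynomial of order at least 2 in place j.\<close>
  define z where "z j = (\<lambda>i. if i < j then homog_part 1 (y i) else y i)" for j
  have z: "z j i \<in> aug" for i j using homog_part_1_aug[of "y i"] by (simp add: z_def y)
  have "F y - F (z j) \<in> J" if "j \<le> Suc k" for j
    using that
  proof (induction j)
    case 0
    have "z 0 = y" by (simp add: z_def)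
    then show ?case by (simp add: T_ideal_0[OF T])
  next
    case (Suc j)
    let ?h = "y j - homog_part 1 (y j)"
    have "F ((z (Suc j))(j := z (Suc j) j + ?h)) - F (z (Suc j)) \<in> J"
      using Suc.prems by (intro F_perturb z aug_linear_part y) simp
    also have "(z (Suc j))(j := z (Suc j) j + ?h) = z j"
      by (auto simp: z_def fun_eq_iff fun_upd_apply)
    finally have "(F y - F (z j)) + (F (z j) - F (z (Suc j))) \<in> J"
      using Suc by (intro T_ideal_add[OF T]) simp_all
    then show ?case by simp
  qed
  then have "F y - F (z (Suc k)) \<in> J" by simp
  also have "std (Suc k) (z (Suc k)) = std (Suc k) (\<lambda>i. homog_part 1 (y i))"
    by (rule std_cong) (simp add: z_def)
  finally show ?thesis by (simp add: z_def)
qed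

inductive_set inst_span :: "'k ncpoly set" where
  inst_span_0: "0 \<in> inst_span"
| inst_span_add: "v \<in> inst_span \<Longrightarrow> (\<And>i. y i \<in> aug) \<Longrightarrow> v + scal c * F y \<in> inst_span"

lemma inst_span_plus:
  assumes "u \<in> inst_span" "v \<in> inst_span"
  shows "u + v \<in> inst_span"
  using assms(2,1)
proof (induction rule: inst_span.induct)
  case (inst_span_add v y c)
  have "u + v + scal c * F y \<in> inst_span"
    by (rule inst_span.inst_span_add) (use inst_span_add in auto)
  then show ?case by (simp only: add.assoc)
next
  case inst_span_0
  then show ?case by (simp only: add_0_right)
qed

lemma inst_span_mult:
  assumes "v \<in> inst_span" "b \<in> aug"
  shows "v * b \<in> J" "b * v \<in> J"
proof -
  have "v * b \<in> J \<and> b * v \<in> J"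
    using assms(1)
  proof (induction rule: inst_span.induct)
    case (inst_span_add v y c)
    have "v * b + scal c * (F y * b) \<in> J" "b * v + scal c * (b * F y) \<in> J"
      using inst_span_add.IH F_mult[of y b, OF inst_span_add.hyps(2) assms(2)]
      by (auto intro: T_ideal_add[OF T] T_ideal_mult_left[OF T])
    moreover have "b * (scal c * F y) = scal c * (b * F y)"
      by (simp only: mult.assoc[symmetric] scal_commute[of c b])
    ultimately show ?case
      by (simp only: distrib_left distrib_right mult.assoc)
  next
    case inst_span_0
    show ?case using T_ideal_0[OF T] by (simp only: mult_zero_left mult_zero_right)
  qed
  then show "v * b \<in> J" "b * v \<in> J" by auto
qed

lemma inst_span_scal: "v \<in> inst_span \<Longrightarrow> scal d * v \<in> inst_span"
proof (induction rule: inst_span.induct)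
  case (inst_span_add v y c)
  then show ?case
    using inst_span.inst_span_add[of "scal d * v" y "d * c"] by (simp add: distrib_left scal_mult mult.assoc)
qed (simp add: inst_span_0)

lemma inst_span_endo:
  assumes "endo \<phi>" "v \<in> inst_span"
  shows "\<phi> v \<in> inst_span"
  using assms(2)
proof (induction rule: inst_span.induct)
  case (inst_span_add v y c)
  interpret endo \<phi> by fact
  have "\<phi> (std (Suc k) y) = std (Suc k) (\<lambda>i. \<phi> (y i))"
    by (rule std_hom) (simp_all add: hom_add hom_mult)
  then have "\<phi> (v + scal c * F y) = \<phi> v + scal c * F (\<lambda>i. \<phi> (y i))"
    by (simp add: hom_add hom_mult hom_scal hom_power)
  then show ?case
    using inst_span.inst_span_add[of "\<phi> v" "\<lambda>i. \<phi> (y i)" c, OF inst_span_add.IH]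
      hom_aug[OF inst_span_add.hyps(2)] by simp
qed (simp add: inst_span_0 endo.hom_0[OF assms(1)])

text \<open>Modulo \<open>J\<close> only the linear parts of the arguments matter, and at linear
  forms \<open>F\<close> is homogeneous of degree k + 1 + m, the degree of f.\<close>

lemma inst_span_homogeneous:
  "v \<in> inst_span \<Longrightarrow> \<exists>v'. homog (Suc k + m) v' \<and> v - v' \<in> J"
proof (induction rule: inst_span.induct)
  case inst_span_0
  show ?case by (intro exI[of _ 0]) (simp add: T_ideal_0[OF T])
next
  case (inst_span_add v y c)
  then obtain v' where v': "homog (Suc k + m) v'" "v - v' \<in> J" by blast
  let ?l = "\<lambda>i. homog_part 1 (y i)"
  have "homog 1 (?l i)" for i by (simp add: homog_part_homog_part)
  then have "homog (Suc k + m) (scal c * F ?l)"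
    by (intro homog_scal_mult homog_mult homog_std homog_power)
  then have "homog (Suc k + m) (v' + scal c * F ?l)"
    using v'(1) by (simp add: homog_part_add)
  moreover have "(v - v') + scal c * (F y - F ?l) \<in> J"
    using v'(2) F_linear_part[of y, OF inst_span_add.hyps(2)]
    by (intro T_ideal_add[OF T] T_ideal_mult_left[OF T])
  then have "v + scal c * F y - (v' + scal c * F ?l) \<in> J"
    by (simp add: algebra_simps)
  ultimately show ?case by blast
qed

lemma T_ideal_inst_span_plus: "T_ideal free_alg {u \<in> aug. \<exists>v\<in>inst_span. u - v \<in> J}"
proof (rule T_idealI)
  show "0 \<in> {u \<in> aug. \<exists>v\<in>inst_span. u - v \<in> J}"
    using inst_span_0 T_ideal_0[OF T] by force
next
  fix p q :: "'k ncpoly" assume "p \<in> {u \<in> aug. \<exists>v\<in>inst_span. u - v \<in> J}" "q \<in> {u \<in> aug. \<exists>v\<in>inst_span. u - v \<in> J}"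
  then obtain u v where uv: "p \<in> aug" "q \<in> aug" "u \<in> inst_span" "v \<in> inst_span" "p - u \<in> J" "q - v \<in> J" by blast
  then have "(p - u) + (q - v) \<in> J" by (intro T_ideal_add[OF T])
  then have "p + q - (u + v) \<in> J" by (simp add: algebra_simps)
  with uv inst_span_plus show "p + q \<in> {u \<in> aug. \<exists>v\<in>inst_span. u - v \<in> J}" by auto
next
  fix p q :: "'k ncpoly" assume "p \<in> {u \<in> aug. \<exists>v\<in>inst_span. u - v \<in> J}"
  then obtain v where v: "p \<in> aug" "v \<in> inst_span" "p - v \<in> J" by blast
  \<comment> \<open>The part of q in \<open>aug\<close> sends the span into \<open>J\<close>, so q
    acts on it through its constant term.\<close>
  let ?c = "scal (const_term q)" and ?r = "q - scal (const_term q)"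
  have vr: "v * ?r \<in> J" "?r * v \<in> J" using inst_span_mult[OF v(2) aug_decompose(2)] .
  have "(p - v) * q + v * ?r \<in> J" "q * (p - v) + ?r * v \<in> J"
    using v(3) vr by (auto intro: T_ideal_add[OF T] T_ideal_mult_left[OF T] T_ideal_mult_right[OF T])
  moreover have "(p - v) * q + v * ?r = p * q - ?c * v" "q * (p - v) + ?r * v = q * p - ?c * v"
    by (simp_all add: algebra_simps scal_commute[of _ v])
  ultimately show "p * q \<in> {u \<in> aug. \<exists>v\<in>inst_span. u - v \<in> J}" "q * p \<in> {u \<in> aug. \<exists>v\<in>inst_span. u - v \<in> J}"
    using v(1) inst_span_scal[OF v(2), of "const_term q"] by auto
next
  fix \<phi> :: "'k ncpoly \<Rightarrow> 'k ncpoly" and p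
  assume \<phi>: "endo \<phi>" and "p \<in> {u \<in> aug. \<exists>v\<in>inst_span. u - v \<in> J}"
  then obtain v where v: "p \<in> aug" "v \<in> inst_span" "p - v \<in> J" by blast
  have "\<phi> p - \<phi> v \<in> J" using T_ideal_endo[OF T \<phi> v(3)] by (simp add: endo.hom_diff[OF \<phi>])
  with v inst_span_endo[OF \<phi>] endo.hom_aug[OF \<phi>] show "\<phi> p \<in> {u \<in> aug. \<exists>v\<in>inst_span. u - v \<in> J}" by auto
qed auto

end

section \<open>The theorem\<close>

lemma identity_of_aug: "identity_of B f \<Longrightarrow> f \<in> aug"
  by (simp add: identity_of_def)

lemma identity_of_eq: "identity_of B f \<Longrightarrow> \<phi> \<in> alg_hom free_alg B \<Longrightarrow> \<phi> f = zero B"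
  by (simp add: identity_of_def)

context assoc_algebra
begin

lemma idempotent_eq_zero:
  assumes "a \<in> carrier B" "add B a a = a"
  shows "a = zero B"
proof -
  obtain b where b: "b \<in> carrier B" "add B a b = zero B" using add_inv[OF assms(1)] by blast
  have "zero B = add B (add B a a) b" using assms(2) b(2) by simp
  also have "\<dots> = add B a (zero B)" using add_assoc[OF assms(1,1) b(1)] b(2) by simp
  also have "\<dots> = a" using add_comm[OF assms(1) zero_closed] add_zero[OF assms(1)] by simp
  finally show ?thesis by simp
qed

lemma zero_simps:
  "add B (zero B) (zero B) = zero B" "smult B c (zero B) = zero B"
  "a \<in> carrier B \<Longrightarrow> mult B (zero B) a = zero B" "a \<in> carrier B \<Longrightarrow> mult B a (zero B) = zero B"
proof -
  show z: "add B (zero B) (zero B) = zero B" by (rule add_zero[OF zero_closed])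
  show "smult B c (zero B) = zero B"
    using smult_add[OF zero_closed zero_closed, of c] z
    by (intro idempotent_eq_zero smult_closed zero_closed) simp
  show "mult B (zero B) a = zero B" if "a \<in> carrier B"
    using mult_add_left[OF zero_closed zero_closed that] z that
    by (intro idempotent_eq_zero mult_closed zero_closed) simp_all
  show "mult B a (zero B) = zero B" if "a \<in> carrier B"
    using mult_add_right[OF zero_closed zero_closed that] z that
    by (intro idempotent_eq_zero mult_closed zero_closed) simp_all
qed

lemma T_ideal_identity_of: "T_ideal free_alg {f. identity_of B f}"
  unfolding T_ideal_def alg_ideal_def
proof (intro conjI ballI allI)
  show "{f. identity_of B f} \<subseteq> carrier free_alg" by (auto simp: identity_of_def)
  have "\<phi> 0 = zero B" if "\<phi> \<in> alg_hom free_alg B" for \<phi>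
    using alg_hom_add[OF that, of 0 0] alg_hom_closed[OF that, of 0] by (intro idempotent_eq_zero) simp_all
  then show "zero free_alg \<in> {f. identity_of B f}" by (simp add: identity_of_def)
next
  fix a b :: "'k ncpoly" assume ab: "a \<in> {f. identity_of B f}" "b \<in> {f. identity_of B f}"
  have "\<phi> (a + b) = zero B" if "\<phi> \<in> alg_hom free_alg B" for \<phi>
    using ab alg_hom_add[OF that, of a b] zero_simps(1)
    by (simp add: identity_of_aug identity_of_eq[OF _ that])
  then show "add free_alg a b \<in> {f. identity_of B f}"
    using ab by (simp add: identity_of_def)
next
  fix a c assume a: "a \<in> {f. identity_of B f}"
  have "\<phi> (scal c * a) = zero B" if "\<phi> \<in> alg_hom free_alg B" for \<phi>
    using a alg_hom_smult[OF that, of a c] zero_simps(2)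
    by (simp add: identity_of_aug identity_of_eq[OF _ that])
  then show "smult free_alg c a \<in> {f. identity_of B f}"
    using a by (simp add: identity_of_def)
next
  fix a b :: "'k ncpoly" assume ab: "a \<in> {f. identity_of B f}" "b \<in> carrier free_alg"
  have "\<phi> (a * b) = zero B" "\<phi> (b * a) = zero B" if "\<phi> \<in> alg_hom free_alg B" for \<phi>
    using ab alg_hom_mult[OF that, of a b] alg_hom_mult[OF that, of b a]
      alg_hom_closed[OF that, of b] zero_simps(3,4)
    by (simp_all add: identity_of_aug identity_of_eq[OF _ that])
  then show "mult free_alg a b \<in> {f. identity_of B f}" "mult free_alg b a \<in> {f. identity_of B f}"
    using ab by (simp_all add: identity_of_def)
next
  fix \<chi> :: "'k ncpoly \<Rightarrow> 'k ncpoly" assume \<chi>: "\<chi> \<in> alg_hom free_alg free_alg"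
  have comp: "\<phi> \<circ> \<chi> \<in> alg_hom free_alg B" if "\<phi> \<in> alg_hom free_alg B" for \<phi>
    by (rule alg_homI; simp only: comp_apply)
      (simp_all only: alg_hom_closed[OF that] alg_hom_closed[OF \<chi>] alg_hom_add[OF that] alg_hom_add[OF \<chi>]
        alg_hom_mult[OF that] alg_hom_mult[OF \<chi>] alg_hom_smult[OF that] alg_hom_smult[OF \<chi>])
  show "\<chi> ` {f. identity_of B f} \<subseteq> {f. identity_of B f}"
  proof clarify
    fix f assume f: "identity_of B f"
    have "\<phi> (\<chi> f) = zero B" if "\<phi> \<in> alg_hom free_alg B" for \<phi>
      using f comp[OF that] by (auto simp: identity_of_def comp_apply)
    then show "identity_of B (\<chi> f)"
      using f alg_hom_closed[OF \<chi>, of f] by (simp add: identity_of_def)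
  qed
qed

end

lemma T_ideal_Inter:
  assumes "\<And>I. I \<in> S \<Longrightarrow> T_ideal free_alg I"
  shows "T_ideal free_alg (aug \<inter> \<Inter>S)"
  using assms T_ideal_aug_self
  by (intro T_idealI)
    (auto intro: T_ideal_0 T_ideal_add T_ideal_mult_left T_ideal_mult_right T_ideal_endo simp: endo.hom_aug)

lemma T_ideal_identities: "T_ideal free_alg (identities (variety G))"
proof -
  have "identities (variety G) = aug \<inter> \<Inter>((\<lambda>B. {f. identity_of B f}) ` variety G)"
    by (auto simp: identities_def)
  moreover have "T_ideal free_alg I" if "I \<in> (\<lambda>B. {f. identity_of B f}) ` variety G" for I
    using that assoc_algebra.T_ideal_identity_of by (auto simp: variety_def)
  ultimately show ?thesis using T_ideal_Inter by metis
qed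

lemma commutator_diff_scal: "\<langle>a - scal c, b\<rangle> = \<langle>a, b\<rangle>" "\<langle>b, a - scal c\<rangle> = \<langle>b, a\<rangle>"
  by (simp_all add: commutator_def algebra_simps scal_commute[of c b])

text \<open>The identity may be evaluated only at polynomials without constant term, but commutators
  do not see constant terms.\<close>

lemma comm_ideal_subset:
  assumes I: "T_ideal free_alg I" and mem: "\<langle>\<langle>X 0, X 1\<rangle>, X 2\<rangle> \<in> I"
  shows "comm_ideal \<subseteq> I"
proof -
  have *: "\<langle>\<langle>a, b\<rangle>, c\<rangle> \<in> I" if "a \<in> aug" "b \<in> aug" "c \<in> aug" for a b c
  proof -
    define g where "g i = (if i = 0 then a else if i = 1 then b else c)" for i :: nat
    interpret endo "subst g" by (rule endo_subst) (simp add: g_def that)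
    have "subst g \<langle>\<langle>X 0, X 1\<rangle>, X 2\<rangle> = \<langle>\<langle>a, b\<rangle>, c\<rangle>"
      by (simp add: commutator_def hom_diff hom_mult g_def)
    then show ?thesis using T_ideal_endo[OF I endo_axioms mem] by simp
  qed
  have gen: "\<langle>\<langle>a, b\<rangle>, c\<rangle> \<in> I" for a b c
    using *[of "a - scal (const_term a)" "b - scal (const_term b)" "c - scal (const_term c)"]
      aug_decompose(2)[of a] aug_decompose(2)[of b] aug_decompose(2)[of c]
    by (simp add: commutator_diff_scal)
  have "p \<in> I" if "p \<in> comm_ideal" for p
    using that
    by (induction rule: comm_ideal.induct)
      (auto intro: T_ideal_0[OF I] T_ideal_add[OF I] T_ideal_mult_left[OF I] T_ideal_mult_right[OF I] gen)
  then show ?thesis by blast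
qed

lemma std_power_order_ge: "std_poly n * X 0 ^ m \<in> order_ge (n + m)"
  unfolding std_poly_eq_std by (intro order_ge_mult std_order_ge order_ge_power X_in_aug)

theorem theorem2p4p2:
  fixes M :: "'k::field_char_0 variety" and n k :: nat and \<epsilon> :: "'k ncpoly"
  assumes "M = variety {commutator (commutator (X 0) (X 1)) (X 2)}"
    and "n \<ge> 1" and "k \<le> n - 1"
    and "\<epsilon> = (if even k then 1 else 0)"
  shows "equivalent_to_identities M
    (higher_consequences M n (std_poly (k + 1) * X 0 ^ (n - k - 1)))
    ((if k = 0 then {} else {\<epsilon> * std_poly k * X 0 ^ (n - k + 1)}) \<union>
     {std_poly (k + 1) * X 0 ^ (n - k), std_poly (k + 2) * X 0 ^ (n - k - 1)} \<union>
     (if k = n - 1 then {} else {std_poly (k + 3) * X 0 ^ (n - k - 2)}))"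
proof -
  define m where "m = n - k - 1"
  have n: "n = Suc k + m" using assms(2,3) by (simp add: m_def)
  define f :: "'k ncpoly" where "f = std_poly (Suc k) * X 0 ^ m"
  define G :: "'k ncpoly set" where
    "G = (if k = 0 then {} else {\<epsilon> * std_poly k * X 0 ^ (m + 2)}) \<union>
     {std_poly (Suc k) * X 0 ^ Suc m, std_poly (k + 2) * X 0 ^ m} \<union>
     (if m = 0 then {} else {std_poly (k + 3) * X 0 ^ (m - 1)})"
  have G: "(if k = 0 then {} else {\<epsilon> * std_poly k * X 0 ^ (n - k + 1)}) \<union>
     {std_poly (k + 1) * X 0 ^ (n - k), std_poly (k + 2) * X 0 ^ (n - k - 1)} \<union>
     (if k = n - 1 then {} else {std_poly (k + 3) * X 0 ^ (n - k - 2)}) = G"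
    unfolding G_def n by simp
  have f: "std_poly (k + 1) * X 0 ^ (n - k - 1) = f"
    by (simp add: f_def m_def)

  define I where "I = identities M"
  have I: "T_ideal free_alg I"
    unfolding I_def assms(1) by (rule T_ideal_identities)
  have "\<langle>\<langle>X 0, X 1\<rangle>, X 2\<rangle> \<in> I"
    by (auto simp: I_def assms(1) identities_def variety_def identity_of_def commutator_def)
  then have comm: "comm_ideal \<subseteq> I" by (rule comm_ideal_subset[OF I])
  interpret quotient_by I by standard (rule I)
  have rel: "rel_free M = Q" "proj M = p"
    by (simp_all add: rel_free_def proj_def I_def fun_eq_iff)

  have ord: "g \<in> order_ge (Suc n)" if "g \<in> G" for g
  proof -
    have "\<epsilon> * std_poly k * X 0 ^ (m + 2) \<in> order_ge (Suc n)"
      using order_ge_mult_left[OF std_power_order_ge[of k "m + 2"], of \<epsilon>] by (simp add: n mult.assoc)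
    moreover have "std_poly (Suc k) * X 0 ^ Suc m \<in> order_ge (Suc n)" "std_poly (k + 2) * X 0 ^ m \<in> order_ge (Suc n)"
      using std_power_order_ge[of "Suc k" "Suc m"] std_power_order_ge[of "k + 2" m] by (simp_all add: n)
    moreover have "std_poly (k + 3) * X 0 ^ (m - 1) \<in> order_ge (Suc n)" if "m \<noteq> 0"
      using std_power_order_ge[of "k + 3" "m - 1"] that by (simp add: n)
    ultimately show ?thesis using that by (auto simp: G_def split: if_splits)
  qed
  have f_aug: "{f} \<subseteq> aug" and G_aug: "G \<subseteq> aug"
    using order_ge_mono[OF std_power_order_ge[of "Suc k" m], of 1] order_ge_mono[OF ord, of _ 1]
    by (auto simp: f_def aug_eq_order_ge)
  \<comment> \<open>Adjoining \<open>I\<close> makes these the full preimages of the T-ideals that f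
    and \<open>G\<close> generate in the relatively free algebra.\<close>
  define JF where "JF = T_ideal_gen free_alg ({f} \<union> I)"
  define JG where "JG = T_ideal_gen free_alg (G \<union> I)"
  have "{f} \<union> I \<subseteq> aug" "G \<union> I \<subseteq> aug"
    using f_aug G_aug T_ideal_aug[OF I] by blast+
  note gen_F = T_ideal_gen_props[OF this(1), folded JF_def] and gen_G = T_ideal_gen_props[OF this(2), folded JG_def]

  interpret JF: T_ideal_mod JF
    using gen_F(1,2) comm by unfold_locales blast+
  have "JF.std_forms (Suc k) m"
    using gen_F(2) unfolding JF.std_forms_iff by (simp add: f_def)
  note conseq = JF.std_forms_consequences[OF this, unfolded JF.std_forms_iff]
  have "G \<subseteq> JF"
    using conseq T_ideal_0[OF gen_F(1)] by (auto simp: G_def assms(4))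
  then have sub: "JG \<subseteq> JF"
    using gen_G(3)[OF gen_F(1)] gen_F(2) by blast

  interpret JG: std_consequences JG k m
  proof
    show "T_ideal free_alg JG" by (rule gen_G(1))
    show "comm_ideal \<subseteq> JG" using comm gen_G(2) by blast
  next
    assume "even k" "k > 0"
    then have "std_poly k * X 0 ^ (m + 2) \<in> G" by (simp add: G_def assms(4))
    then show "std_poly k * X 0 ^ (m + 2) \<in> JG" using gen_G(2) by blast
  next
    have "std_poly (Suc k) * X 0 ^ Suc m \<in> G" "std_poly (k + 2) * X 0 ^ m \<in> G" by (simp_all add: G_def)
    then show "std_poly (Suc k) * X 0 ^ Suc m \<in> JG" "std_poly (k + 2) * X 0 ^ m \<in> JG" using gen_G(2) by blast+
  next
    assume "m > 0"
    then have "std_poly (k + 3) * X 0 ^ (m - 1) \<in> G" by (simp add: G_def)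
    then show "std_poly (k + 3) * X 0 ^ (m - 1) \<in> JG" using gen_G(2) by blast
  qed

  \<comment> \<open>The preimage of the elements without components of degree at most n. It is a
    T-ideal containing \<open>G\<close> and \<open>I\<close>, hence all of
    \<open>JG\<close>.\<close>
  let ?H = "{u \<in> aug. \<forall>d\<le>n. homog_part d u \<in> I}"
  have "G \<union> I \<subseteq> ?H"
    using G_aug homog_part_order_ge[OF ord] T_ideal_0[OF I] T_ideal_homogeneous[OF I] T_ideal_aug[OF I] by auto
  then have H: "JG \<subseteq> ?H"
    by (rule gen_G(3)[OF T_ideal_low_degree[OF I]])
  have span: "JF \<subseteq> {u \<in> aug. \<exists>v\<in>JG.inst_span. u - v \<in> JG}"
  proof (rule gen_F(3)[OF JG.T_ideal_inst_span_plus])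
    have "0 + scal 1 * JG.F X \<in> JG.inst_span"
      by (rule JG.inst_span_add[OF JG.inst_span_0]) simp
    then have "f \<in> JG.inst_span" by (simp add: f_def std_poly_eq_std)
    then have "f \<in> {u \<in> aug. \<exists>v\<in>JG.inst_span. u - v \<in> JG}"
      using f_aug T_ideal_0[OF gen_G(1)] by (auto intro!: bexI[of _ f])
    moreover have "I \<subseteq> {u \<in> aug. \<exists>v\<in>JG.inst_span. u - v \<in> JG}"
      using JG.inst_span_0 T_ideal_aug[OF I] gen_G(2) by (auto intro!: bexI[of _ 0])
    ultimately show "{f} \<union> I \<subseteq> {u \<in> aug. \<exists>v\<in>JG.inst_span. u - v \<in> JG}" by blast
  qed
  have JG_iff: "u \<in> JG \<longleftrightarrow> u \<in> JF \<and> u \<in> ?H" for u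
  proof
    assume u: "u \<in> JF \<and> u \<in> ?H"
    then obtain v where v: "v \<in> JG.inst_span" "u - v \<in> JG" using span by blast
    obtain w where w: "homog n w" "v - w \<in> JG"
      using JG.inst_span_homogeneous[OF v(1)] n by blast
    have uw: "u - w \<in> JG" using T_ideal_add[OF gen_G(1) v(2) w(2)] by simp
    \<comment> \<open>In degree n both u and u - w vanish modulo \<open>I\<close>; hence so does w,
      which is its own component of degree n.\<close>
    have "homog_part n u \<in> I" "homog_part n (u - w) \<in> I"
      using u uw H by blast+
    then have "homog_part n u - homog_part n (u - w) \<in> I" by (rule T_ideal_diff[OF I])
    then have "w \<in> I" using w(1) by (simp add: homog_part_diff)
    then have "w \<in> JG" using gen_G(2) by blast
    with uw show "u \<in> JG" using T_ideal_add[OF gen_G(1), of "u - w" w] by simp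
  qed (use H sub in blast)

  have rel_homog: "rel_homog_part M d (p u) = p (homog_part d u)" for d u
  proof -
    have "p (homog_part d a) = p (homog_part d u)" if "a \<in> p u" for a
      using T_ideal_homogeneous[OF I that[unfolded mem_p_iff]] by (simp add: p_eq_iff homog_part_diff)
    then show ?thesis
      unfolding rel_homog_part_def rel by (intro UN_constant_eq[OF self_mem_p] ballI)
  qed
  have "higher_consequences M n f = {U \<in> p ` JF. \<forall>d\<le>n. rel_homog_part M d U = p 0}"
    using T_ideal_gen_quot[OF f_aug] by (simp add: higher_consequences_def rel Q_zero JF_def)
  also have "\<dots> = p ` {u \<in> JF. \<forall>d\<le>n. homog_part d u \<in> I}"
  proof -
    have "(\<forall>d\<le>n. rel_homog_part M d (p u) = p 0) \<longleftrightarrow> (\<forall>d\<le>n. homog_part d u \<in> I)" for u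
      by (simp add: rel_homog p_eq_iff)
    then show ?thesis by blast
  qed
  also have "{u \<in> JF. \<forall>d\<le>n. homog_part d u \<in> I} = JG"
    using JG_iff T_ideal_aug[OF gen_F(1)] by blast
  also have "p ` JG = T_ideal_gen Q (p ` G)"
    using T_ideal_gen_quot[OF G_aug] by (simp add: JG_def)
  finally show ?thesis
    unfolding G f equivalent_to_identities_def rel .
qed

end
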